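(* Let $k$ be an algebraically closed field of characteristic zero and let $\varrho$ be a (faithful) rational action of a finite group $G$ on an $n$-dimensional irreducible variety. (i) If $\varrho$ has a fixed point, then $n\ge\mathrm{rdim}_k(G)$. (ii) If $n>\mathrm{rdim}_k(G)$, then $\varrho$ is compressible into a (faithful) rational action of a smaller dimension. (iii) If there is an $n$-dimensional faithful linear representation $\lambda\colon G\to\mathrm{GL}_n\subset\mathrm{Aut}(\mathbf A^n)$ over $k$, then either $\varrho$ is compressible into a (faithful) rational action of a smaller dimension or $\varrho$ is obtained by a nontrivial base change from the linear action $\lambda$ of the group $G$ on $\mathbf A^n$.
   Context: $\mathrm{rdim}_k(G)$ is the minimal integer $m>0$ such that there is a group embedding $G\hookrightarrow\mathrm{GL}_m(k)$. $\mathrm{GL}_n$ is the group of invertible linear maps $\mathbf A^n\to\mathbf A^n$. Varieties are algebraic varieties over $k$, and $\mathrm{Bir}(X)$ is the group of birational self-maps of an irreducible variety $X$. A (faithful) rational action of $G$ on an irreducible variety $X$ is an injective homomorphism $\varrho\colon G\hookrightarrow\mathrm{Bir}(X)$; its dimension is $\dim X$; it is regular if its image lies in $\mathrm{Aut}(X)$. A regularization of $\varrho$ is a regular action of $G$ on an irreducible smooth complete variety $Y$ such that there is a $G$-equivariant birational isomorphism $X\dashrightarrow Y$; $\varrho$ has a fixed point if there is a regularization with $Y^G\ne\varnothing$. A rational action $\varrho_1\colon G\hookrightarrow\mathrm{Bir}(X_1)$ is compressible into a rational action $\varrho_2\colon G\hookrightarrow\mathrm{Bir}(X_2)$ if there is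 a $G$-equivariant dominant rational map $\varphi\colon X_1\dashrightarrow X_2$ (a compression); in this case $\varrho_1$ is said to be obtained from $\varrho_2$ by a base change. If there is such a $\varphi$ that is not a birational isomorphism, $\varrho_1$ is said to be obtained from $\varrho_2$ by a nontrivial base change.
   Formalization: The dimension n is assumed positive; for n = 0 (the trivial group acting on a point, where rdim is 1 because m > 0 is required) parts (i) and (iii) fail as stated, and (ii) is vacuous. *)

theory Defs
  imports
    "HOL-Analysis.Abstract_Topology"
    "HOL-Library.Function_Algebras"
    "HOL-Algebra.Group"
    "HOL-Computational_Algebra.Polynomial"
    "Jordan_Normal_Form.Matrix"
begin

section \<open>Spaces with functions\<close>

text \<open>
  Varieties over the algebraically closed field \<open>'k\<close> are modelled in the classical style of
  Serre: a set of points with a topology and a sheaf of \<open>'k\<close>-valued functions, covered by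
  finitely many affine algebraic sets and separated. A section over \<open>U\<close> is represented by a total
  function of which only the values on \<open>U\<close> matter (see the axiom on agreement below);
  \<open>reg X U\<close> is meaningful only for open \<open>U\<close>.
\<close>

record ('p, 'k) fspace =
  top :: "'p topology"
  reg :: "'p set \<Rightarrow> ('p \<Rightarrow> 'k) set"

abbreviation pts :: "('p, 'k) fspace \<Rightarrow> 'p set" where
  "pts X \<equiv> topspace (top X)"

definition function_sheaf :: "('p, 'k::field) fspace \<Rightarrow> bool" where
  "function_sheaf X \<longleftrightarrow>
     (\<forall>U f g. openin (top X) U \<longrightarrow> f \<in> reg X U \<longrightarrow> (\<forall>x\<in>U. g x = f x) \<longrightarrow> g \<in> reg X U) \<and>
     (\<forall>U c. openin (top X) U \<longrightarrow> (\<lambda>_. c) \<in> reg X U) \<and>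
     (\<forall>U f g. openin (top X) U \<longrightarrow> f \<in> reg X U \<longrightarrow> g \<in> reg X U \<longrightarrow>
        (\<lambda>x. f x + g x) \<in> reg X U \<and> (\<lambda>x. f x * g x) \<in> reg X U) \<and>
     (\<forall>U V f. openin (top X) U \<longrightarrow> openin (top X) V \<longrightarrow> V \<subseteq> U \<longrightarrow> f \<in> reg X U \<longrightarrow> f \<in> reg X V) \<and>
     (\<forall>\<U> f. (\<forall>U\<in>\<U>. openin (top X) U \<and> f \<in> reg X U) \<longrightarrow> f \<in> reg X (\<Union>\<U>))"

definition open_sub :: "('p, 'k) fspace \<Rightarrow> 'p set \<Rightarrow> ('p, 'k) fspace" where
  "open_sub X U = \<lparr>top = subtopology (top X) U, reg = reg X\<rparr>"

definition morphism :: "('p, 'k) fspace \<Rightarrow> ('q, 'k) fspace \<Rightarrow> ('p \<Rightarrow> 'q) \<Rightarrow> bool" where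
  "morphism X Y \<phi> \<longleftrightarrow>
     continuous_map (top X) (top Y) \<phi> \<and>
     (\<forall>V f. openin (top Y) V \<longrightarrow> f \<in> reg Y V \<longrightarrow> (f \<circ> \<phi>) \<in> reg X {x \<in> pts X. \<phi> x \<in> V})"

definition iso_pair ::
  "('p, 'k) fspace \<Rightarrow> ('q, 'k) fspace \<Rightarrow> ('p \<Rightarrow> 'q) \<Rightarrow> ('q \<Rightarrow> 'p) \<Rightarrow> bool" where
  "iso_pair X Y \<phi> \<psi> \<longleftrightarrow>
     morphism X Y \<phi> \<and> morphism Y X \<psi> \<and>
     (\<forall>x\<in>pts X. \<psi> (\<phi> x) = x) \<and> (\<forall>y\<in>pts Y. \<phi> (\<psi> y) = y)"

definition isomorphic :: "('p, 'k) fspace \<Rightarrow> ('q, 'k) fspace \<Rightarrow> bool" where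
  "isomorphic X Y \<longleftrightarrow> (\<exists>\<phi> \<psi>. iso_pair X Y \<phi> \<psi>)"

definition automorphism :: "('p, 'k) fspace \<Rightarrow> ('p \<Rightarrow> 'p) \<Rightarrow> bool" where
  "automorphism X \<phi> \<longleftrightarrow> (\<exists>\<psi>. iso_pair X X \<phi> \<psi>)"


section \<open>Affine algebraic sets\<close>

text \<open>Points of affine \<open>n\<close>-space are the elements of \<^term>\<open>carrier_vec n\<close>.\<close>

inductive_set poly_fun :: "nat \<Rightarrow> ('k::field vec \<Rightarrow> 'k) set" for n :: nat where
  const: "(\<lambda>_. c) \<in> poly_fun n"
| coord: "i < n \<Longrightarrow> (\<lambda>v. v $ i) \<in> poly_fun n"
| add: "p \<in> poly_fun n \<Longrightarrow> q \<in> poly_fun n \<Longrightarrow> (\<lambda>v. p v + q v) \<in> poly_fun n"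
| mult: "p \<in> poly_fun n \<Longrightarrow> q \<in> poly_fun n \<Longrightarrow> (\<lambda>v. p v * q v) \<in> poly_fun n"

definition algebraic_set :: "nat \<Rightarrow> 'k::field vec set \<Rightarrow> bool" where
  "algebraic_set n Z \<longleftrightarrow> (\<exists>S \<subseteq> poly_fun n. Z = {v \<in> carrier_vec n. \<forall>p\<in>S. p v = 0})"

definition zariski :: "nat \<Rightarrow> 'k::field vec set \<Rightarrow> 'k vec topology" where
  "zariski n Z = topology_generated_by {{v \<in> Z. p v \<noteq> 0} | p. p \<in> poly_fun n}"

definition affine_variety :: "nat \<Rightarrow> 'k::field vec set \<Rightarrow> ('k vec, 'k) fspace" where
  "affine_variety n Z =
     \<lparr>top = zariski n Z,
      reg = (\<lambda>U. {f. \<forall>x\<in>U. \<exists>W p q. openin (zariski n Z) W \<and> x \<in> W \<and> W \<subseteq> U \<and>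
                     p \<in> poly_fun n \<and> q \<in> poly_fun n \<and> (\<forall>y\<in>W. q y \<noteq> 0 \<and> f y = p y / q y)})\<rparr>"

definition affine_space :: "nat \<Rightarrow> ('k::field vec, 'k) fspace" where
  "affine_space n = affine_variety n (carrier_vec n)"


section \<open>Varieties\<close>

definition prevariety :: "('p, 'k::field) fspace \<Rightarrow> bool" where
  "prevariety X \<longleftrightarrow>
     function_sheaf X \<and>
     (\<exists>\<U>. finite \<U> \<and> \<Union>\<U> = pts X \<and>
        (\<forall>U\<in>\<U>. openin (top X) U \<and>
           (\<exists>n Z. algebraic_set n Z \<and> isomorphic (open_sub X U) (affine_variety n Z))))"

text \<open>
  The Zariski topology of the product variety: its basic open sets are the non-vanishing loci in
  \<open>U \<times> V\<close> of elements of the tensor product of \<open>reg X U\<close> and \<open>reg Y V\<close>.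
\<close>

definition prod_zariski :: "('p, 'k::field) fspace \<Rightarrow> ('q, 'k) fspace \<Rightarrow> ('p \<times> 'q) topology" where
  "prod_zariski X Y = topology_generated_by
     {{(x, y). x \<in> U \<and> y \<in> V \<and> (\<Sum>i<r. f i x * g i y) \<noteq> 0} | U V r f g.
        openin (top X) U \<and> openin (top Y) V \<and> (\<forall>i<(r::nat). f i \<in> reg X U \<and> g i \<in> reg Y V)}"

definition variety :: "('p, 'k::field) fspace \<Rightarrow> bool" where
  "variety X \<longleftrightarrow> prevariety X \<and> closedin (prod_zariski X X) {(x, x) | x. x \<in> pts X}"

definition irreducible_variety :: "('p, 'k::field) fspace \<Rightarrow> bool" where
  "irreducible_variety X \<longleftrightarrow>
     variety X \<and> pts X \<noteq> {} \<and>
     (\<forall>A B. closedin (top X) A \<longrightarrow> closedin (top X) B \<longrightarrow> A \<union> B = pts X \<longrightarrow>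
        A = pts X \<or> B = pts X)"

text \<open>
  Test varieties \<open>Z\<close> with points in \<^typ>\<open>'k vec\<close> suffice: a variety over an algebraically closed
  field \<open>'k\<close> has at most as many points as \<open>'k\<close> has elements, so each variety is isomorphic to
  one whose points lie in \<^typ>\<open>'k vec\<close>. The same holds wherever a variety is existentially
  quantified below.
\<close>

definition complete_variety :: "('p, 'k::field) fspace \<Rightarrow> bool" where
  "complete_variety X \<longleftrightarrow>
     variety X \<and>
     (\<forall>Z :: ('k vec, 'k) fspace. variety Z \<longrightarrow>
        (\<forall>C. closedin (prod_zariski X Z) C \<longrightarrow> closedin (top Z) (snd ` C)))"

text \<open>
  The dimension of an irreducible variety is the transcendence degree of its field of rational
  functions, that is, the greatest number of algebraically independent rational functions.
  Finitely many rational functions are given by regular functions on a common nonempty open set.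
  Over an infinite field a polynomial is zero iff its polynomial function is.
\<close>

definition alg_indep_on :: "'p set \<Rightarrow> nat \<Rightarrow> (nat \<Rightarrow> 'p \<Rightarrow> 'k::field) \<Rightarrow> bool" where
  "alg_indep_on U m f \<longleftrightarrow>
     (\<forall>p \<in> poly_fun m. (\<forall>x\<in>U. p (vec m (\<lambda>i. f i x)) = 0) \<longrightarrow> (\<forall>v\<in>carrier_vec m. p v = 0))"

definition vdim :: "('p, 'k::field) fspace \<Rightarrow> nat" where
  "vdim X = (GREATEST m. \<exists>U f. openin (top X) U \<and> U \<noteq> {} \<and> (\<forall>i<m. f i \<in> reg X U) \<and>
                                alg_indep_on U m f)"

text \<open>
  The tangent space at \<open>x\<close> consists of the point derivations of the local ring at \<open>x\<close>. A germ is
  represented by any total function that is regular near \<open>x\<close>; a derivation is constant on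
  representatives of a germ, and is set to zero on functions that do not represent a germ.
\<close>

definition regular_near :: "('p, 'k::field) fspace \<Rightarrow> 'p \<Rightarrow> ('p \<Rightarrow> 'k) set" where
  "regular_near X x = {f. \<exists>U. openin (top X) U \<and> x \<in> U \<and> f \<in> reg X U}"

definition tangent_space :: "('p, 'k::field) fspace \<Rightarrow> 'p \<Rightarrow> (('p \<Rightarrow> 'k) \<Rightarrow> 'k) set" where
  "tangent_space X x = {D.
     (\<forall>f. f \<notin> regular_near X x \<longrightarrow> D f = 0) \<and>
     (\<forall>f\<in>regular_near X x. \<forall>g\<in>regular_near X x.
        (\<exists>W. openin (top X) W \<and> x \<in> W \<and> (\<forall>y\<in>W. f y = g y)) \<longrightarrow> D f = D g) \<and>
     (\<forall>f\<in>regular_near X x. \<forall>g\<in>regular_near X x. D (\<lambda>y. f y + g y) = D f + D g) \<and>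
     (\<forall>c. \<forall>f\<in>regular_near X x. D (\<lambda>y. c * f y) = c * D f) \<and>
     (\<forall>f\<in>regular_near X x. \<forall>g\<in>regular_near X x.
        D (\<lambda>y. f y * g y) = f x * D g + g x * D f)}"

definition fun_scale :: "'k::field \<Rightarrow> ('a \<Rightarrow> 'k) \<Rightarrow> 'a \<Rightarrow> 'k" where
  "fun_scale c D = (\<lambda>f. c * D f)"

lemma vector_space_fun_scale: "vector_space fun_scale"
  by unfold_locales (auto simp: fun_scale_def fun_eq_iff algebra_simps)

definition smooth_variety :: "('p, 'k::field) fspace \<Rightarrow> bool" where
  "smooth_variety X \<longleftrightarrow>
     irreducible_variety X \<and> (\<forall>x\<in>pts X. vector_space.dim fun_scale (tangent_space X x) = vdim X)"


section \<open>Rational maps\<close>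

text \<open>
  For irreducible \<open>X\<close>, a rational map from \<open>X\<close> to \<open>Y\<close> is an equivalence class of morphisms
  defined on nonempty open subsets of \<open>X\<close>.
\<close>

definition rat_reps ::
  "('p, 'k) fspace \<Rightarrow> ('q, 'k) fspace \<Rightarrow> ('p set \<times> ('p \<Rightarrow> 'q)) set" where
  "rat_reps X Y = {(U, \<phi>). openin (top X) U \<and> U \<noteq> {} \<and> morphism (open_sub X U) Y \<phi>}"

definition rat_eq ::
  "('p, 'k) fspace \<Rightarrow> ('q, 'k) fspace \<Rightarrow> ('p set \<times> ('p \<Rightarrow> 'q)) rel" where
  "rat_eq X Y = {((U, \<phi>), (V, \<psi>)). (U, \<phi>) \<in> rat_reps X Y \<and> (V, \<psi>) \<in> rat_reps X Y \<and>
                                     (\<forall>x\<in>U \<inter> V. \<phi> x = \<psi> x)}"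

type_synonym ('p, 'q) rat_map = "('p set \<times> ('p \<Rightarrow> 'q)) set"

definition rat_maps :: "('p, 'k) fspace \<Rightarrow> ('q, 'k) fspace \<Rightarrow> ('p, 'q) rat_map set" where
  "rat_maps X Y = rat_reps X Y // rat_eq X Y"

definition rat_of :: "('p, 'k) fspace \<Rightarrow> ('q, 'k) fspace \<Rightarrow> ('p \<Rightarrow> 'q) \<Rightarrow> ('p, 'q) rat_map" where
  "rat_of X Y \<phi> = rat_eq X Y `` {(pts X, \<phi>)}"

definition dominant :: "('q, 'k) fspace \<Rightarrow> ('p, 'q) rat_map \<Rightarrow> bool" where
  "dominant Y c \<longleftrightarrow> (\<forall>(U, \<phi>) \<in> c. (top Y) closure_of (\<phi> ` U) = pts Y)"

text \<open>Composition of \<open>d\<close> after \<open>c\<close>; only used for dominant \<open>c\<close>.\<close>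

definition rat_comp ::
  "('p, 'k) fspace \<Rightarrow> ('r, 'k) fspace \<Rightarrow> ('q, 'r) rat_map \<Rightarrow> ('p, 'q) rat_map \<Rightarrow> ('p, 'r) rat_map" where
  "rat_comp X Z d c =
     rat_eq X Z `` {(U \<inter> \<phi> -` V, \<psi> \<circ> \<phi>) | U \<phi> V \<psi>. (U, \<phi>) \<in> c \<and> (V, \<psi>) \<in> d}"

definition birational :: "('p, 'k) fspace \<Rightarrow> ('q, 'k) fspace \<Rightarrow> ('p, 'q) rat_map \<Rightarrow> bool" where
  "birational X Y c \<longleftrightarrow>
     c \<in> rat_maps X Y \<and> dominant Y c \<and>
     (\<exists>d \<in> rat_maps Y X. dominant X d \<and>
        rat_comp X X d c = rat_of X X id \<and> rat_comp Y Y c d = rat_of Y Y id)"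

definition Bir :: "('p, 'k) fspace \<Rightarrow> ('p, 'p) rat_map monoid" where
  "Bir X = \<lparr>carrier = {c. birational X X c}, mult = rat_comp X X, one = rat_of X X id\<rparr>"


section \<open>Rational actions\<close>

definition rational_action ::
  "('g, 'b) monoid_scheme \<Rightarrow> ('p, 'k::field) fspace \<Rightarrow> ('g \<Rightarrow> ('p, 'p) rat_map) \<Rightarrow> bool" where
  "rational_action G X \<rho> \<longleftrightarrow>
     irreducible_variety X \<and> \<rho> \<in> hom G (Bir X) \<and> inj_on \<rho> (carrier G)"

definition regular_action ::
  "('g, 'b) monoid_scheme \<Rightarrow> ('p, 'k::field) fspace \<Rightarrow> ('g \<Rightarrow> ('p, 'p) rat_map) \<Rightarrow> bool" where
  "regular_action G X \<rho> \<longleftrightarrow>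
     rational_action G X \<rho> \<and>
     (\<forall>g\<in>carrier G. \<exists>\<phi>. automorphism X \<phi> \<and> \<rho> g = rat_of X X \<phi>)"

definition fixed_points ::
  "('g, 'b) monoid_scheme \<Rightarrow> ('p, 'k::field) fspace \<Rightarrow> ('g \<Rightarrow> ('p, 'p) rat_map) \<Rightarrow> 'p set" where
  "fixed_points G X \<rho> =
     {x \<in> pts X. \<forall>g\<in>carrier G. \<exists>\<phi>. automorphism X \<phi> \<and> \<rho> g = rat_of X X \<phi> \<and> \<phi> x = x}"

definition equivariant ::
  "('g, 'b) monoid_scheme \<Rightarrow> ('p, 'k::field) fspace \<Rightarrow> ('g \<Rightarrow> ('p, 'p) rat_map) \<Rightarrow>
   ('q, 'k) fspace \<Rightarrow> ('g \<Rightarrow> ('q, 'q) rat_map) \<Rightarrow> ('p, 'q) rat_map \<Rightarrow> bool" where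
  "equivariant G X \<rho> Y \<sigma> c \<longleftrightarrow>
     (\<forall>g\<in>carrier G. rat_comp X Y c (\<rho> g) = rat_comp X Y (\<sigma> g) c)"

definition regularization ::
  "('g, 'b) monoid_scheme \<Rightarrow> ('p, 'k::field) fspace \<Rightarrow> ('g \<Rightarrow> ('p, 'p) rat_map) \<Rightarrow>
   ('q, 'k) fspace \<Rightarrow> ('g \<Rightarrow> ('q, 'q) rat_map) \<Rightarrow> bool" where
  "regularization G X \<rho> Y \<sigma> \<longleftrightarrow>
     regular_action G Y \<sigma> \<and> smooth_variety Y \<and> complete_variety Y \<and>
     (\<exists>c. birational X Y c \<and> equivariant G X \<rho> Y \<sigma> c)"

definition has_fixed_point ::
  "('g, 'b) monoid_scheme \<Rightarrow> ('p, 'k::field) fspace \<Rightarrow> ('g \<Rightarrow> ('p, 'p) rat_map) \<Rightarrow> bool" where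
  "has_fixed_point G X \<rho> \<longleftrightarrow>
     (\<exists>(Y :: ('k vec, 'k) fspace) \<sigma>. regularization G X \<rho> Y \<sigma> \<and> fixed_points G Y \<sigma> \<noteq> {})"

definition compression ::
  "('g, 'b) monoid_scheme \<Rightarrow> ('p, 'k::field) fspace \<Rightarrow> ('g \<Rightarrow> ('p, 'p) rat_map) \<Rightarrow>
   ('q, 'k) fspace \<Rightarrow> ('g \<Rightarrow> ('q, 'q) rat_map) \<Rightarrow> ('p, 'q) rat_map \<Rightarrow> bool" where
  "compression G X \<rho> Y \<sigma> c \<longleftrightarrow> c \<in> rat_maps X Y \<and> dominant Y c \<and> equivariant G X \<rho> Y \<sigma> c"

definition compressible_into ::
  "('g, 'b) monoid_scheme \<Rightarrow> ('p, 'k::field) fspace \<Rightarrow> ('g \<Rightarrow> ('p, 'p) rat_map) \<Rightarrow>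
   ('q, 'k) fspace \<Rightarrow> ('g \<Rightarrow> ('q, 'q) rat_map) \<Rightarrow> bool" where
  "compressible_into G X \<rho> Y \<sigma> \<longleftrightarrow> (\<exists>c. compression G X \<rho> Y \<sigma> c)"

definition compressible_to_smaller_dim ::
  "('g, 'b) monoid_scheme \<Rightarrow> ('p, 'k::field) fspace \<Rightarrow> ('g \<Rightarrow> ('p, 'p) rat_map) \<Rightarrow> bool" where
  "compressible_to_smaller_dim G X \<rho> \<longleftrightarrow>
     (\<exists>(Y :: ('k vec, 'k) fspace) \<sigma>.
        rational_action G Y \<sigma> \<and> vdim Y < vdim X \<and> compressible_into G X \<rho> Y \<sigma>)"

definition nontrivial_base_change ::
  "('g, 'b) monoid_scheme \<Rightarrow> ('p, 'k::field) fspace \<Rightarrow> ('g \<Rightarrow> ('p, 'p) rat_map) \<Rightarrow>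
   ('q, 'k) fspace \<Rightarrow> ('g \<Rightarrow> ('q, 'q) rat_map) \<Rightarrow> bool" where
  "nontrivial_base_change G X \<rho> Y \<sigma> \<longleftrightarrow>
     (\<exists>c. compression G X \<rho> Y \<sigma> c \<and> \<not> birational X Y c)"


section \<open>Linear representations\<close>

definition GL :: "nat \<Rightarrow> 'k::field mat monoid" where
  "GL n = units_of (ring_mat TYPE('k) n ())"

definition faithful_rep ::
  "('g, 'b) monoid_scheme \<Rightarrow> nat \<Rightarrow> ('g \<Rightarrow> 'k::field mat) \<Rightarrow> bool" where
  "faithful_rep G n r \<longleftrightarrow> r \<in> hom G (GL n) \<and> inj_on r (carrier G)"

definition rdim :: "'k::field itself \<Rightarrow> ('g, 'b) monoid_scheme \<Rightarrow> nat" where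
  "rdim K G = (LEAST m. m > 0 \<and> (\<exists>r :: 'g \<Rightarrow> 'k mat. faithful_rep G m r))"

definition linear_action ::
  "nat \<Rightarrow> ('g \<Rightarrow> 'k::field mat) \<Rightarrow> 'g \<Rightarrow> ('k vec, 'k vec) rat_map" where
  "linear_action n r = (\<lambda>g. rat_of (affine_space n) (affine_space n) (\<lambda>v. r g *\<^sub>v v))"

end

theory Submission
  imports
    Defs
    "HOL-Analysis.Abstract_Limits"
    "HOL-Algebra.Multiplicative_Group"
    "Jordan_Normal_Form.Determinant"
begin

text \<open>
  For (i), let \<open>y\<close> be a fixed point of a regularization. If \<open>g\<close> acts trivially on the tangent space
  at \<open>y\<close>, then \<open>1 - g\<close> maps the maximal ideal \<open>M\<close> of the local ring into \<open>M\<^sup>2\<close>. As \<open>g\<close> has finite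
  order and the characteristic is zero, the ideal \<open>J\<close> generated by the image of \<open>1 - g\<close> then satisfies
  \<open>J = M J\<close>, and Nakayama's lemma gives \<open>g = 1\<close>. So the tangent representation, whose dimension is \<open>n\<close>
  by smoothness, is faithful.

  For (ii) and (iii), restrict the action to an invariant open subset \<open>W\<close> of an affine chart. Averaging
  yields, for every faithful linear representation on \<open>k\<^sup>m\<close>, an equivariant map \<open>\<phi>\<close> from \<open>W\<close> to \<open>k\<^sup>m\<close> that
  sends some point to a vector with trivial stabilizer, so \<open>G\<close> acts faithfully on the closure of the
  image. That closure has dimension at most \<open>m\<close>, and less if it is not all of \<open>k\<^sup>m\<close>. If \<open>m = n\<close> and \<open>\<phi>\<close> is
  dominant, compose it with \<open>v \<mapsto> f v \<cdot> v\<close>, where \<open>f\<close> is an invariant form of degree \<open>d > 0\<close>: this is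
  dominant, equivariant and of degree \<open>d + 1\<close>, hence not birational.
\<close>

section \<open>Polynomial functions\<close>

text \<open>The link between the tangent space and J = M J is that the operator sending f to f - f o
  g obeys a twisted product rule: its values on finitely many coordinates therefore generate J, and
  it maps the square of M into M J. Rational actions are classes of partial maps; for a finite group
  on an irreducible variety there is one nonempty open \<open>W\<close> on which chosen
  representatives compose as honest maps. Dimension is defined by algebraically independent
  functions, so both dimension bounds come from counting: clearing denominators puts
  \<open>(N + 1) ^ l\<close> independent functions into a space spanned by at most
  \<open>(D * N + 1) ^ n\<close> monomials, which forces \<open>l \<le> n\<close>. If a nonzero
  polynomial vanishes on the closure, its multiples already occupy all of that space up to a term of
  order n - 1 in N, which forces \<open>l < n\<close>. The averaged map \<phi> may itself be
  birational, so nontriviality has to be manufactured: multiplication by an invariant form commutes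
  with the linear action, and it reaches every vector at which the form is nonzero because (d +
  1)-st roots exist.\<close>

lemma poly_fun_smult: "p \<in> poly_fun n \<Longrightarrow> (\<lambda>v. c * p v) \<in> poly_fun n"
  using poly_fun.mult[OF poly_fun.const[of c]] by simp

lemma poly_fun_diff:
  assumes "p \<in> poly_fun n" "q \<in> poly_fun n"
  shows "(\<lambda>v. p v - q v) \<in> poly_fun n"
  using poly_fun.add[OF assms(1) poly_fun_smult[OF assms(2), of "-1"]] by simp

lemma poly_fun_sum:
  assumes "\<And>i. i \<in> I \<Longrightarrow> f i \<in> poly_fun n"
  shows "(\<lambda>v. \<Sum>i\<in>I. f i v) \<in> poly_fun n"
  using assms by (induction I rule: infinite_finite_induct) (auto intro: poly_fun.intros)

lemma poly_fun_prod:
  assumes "\<And>i. i \<in> I \<Longrightarrow> f i \<in> poly_fun n"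
  shows "(\<lambda>v. \<Prod>i\<in>I. f i v) \<in> poly_fun n"
  using assms by (induction I rule: infinite_finite_induct) (auto intro: poly_fun.intros)

lemma poly_fun_compose:
  assumes "p \<in> poly_fun m" "\<And>i. i < m \<Longrightarrow> f i \<in> poly_fun n"
  shows "(\<lambda>v. p (vec m (\<lambda>i. f i v))) \<in> poly_fun n"
  using assms by (induction rule: poly_fun.induct) (auto intro: poly_fun.intros)

lemma poly_fun_agree:
  assumes "p \<in> poly_fun n" "\<And>i. i < n \<Longrightarrow> v $ i = w $ i"
  shows "p v = p w"
  using assms by (induction rule: poly_fun.induct) auto

text \<open>Restriction to a line passes from polynomial functions, which carry no coefficients, to
  genuine univariate polynomials. This supplies both the absence of zero divisors and the degree
  comparison against birationality.\<close>

lemma poly_fun_line: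
  assumes "p \<in> poly_fun n"
  shows "\<exists>P. \<forall>t. poly P t = p (vec n (\<lambda>i. a i + t * b i))"
  using assms
proof (induction rule: poly_fun.induct)
  case (const c)
  show ?case by (rule exI[of _ "[:c:]"]) simp
next
  case (coord i)
  then show ?case by (intro exI[of _ "[:a i, b i:]"]) simp
next
  case (add p q)
  then obtain P Q where "\<forall>t. poly P t = p (vec n (\<lambda>i. a i + t * b i))"
    "\<forall>t. poly Q t = q (vec n (\<lambda>i. a i + t * b i))" by blast
  then show ?case by (intro exI[of _ "P + Q"]) simp
next
  case (mult p q)
  then obtain P Q where "\<forall>t. poly P t = p (vec n (\<lambda>i. a i + t * b i))"
    "\<forall>t. poly Q t = q (vec n (\<lambda>i. a i + t * b i))" by blast
  then show ?case by (intro exI[of _ "P * Q"]) simp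
qed

text \<open>On the line joining \<open>a\<close> and \<open>b\<close> both restrictions are nonzero
  polynomials, one by its value at 0 and the other at 1; their product is nonzero and has a non-root
  because the field is infinite.\<close>

lemma poly_fun_no_zero_divisors:
  fixes p q :: "'k :: field_char_0 vec \<Rightarrow> 'k"
  assumes p: "p \<in> poly_fun n" and q: "q \<in> poly_fun n"
    and a: "a \<in> carrier_vec n" "p a \<noteq> 0" and b: "b \<in> carrier_vec n" "q b \<noteq> 0"
  shows "\<exists>v\<in>carrier_vec n. p v \<noteq> 0 \<and> q v \<noteq> 0"
proof -
  define l where "l t = vec n (\<lambda>i. a $ i + t * (b $ i - a $ i))" for t
  obtain P where P: "poly P t = p (l t)" for t
    unfolding l_def using poly_fun_line[OF p, of "\<lambda>i. a $ i" "\<lambda>i. b $ i - a $ i"] by blast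
  obtain Q where Q: "poly Q t = q (l t)" for t
    unfolding l_def using poly_fun_line[OF q, of "\<lambda>i. a $ i" "\<lambda>i. b $ i - a $ i"] by blast
  have l0: "l 0 = a" and l1: "l 1 = b" using a b by (auto simp: l_def)
  have "P \<noteq> 0" using P[of 0] a l0 by auto
  moreover have "Q \<noteq> 0" using Q[of 1] b l1 by auto
  ultimately have "P * Q \<noteq> 0" by simp
  then obtain t where "poly (P * Q) t \<noteq> 0" using poly_all_0_iff_0 by blast
  then have "p (l t) \<noteq> 0 \<and> q (l t) \<noteq> 0" using P Q by simp
  moreover have "l t \<in> carrier_vec n" by (simp add: l_def)
  ultimately show ?thesis by blast
qed


section \<open>Charts\<close>

text \<open>Principal open sets are closed under intersection, by multiplying the polynomials, so
  the generating family is already a base.\<close>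

lemma openin_zariski:
  "openin (zariski n Z) U \<longleftrightarrow>
     U \<subseteq> Z \<and> (\<forall>x\<in>U. \<exists>p\<in>poly_fun n. p x \<noteq> 0 \<and> {v \<in> Z. p v \<noteq> 0} \<subseteq> U)"
proof
  assume "openin (zariski n Z) U"
  then have "generate_topology_on {{v \<in> Z. p v \<noteq> 0} | p. p \<in> poly_fun n} U"
    unfolding zariski_def openin_topology_generated_by_iff .
  then show "U \<subseteq> Z \<and> (\<forall>x\<in>U. \<exists>p\<in>poly_fun n. p x \<noteq> 0 \<and> {v \<in> Z. p v \<noteq> 0} \<subseteq> U)"
  proof (induction rule: generate_topology_on.induct)
    case (Int a b)
    show ?case
    proof (intro conjI ballI)
      show "a \<inter> b \<subseteq> Z" using Int by blast
      fix x assume "x \<in> a \<inter> b"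
      then obtain p q where pq: "p \<in> poly_fun n" "p x \<noteq> 0" "{v \<in> Z. p v \<noteq> 0} \<subseteq> a"
         "q \<in> poly_fun n" "q x \<noteq> 0" "{v \<in> Z. q v \<noteq> 0} \<subseteq> b"
        using Int by blast
      then show "\<exists>p\<in>poly_fun n. p x \<noteq> 0 \<and> {v \<in> Z. p v \<noteq> 0} \<subseteq> a \<inter> b"
        by (intro bexI[of _ "\<lambda>v. p v * q v"]) (auto intro: poly_fun.mult)
    qed
  next
    case (UN K)
    then show ?case by (meson Sup_least Union_iff Union_upper subset_trans)
  qed auto
next
  assume U: "U \<subseteq> Z \<and> (\<forall>x\<in>U. \<exists>p\<in>poly_fun n. p x \<noteq> 0 \<and> {v \<in> Z. p v \<noteq> 0} \<subseteq> U)"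
  have "\<exists>T. openin (zariski n Z) T \<and> x \<in> T \<and> T \<subseteq> U" if "x \<in> U" for x
  proof -
    obtain p where p: "p \<in> poly_fun n" "p x \<noteq> 0" "{v \<in> Z. p v \<noteq> 0} \<subseteq> U" using U \<open>x \<in> U\<close> by blast
    have "openin (zariski n Z) {v \<in> Z. p v \<noteq> 0}"
      unfolding zariski_def by (rule topology_generated_by_Basis) (use p in auto)
    then show ?thesis using p U that by blast
  qed
  then show "openin (zariski n Z) U" using openin_subopen by metis
qed

lemma openin_zariski_basic: "p \<in> poly_fun n \<Longrightarrow> openin (zariski n Z) {v \<in> Z. p v \<noteq> 0}"
  unfolding openin_zariski by auto

lemma topspace_zariski [simp]: "topspace (zariski n Z) = Z"
proof (rule subset_antisym)
  show "topspace (zariski n Z) \<subseteq> Z" using openin_topspace openin_zariski by metis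
  have "openin (zariski n Z) {v \<in> Z. (\<lambda>_. 1) v \<noteq> (0 :: 'a)}"
    by (rule openin_zariski_basic) (rule poly_fun.const)
  then have "openin (zariski n Z) Z" by simp
  then show "Z \<subseteq> topspace (zariski n Z)" using openin_subset by metis
qed

lemma top_affine_variety [simp]: "top (affine_variety n Z) = zariski n Z"
  by (simp add: affine_variety_def)

lemma reg_affine_variety:
  "reg (affine_variety n Z) U = {f. \<forall>x\<in>U. \<exists>W p q. openin (zariski n Z) W \<and> x \<in> W \<and> W \<subseteq> U \<and>
                     p \<in> poly_fun n \<and> q \<in> poly_fun n \<and> (\<forall>y\<in>W. q y \<noteq> 0 \<and> f y = p y / q y)}"
  by (simp add: affine_variety_def)

lemma open_sub_simps [simp]:
  "top (open_sub X U) = subtopology (top X) U" "reg (open_sub X U) = reg X"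
  by (auto simp: open_sub_def)

lemma open_sub_pts [simp]: "open_sub X (pts X) = (X :: ('p, 'k) fspace)"
  by (simp add: open_sub_def)

lemma algebraic_set_carrier: "algebraic_set n Z \<Longrightarrow> Z \<subseteq> carrier_vec n"
  by (auto simp: algebraic_set_def)

lemma
  assumes X: "function_sheaf X" and U: "openin (top X) U"
  shows reg_cong: "f \<in> reg X U \<Longrightarrow> (\<And>x. x \<in> U \<Longrightarrow> g x = f x) \<Longrightarrow> g \<in> reg X U"
    and reg_const: "(\<lambda>_. c) \<in> reg X U"
    and reg_add: "f \<in> reg X U \<Longrightarrow> g \<in> reg X U \<Longrightarrow> (\<lambda>x. f x + g x) \<in> reg X U"
    and reg_mult: "f \<in> reg X U \<Longrightarrow> g \<in> reg X U \<Longrightarrow> (\<lambda>x. f x * g x) \<in> reg X U"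
    and reg_mono: "openin (top X) V \<Longrightarrow> V \<subseteq> U \<Longrightarrow> f \<in> reg X U \<Longrightarrow> f \<in> reg X V"
proof -
  note sheaf = X[unfolded function_sheaf_def]
  note 1 = conjunct1[OF sheaf] and 2 = conjunct2[OF sheaf]
  note 3 = conjunct1[OF conjunct2[OF 2]] and 4 = conjunct1[OF conjunct2[OF conjunct2[OF 2]]]
  show "f \<in> reg X U \<Longrightarrow> (\<And>x. x \<in> U \<Longrightarrow> g x = f x) \<Longrightarrow> g \<in> reg X U"
    by (rule 1[rule_format, OF U]) auto
  show "(\<lambda>_. c) \<in> reg X U" by (rule conjunct1[OF 2, rule_format, OF U])
  show "f \<in> reg X U \<Longrightarrow> g \<in> reg X U \<Longrightarrow> (\<lambda>x. f x + g x) \<in> reg X U"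
    by (rule 3[rule_format, OF U, THEN conjunct1])
  show "f \<in> reg X U \<Longrightarrow> g \<in> reg X U \<Longrightarrow> (\<lambda>x. f x * g x) \<in> reg X U"
    by (rule 3[rule_format, OF U, THEN conjunct2])
  show "openin (top X) V \<Longrightarrow> V \<subseteq> U \<Longrightarrow> f \<in> reg X U \<Longrightarrow> f \<in> reg X V"
    by (rule 4[rule_format, OF U])
qed

lemma reg_Union:
  assumes X: "function_sheaf X" and "\<And>U. U \<in> \<U> \<Longrightarrow> openin (top X) U" "\<And>U. U \<in> \<U> \<Longrightarrow> f \<in> reg X U"
  shows "f \<in> reg X (\<Union>\<U>)"
  using X[unfolded function_sheaf_def, THEN conjunct2, THEN conjunct2, THEN conjunct2, THEN conjunct2,
      rule_format, of \<U> f] assms(2,3) by blast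

text \<open>An isomorphism of an open piece with an affine algebraic set, seen from \<open>X\<close>
  alone: coordinates separate points, quotients of polynomials are regular, and conversely regular
  functions are locally such quotients. In the last clause nonvanishing of the single denominator
  \<open>q\<close> both places \<open>x\<close> in \<open>U\<close> and validates the formula for
  \<open>f\<close>.\<close>

definition chart :: "('p, 'k::field) fspace \<Rightarrow> 'p set \<Rightarrow> nat \<Rightarrow> ('p \<Rightarrow> 'k vec) \<Rightarrow> bool" where
  "chart X A n \<xi> \<longleftrightarrow> openin (top X) A \<and> inj_on \<xi> A \<and> \<xi> ` A \<subseteq> carrier_vec n \<and>
     (\<forall>p\<in>poly_fun n. \<forall>q\<in>poly_fun n. openin (top X) {x \<in> A. q (\<xi> x) \<noteq> 0} \<and>
        (\<lambda>x. p (\<xi> x) / q (\<xi> x)) \<in> reg X {x \<in> A. q (\<xi> x) \<noteq> 0}) \<and>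
     (\<forall>U f z. openin (top X) U \<longrightarrow> f \<in> reg X U \<longrightarrow> z \<in> U \<inter> A \<longrightarrow>
        (\<exists>p\<in>poly_fun n. \<exists>q\<in>poly_fun n. q (\<xi> z) \<noteq> 0 \<and>
           (\<forall>x\<in>A. q (\<xi> x) \<noteq> 0 \<longrightarrow> x \<in> U \<and> f x = p (\<xi> x) / q (\<xi> x))))"

lemma chart_openin: "chart X A n \<xi> \<Longrightarrow> openin (top X) A"
  and chart_inj: "chart X A n \<xi> \<Longrightarrow> inj_on \<xi> A"
  and chart_carrier: "chart X A n \<xi> \<Longrightarrow> x \<in> A \<Longrightarrow> \<xi> x \<in> carrier_vec n"
  and chart_basic: "chart X A n \<xi> \<Longrightarrow> q \<in> poly_fun n \<Longrightarrow> openin (top X) {x \<in> A. q (\<xi> x) \<noteq> 0}"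
  by (auto simp: chart_def)

lemma chart_reg:
  "chart X A n \<xi> \<Longrightarrow> p \<in> poly_fun n \<Longrightarrow> q \<in> poly_fun n \<Longrightarrow>
     (\<lambda>x. p (\<xi> x) / q (\<xi> x)) \<in> reg X {x \<in> A. q (\<xi> x) \<noteq> 0}"
  by (auto simp: chart_def)

lemma chart_reg_poly:
  assumes "chart X A n \<xi>" "p \<in> poly_fun n"
  shows "(\<lambda>x. p (\<xi> x)) \<in> reg X A"
  using chart_reg[OF assms poly_fun.const[of 1]] by simp

lemma chart_local:
  assumes "chart X A n \<xi>" "openin (top X) U" "f \<in> reg X U" "z \<in> U" "z \<in> A"
  obtains p q where "p \<in> poly_fun n" "q \<in> poly_fun n" "q (\<xi> z) \<noteq> 0"
    "\<And>x. x \<in> A \<Longrightarrow> q (\<xi> x) \<noteq> 0 \<Longrightarrow> x \<in> U \<and> f x = p (\<xi> x) / q (\<xi> x)"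
proof -
  have "\<forall>U f z. openin (top X) U \<longrightarrow> f \<in> reg X U \<longrightarrow> z \<in> U \<inter> A \<longrightarrow>
        (\<exists>p\<in>poly_fun n. \<exists>q\<in>poly_fun n. q (\<xi> z) \<noteq> 0 \<and>
           (\<forall>x\<in>A. q (\<xi> x) \<noteq> 0 \<longrightarrow> x \<in> U \<and> f x = p (\<xi> x) / q (\<xi> x)))"
    using assms(1) unfolding chart_def by (elim conjE)
  from this[rule_format, OF assms(2,3)] show thesis using that assms(4,5) by blast
qed

lemma reg_affineE:
  assumes "f \<in> reg (affine_variety n Z) U" "x \<in> U"
  obtains W p q where "openin (zariski n Z) W" "x \<in> W" "W \<subseteq> U" "p \<in> poly_fun n" "q \<in> poly_fun n"
    "\<And>y. y \<in> W \<Longrightarrow> q y \<noteq> 0 \<and> f y = p y / q y"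
  using assms by (auto simp: reg_affine_variety)

lemma zariski_reg_local:
  assumes "openin (zariski n Z) U" "f \<in> reg (affine_variety n Z) U" "z \<in> U"
  obtains p q where "p \<in> poly_fun n" "q \<in> poly_fun n" "q z \<noteq> 0"
    "\<And>x. x \<in> Z \<Longrightarrow> q x \<noteq> 0 \<Longrightarrow> x \<in> U \<and> f x = p x / q x"
proof -
  obtain W p q where W: "openin (zariski n Z) W" "z \<in> W" "W \<subseteq> U" "p \<in> poly_fun n" "q \<in> poly_fun n"
    "\<And>y. y \<in> W \<Longrightarrow> q y \<noteq> 0 \<and> f y = p y / q y"
    using reg_affineE[OF assms(2,3)] by metis
  obtain r where r: "r \<in> poly_fun n" "r z \<noteq> 0" "{v \<in> Z. r v \<noteq> 0} \<subseteq> W"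
    using W(1,2) unfolding openin_zariski by blast
  show thesis
  \<comment> \<open>The extra factor \<open>r\<close>, whose nonvanishing locus lies in
    \<open>W\<close>, makes the new denominator detect membership in \<open>W\<close> as
    well.\<close>
  proof (rule that[of "\<lambda>v. p v * r v" "\<lambda>v. q v * r v"])
    show "q z * r z \<noteq> 0" using W r by auto
    show "x \<in> U \<and> f x = p x * r x / (q x * r x)" if "x \<in> Z" "q x * r x \<noteq> 0" for x
    proof -
      have "x \<in> W" using that r by auto
      then show ?thesis using W that by auto
    qed
  qed (use W r in \<open>auto intro: poly_fun.mult\<close>)
qed

lemma reg_affineI:
  assumes "\<And>x. x \<in> U \<Longrightarrow> \<exists>W p q. openin (zariski n Z) W \<and> x \<in> W \<and> W \<subseteq> U \<and>
      p \<in> poly_fun n \<and> q \<in> poly_fun n \<and> (\<forall>y\<in>W. q y \<noteq> 0 \<and> f y = p y / q y)"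
  shows "f \<in> reg (affine_variety n Z) U"
  using assms by (simp add: reg_affine_variety)

lemma affine_function_sheaf: "function_sheaf (affine_variety n Z)"
proof -
  have cong: "g \<in> reg (affine_variety n Z) U"
    if f: "f \<in> reg (affine_variety n Z) U" and gf: "\<forall>x\<in>U. g x = f x" for U f and g :: "'a vec \<Rightarrow> 'a"
  proof (rule reg_affineI)
    fix x assume "x \<in> U"
    from reg_affineE[OF f this] obtain W p q where W: "openin (zariski n Z) W" "x \<in> W" "W \<subseteq> U"
      "p \<in> poly_fun n" "q \<in> poly_fun n" "\<And>y. y \<in> W \<Longrightarrow> q y \<noteq> 0 \<and> f y = p y / q y" by metis
    show "\<exists>W p q. openin (zariski n Z) W \<and> x \<in> W \<and> W \<subseteq> U \<and>
      p \<in> poly_fun n \<and> q \<in> poly_fun n \<and> (\<forall>y\<in>W. q y \<noteq> 0 \<and> g y = p y / q y)"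
      by (rule exI[of _ W], rule exI[of _ p], rule exI[of _ q]) (use W gf in auto)
  qed
  have const: "(\<lambda>_. c) \<in> reg (affine_variety n Z) U" if U: "openin (zariski n Z) U" for U and c :: 'a
  proof (rule reg_affineI)
    fix x assume "x \<in> U"
    then show "\<exists>W p q. openin (zariski n Z) W \<and> x \<in> W \<and> W \<subseteq> U \<and>
      p \<in> poly_fun n \<and> q \<in> poly_fun n \<and> (\<forall>y\<in>W. q y \<noteq> 0 \<and> c = p y / q y)"
      by (intro exI[of _ U] exI[of _ "\<lambda>_. c"] exI[of _ "\<lambda>_. 1"]) (simp add: U poly_fun.const)
  qed
  have add_mult: "(\<lambda>x. f x + g x) \<in> reg (affine_variety n Z) U \<and> (\<lambda>x. f x * g x) \<in> reg (affine_variety n Z) U"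
    if f: "f \<in> reg (affine_variety n Z) U" and g: "g \<in> reg (affine_variety n Z) U" for U and f g :: "'a vec \<Rightarrow> 'a"
  proof -
    have "(\<exists>W p q. openin (zariski n Z) W \<and> x \<in> W \<and> W \<subseteq> U \<and> p \<in> poly_fun n \<and> q \<in> poly_fun n \<and>
            (\<forall>y\<in>W. q y \<noteq> 0 \<and> f y + g y = p y / q y)) \<and>
          (\<exists>W p q. openin (zariski n Z) W \<and> x \<in> W \<and> W \<subseteq> U \<and> p \<in> poly_fun n \<and> q \<in> poly_fun n \<and>
            (\<forall>y\<in>W. q y \<noteq> 0 \<and> f y * g y = p y / q y))" if x: "x \<in> U" for x
    proof -
      from reg_affineE[OF f x] obtain W p q where W: "openin (zariski n Z) W" "x \<in> W" "W \<subseteq> U"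
        "p \<in> poly_fun n" "q \<in> poly_fun n" "\<And>y. y \<in> W \<Longrightarrow> q y \<noteq> 0 \<and> f y = p y / q y" by metis
      from reg_affineE[OF g x] obtain W' p' q' where W': "openin (zariski n Z) W'" "x \<in> W'" "W' \<subseteq> U"
        "p' \<in> poly_fun n" "q' \<in> poly_fun n" "\<And>y. y \<in> W' \<Longrightarrow> q' y \<noteq> 0 \<and> g y = p' y / q' y" by metis
      have o: "openin (zariski n Z) (W \<inter> W')" using W W' by blast
      have 1: "q y * q' y \<noteq> 0 \<and> f y + g y = (p y * q' y + p' y * q y) / (q y * q' y)"
        and 2: "q y * q' y \<noteq> 0 \<and> f y * g y = (p y * p' y) / (q y * q' y)" if "y \<in> W \<inter> W'" for y
        using W(6)[of y] W'(6)[of y] that by (simp_all add: field_simps)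
      show ?thesis
        by (rule conjI; rule exI[of _ "W \<inter> W'"],
            (rule exI[of _ "\<lambda>v. p v * q' v + p' v * q v"] exI[of _ "\<lambda>v. p v * p' v"]),
            rule exI[of _ "\<lambda>v. q v * q' v"])
           (use W(2-5) W'(2-5) o 1 2 in \<open>auto intro: poly_fun.add poly_fun.mult\<close>)
    qed
    then show ?thesis by (auto intro!: reg_affineI)
  qed
  have mono: "f \<in> reg (affine_variety n Z) V"
    if f: "f \<in> reg (affine_variety n Z) U" and V: "openin (zariski n Z) V" "V \<subseteq> U" for U V and f :: "'a vec \<Rightarrow> 'a"
  proof (rule reg_affineI)
    fix x assume x: "x \<in> V"
    then have "x \<in> U" using V by blast
    from reg_affineE[OF f this] obtain W p q where W: "openin (zariski n Z) W" "x \<in> W" "W \<subseteq> U"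
      "p \<in> poly_fun n" "q \<in> poly_fun n" "\<And>y. y \<in> W \<Longrightarrow> q y \<noteq> 0 \<and> f y = p y / q y" by metis
    have o: "openin (zariski n Z) (W \<inter> V)" using W V by blast
    show "\<exists>W p q. openin (zariski n Z) W \<and> x \<in> W \<and> W \<subseteq> V \<and>
      p \<in> poly_fun n \<and> q \<in> poly_fun n \<and> (\<forall>y\<in>W. q y \<noteq> 0 \<and> f y = p y / q y)"
      by (rule exI[of _ "W \<inter> V"], rule exI[of _ p], rule exI[of _ q]) (use W o x in simp)
  qed
  have union: "f \<in> reg (affine_variety n Z) (\<Union>\<U>)"
    if f: "\<And>U. U \<in> \<U> \<Longrightarrow> f \<in> reg (affine_variety n Z) U" for \<U> and f :: "'a vec \<Rightarrow> 'a"
  proof (rule reg_affineI)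
    fix x assume "x \<in> \<Union>\<U>"
    then obtain U where U: "U \<in> \<U>" "x \<in> U" by blast
    from reg_affineE[OF f[OF U(1)] U(2)] obtain W p q where W: "openin (zariski n Z) W" "x \<in> W" "W \<subseteq> U"
      "p \<in> poly_fun n" "q \<in> poly_fun n" "\<And>y. y \<in> W \<Longrightarrow> q y \<noteq> 0 \<and> f y = p y / q y" by metis
    have "W \<subseteq> \<Union>\<U>" using U W by blast
    then show "\<exists>W p q. openin (zariski n Z) W \<and> x \<in> W \<and> W \<subseteq> \<Union>\<U> \<and>
      p \<in> poly_fun n \<and> q \<in> poly_fun n \<and> (\<forall>y\<in>W. q y \<noteq> 0 \<and> f y = p y / q y)"
      by (intro exI[of _ W] exI[of _ p] exI[of _ q]) (use W in simp)
  qed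
  show ?thesis unfolding function_sheaf_def
  proof (intro conjI allI impI, goal_cases)
    case (1 U f g) show ?case by (rule cong[OF 1(2,3)])
  next
    case (2 U c) then show ?case using const[of U c] by (simp only: top_affine_variety)
  next
    case (3 U f g) then show ?case using add_mult by blast
  next
    case (4 U f g) then show ?case using add_mult by blast
  next
    case (5 U V f) show ?case by (rule mono[OF 5(4) _ 5(3)]) (use 5 in \<open>simp only: top_affine_variety\<close>)
  next
    case (6 \<U> f) then show ?case by (intro union) blast
  qed
qed

lemma affine_quotient_reg:
  assumes "p \<in> poly_fun n" "q \<in> poly_fun n"
  shows "(\<lambda>v. p v / q v) \<in> reg (affine_variety n Z) {v \<in> Z. q v \<noteq> 0}"
proof (simp only: reg_affine_variety mem_Collect_eq, intro ballI)
  fix x assume "x \<in> {v \<in> Z. q v \<noteq> 0}"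
  then show "\<exists>W p' q'. openin (zariski n Z) W \<and> x \<in> W \<and> W \<subseteq> {v \<in> Z. q v \<noteq> 0} \<and> p' \<in> poly_fun n \<and>
      q' \<in> poly_fun n \<and> (\<forall>y\<in>W. q' y \<noteq> 0 \<and> p y / q y = p' y / q' y)"
    by (intro exI[of _ "{v \<in> Z. q v \<noteq> 0}"] exI[of _ p] exI[of _ q])
       (use assms openin_zariski_basic[OF assms(2)] in auto)
qed

lemma chart_affine:
  assumes "Z \<subseteq> carrier_vec n"
  shows "chart (affine_variety n Z) Z n (\<lambda>v. v)"
  unfolding chart_def
proof (intro conjI allI impI ballI)
  show "openin (top (affine_variety n Z)) Z" using openin_topspace[of "zariski n Z"] by simp
  show "openin (top (affine_variety n Z)) {x \<in> Z. q x \<noteq> 0}" if "q \<in> poly_fun n" for q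
    using openin_zariski_basic[OF that] by simp
  show "(\<lambda>v. p v / q v) \<in> reg (affine_variety n Z) {x \<in> Z. q x \<noteq> 0}"
    if "p \<in> poly_fun n" "q \<in> poly_fun n" for p q
    using affine_quotient_reg[OF that] .
  fix U f z
  assume *: "openin (top (affine_variety n Z)) U" "f \<in> reg (affine_variety n Z) U" "z \<in> U \<inter> Z"
  obtain p q where "p \<in> poly_fun n" "q \<in> poly_fun n" "q z \<noteq> 0"
    "\<And>x. x \<in> Z \<Longrightarrow> q x \<noteq> 0 \<Longrightarrow> x \<in> U \<and> f x = p x / q x"
    using zariski_reg_local[of n Z U f z] * by auto
  then show "\<exists>p\<in>poly_fun n. \<exists>q\<in>poly_fun n. q z \<noteq> 0 \<and>
           (\<forall>x\<in>Z. q x \<noteq> 0 \<longrightarrow> x \<in> U \<and> f x = p x / q x)" by blast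
qed (use assms in auto)

text \<open>Quotients of polynomials are pulled back along \<phi>. Conversely a regular function on
  \<open>X\<close> is pulled back along \<psi>, written as a quotient on \<open>Z\<close>, and
  returned by evaluating at \<phi> x, where \<psi> undoes \<phi>.\<close>

lemma chart_of_iso_pair:
  assumes A: "openin (top X) A" and Z: "Z \<subseteq> carrier_vec n"
    and iso: "iso_pair (open_sub X A) (affine_variety n Z) \<phi> \<psi>" and sheaf: "function_sheaf X"
  shows "chart X A n \<phi>"
proof -
  have ptsA: "pts (open_sub X A) = A" using openin_subset[OF A] by auto
  have sub: "{x \<in> pts X. x \<in> A \<and> P x} = {x \<in> A. P x}" for P using openin_subset[OF A] by auto
  have \<phi>: "continuous_map (subtopology (top X) A) (zariski n Z) \<phi>"
    and \<phi>reg: "\<And>V f. openin (zariski n Z) V \<Longrightarrow> f \<in> reg (affine_variety n Z) V \<Longrightarrow>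
         (f \<circ> \<phi>) \<in> reg X {x \<in> A. \<phi> x \<in> V}"
    and \<psi>: "continuous_map (zariski n Z) (subtopology (top X) A) \<psi>"
    and \<psi>reg: "\<And>V f. openin (subtopology (top X) A) V \<Longrightarrow> f \<in> reg X V \<Longrightarrow>
         (f \<circ> \<psi>) \<in> reg (affine_variety n Z) {v \<in> Z. \<psi> v \<in> V}"
    and \<psi>\<phi>: "\<And>x. x \<in> A \<Longrightarrow> \<psi> (\<phi> x) = x"
    using iso ptsA unfolding iso_pair_def morphism_def by (simp_all add: sub)
  have \<phi>Z: "\<phi> x \<in> Z" if "x \<in> A" for x
    using continuous_map_image_subset_topspace[OF \<phi>] that ptsA by auto
  have basic: "openin (top X) {x \<in> A. q (\<phi> x) \<noteq> 0}" if q: "q \<in> poly_fun n" for q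
  proof -
    have "openin (subtopology (top X) A) {x \<in> A. \<phi> x \<in> {v \<in> Z. q v \<noteq> 0}}"
      using openin_continuous_map_preimage[OF \<phi> openin_zariski_basic[OF q]] ptsA by (simp add: sub)
    moreover have "{x \<in> A. \<phi> x \<in> {v \<in> Z. q v \<noteq> 0}} = {x \<in> A. q (\<phi> x) \<noteq> 0}" using \<phi>Z by auto
    ultimately show ?thesis using openin_open_subtopology[OF A] by simp
  qed
  show ?thesis unfolding chart_def
  proof (intro conjI allI impI ballI)
    show "inj_on \<phi> A" using \<psi>\<phi> by (metis inj_onI)
    show "\<phi> ` A \<subseteq> carrier_vec n" using \<phi>Z Z by blast
    show "openin (top X) {x \<in> A. q (\<phi> x) \<noteq> 0}" if "q \<in> poly_fun n" for q
      using basic[OF that] .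
    show "(\<lambda>x. p (\<phi> x) / q (\<phi> x)) \<in> reg X {x \<in> A. q (\<phi> x) \<noteq> 0}"
      if "p \<in> poly_fun n" "q \<in> poly_fun n" for p q
    proof -
      have "(\<lambda>v. p v / q v) \<circ> \<phi> \<in> reg X {x \<in> A. \<phi> x \<in> {v \<in> Z. q v \<noteq> 0}}"
        by (rule \<phi>reg) (use openin_zariski_basic affine_quotient_reg that in blast)+
      moreover have "{x \<in> A. \<phi> x \<in> {v \<in> Z. q v \<noteq> 0}} = {x \<in> A. q (\<phi> x) \<noteq> 0}" using \<phi>Z by auto
      ultimately show ?thesis by (simp add: o_def)
    qed
    fix U f z
    assume *: "openin (top X) U" "f \<in> reg X U" "z \<in> U \<inter> A"
    have oUA: "openin (top X) (U \<inter> A)" using * A by blast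
    have UA: "openin (subtopology (top X) A) (U \<inter> A)" "f \<in> reg X (U \<inter> A)"
      using oUA openin_open_subtopology[OF A] reg_mono[OF sheaf *(1) oUA _ *(2)] by auto
    have o: "openin (zariski n Z) {v \<in> Z. \<psi> v \<in> U \<inter> A}"
      using openin_continuous_map_preimage[OF \<psi> UA(1)] by simp
    obtain p q where pq: "p \<in> poly_fun n" "q \<in> poly_fun n" "q (\<phi> z) \<noteq> 0"
      "\<And>x. x \<in> Z \<Longrightarrow> q x \<noteq> 0 \<Longrightarrow> x \<in> {v \<in> Z. \<psi> v \<in> U \<inter> A} \<and> (f \<circ> \<psi>) x = p x / q x"
      using zariski_reg_local[OF o \<psi>reg[OF UA], of "\<phi> z"] * \<phi>Z \<psi>\<phi> by auto
    then have "\<forall>x\<in>A. q (\<phi> x) \<noteq> 0 \<longrightarrow> x \<in> U \<and> f x = p (\<phi> x) / q (\<phi> x)"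
      using \<phi>Z \<psi>\<phi> by fastforce
    then show "\<exists>p\<in>poly_fun n. \<exists>q\<in>poly_fun n. q (\<phi> z) \<noteq> 0 \<and>
           (\<forall>x\<in>A. q (\<phi> x) \<noteq> 0 \<longrightarrow> x \<in> U \<and> f x = p (\<phi> x) / q (\<phi> x))"
      using pq(1-3) by blast
  qed (use A in auto)
qed

lemma prevariety_chart:
  assumes "prevariety X" "x \<in> pts X"
  obtains A n \<xi> where "x \<in> A" "chart X A n \<xi>"
proof -
  obtain U n Z where U: "x \<in> U" "openin (top X) U" "algebraic_set n Z"
    "isomorphic (open_sub X U) (affine_variety n Z)" "function_sheaf X"
    using assms unfolding prevariety_def by blast
  then obtain \<phi> \<psi> where "iso_pair (open_sub X U) (affine_variety n Z) \<phi> \<psi>"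
    unfolding isomorphic_def by blast
  then show thesis using that U chart_of_iso_pair algebraic_set_carrier by metis
qed


section \<open>Regular functions and morphisms\<close>

lemma reg_local:
  assumes "function_sheaf X" "\<And>x. x \<in> U \<Longrightarrow> \<exists>W. openin (top X) W \<and> x \<in> W \<and> W \<subseteq> U \<and> f \<in> reg X W"
  shows "f \<in> reg X U"
proof -
  let ?W = "{W. openin (top X) W \<and> W \<subseteq> U \<and> f \<in> reg X W}"
  have "f \<in> reg X (\<Union>?W)" by (rule reg_Union[OF assms(1)]) auto
  moreover have "\<Union>?W = U" using assms(2) by blast
  ultimately show ?thesis by simp
qed

lemma reg_sum:
  assumes "function_sheaf X" "openin (top X) U" "\<And>i. i \<in> I \<Longrightarrow> f i \<in> reg X U"
  shows "(\<lambda>x. \<Sum>i\<in>I. f i x) \<in> reg X U"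
  using assms(3)
  by (induction I rule: infinite_finite_induct) (auto intro: reg_const reg_add assms(1,2))

lemma reg_smult: "function_sheaf X \<Longrightarrow> openin (top X) U \<Longrightarrow> f \<in> reg X U \<Longrightarrow> (\<lambda>x. c * f x) \<in> reg X U"
  by (rule reg_mult) (auto intro: reg_const)

lemma reg_poly_fun:
  assumes "function_sheaf X" "openin (top X) U" "p \<in> poly_fun n" "\<And>i. i < n \<Longrightarrow> (\<lambda>x. \<phi> x $ i) \<in> reg X U"
  shows "(\<lambda>x. p (\<phi> x)) \<in> reg X U"
  using assms(3,4)
  by (induction rule: poly_fun.induct) (auto intro: reg_const reg_add reg_mult assms(1,2))

lemma prevariety_sheaf: "prevariety X \<Longrightarrow> function_sheaf X"
  by (simp add: prevariety_def)

text \<open>In a chart \<open>f\<close> is p / q near each point, so its nonvanishing there is that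
  of the polynomial p q.\<close>

lemma openin_neq_0:
  assumes X: "prevariety X" and U: "openin (top X) U" and f: "f \<in> reg X U"
  shows "openin (top X) {x \<in> U. f x \<noteq> 0}"
proof (subst openin_subopen, intro ballI)
  fix x assume x: "x \<in> {x \<in> U. f x \<noteq> 0}"
  then have "x \<in> pts X" using openin_subset[OF U] by blast
  then obtain A n \<xi> where A: "x \<in> A" "chart X A n \<xi>" using prevariety_chart[OF X] by metis
  obtain p q where pq: "p \<in> poly_fun n" "q \<in> poly_fun n" "q (\<xi> x) \<noteq> 0"
    "\<And>x. x \<in> A \<Longrightarrow> q (\<xi> x) \<noteq> 0 \<Longrightarrow> x \<in> U \<and> f x = p (\<xi> x) / q (\<xi> x)"
    using chart_local[OF A(2) U f] x A by blast
  have "openin (top X) {x \<in> A. p (\<xi> x) * q (\<xi> x) \<noteq> 0}"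
    by (rule chart_basic[OF A(2), where q = "\<lambda>v. p v * q v"]) (rule poly_fun.mult[OF pq(1,2)])
  moreover have "p (\<xi> x) * q (\<xi> x) \<noteq> 0" using pq x A by fastforce
  ultimately show "\<exists>T. openin (top X) T \<and> x \<in> T \<and> T \<subseteq> {x \<in> U. f x \<noteq> 0}"
    using pq A by (intro exI[of _ "{x \<in> A. p (\<xi> x) * q (\<xi> x) \<noteq> 0}"]) auto
qed

lemma reg_inverse:
  assumes X: "prevariety X" and U: "openin (top X) U" and f: "f \<in> reg X U" and f0: "\<And>x. x \<in> U \<Longrightarrow> f x \<noteq> 0"
  shows "(\<lambda>x. 1 / f x) \<in> reg X U"
proof (rule reg_local[OF prevariety_sheaf[OF X]])
  fix x assume x: "x \<in> U"
  then have "x \<in> pts X" using openin_subset[OF U] by blast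
  then obtain A n \<xi> where A: "x \<in> A" "chart X A n \<xi>" using prevariety_chart[OF X] by metis
  obtain p q where pq: "p \<in> poly_fun n" "q \<in> poly_fun n" "q (\<xi> x) \<noteq> 0"
    "\<And>x. x \<in> A \<Longrightarrow> q (\<xi> x) \<noteq> 0 \<Longrightarrow> x \<in> U \<and> f x = p (\<xi> x) / q (\<xi> x)"
    using chart_local[OF A(2) U f] x A by blast
  let ?W = "{x \<in> A. p (\<xi> x) * q (\<xi> x) \<noteq> 0}"
  have W: "openin (top X) ?W"
    by (rule chart_basic[OF A(2), where q = "\<lambda>v. p v * q v"]) (rule poly_fun.mult[OF pq(1,2)])
  \<comment> \<open>The reciprocal q / p is expanded by \<open>q\<close>, so that the denominator
    vanishes exactly off \<open>?W\<close> and \<open>chart_reg\<close> applies on that set.\<close>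
  have "(\<lambda>x. (q (\<xi> x) * q (\<xi> x)) / (p (\<xi> x) * q (\<xi> x))) \<in> reg X ?W"
    by (rule chart_reg[OF A(2), where q = "\<lambda>v. p v * q v" and p = "\<lambda>v. q v * q v"])
      (auto intro: poly_fun.mult pq)
  then have "(\<lambda>x. 1 / f x) \<in> reg X ?W"
    by (rule reg_cong[OF prevariety_sheaf[OF X] W]) (use pq in auto)
  moreover have "p (\<xi> x) * q (\<xi> x) \<noteq> 0" using pq f0[OF x] A by auto
  ultimately show "\<exists>W. openin (top X) W \<and> x \<in> W \<and> W \<subseteq> U \<and> (\<lambda>x. 1 / f x) \<in> reg X W"
    using W pq A by (intro exI[of _ ?W]) auto
qed

lemma topspace_open_sub: "openin (top X) U \<Longrightarrow> topspace (subtopology (top X) U) = U"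
  using openin_subset[of "top X" U] by auto

lemma
  assumes \<phi>: "morphism (open_sub X U) Y \<phi>" and U: "openin (top X) U"
  shows morphism_mapsto: "x \<in> U \<Longrightarrow> \<phi> x \<in> pts Y"
    and morphism_preimage: "openin (top Y) V \<Longrightarrow> openin (top X) {x \<in> U. \<phi> x \<in> V}"
    and morphism_pullback: "openin (top Y) V \<Longrightarrow> f \<in> reg Y V \<Longrightarrow> (\<lambda>x. f (\<phi> x)) \<in> reg X {x \<in> U. \<phi> x \<in> V}"
proof -
  have c: "continuous_map (top (open_sub X U)) (top Y) \<phi>"
    and r: "\<forall>V f. openin (top Y) V \<longrightarrow> f \<in> reg Y V \<longrightarrow> (f \<circ> \<phi>) \<in> reg (open_sub X U) {x \<in> pts (open_sub X U). \<phi> x \<in> V}"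
    using \<phi> unfolding morphism_def by (rule conjunct1, rule conjunct2)
  show "x \<in> U \<Longrightarrow> \<phi> x \<in> pts Y"
    using continuous_map_image_subset_topspace[OF c] unfolding open_sub_simps topspace_open_sub[OF U] by blast
  show "openin (top Y) V \<Longrightarrow> openin (top X) {x \<in> U. \<phi> x \<in> V}"
    using openin_continuous_map_preimage[OF c, of V]
    unfolding open_sub_simps topspace_open_sub[OF U] openin_open_subtopology[OF U] by blast
  show "openin (top Y) V \<Longrightarrow> f \<in> reg Y V \<Longrightarrow> (\<lambda>x. f (\<phi> x)) \<in> reg X {x \<in> U. \<phi> x \<in> V}"
    using r[rule_format, of V f] unfolding open_sub_simps topspace_open_sub[OF U] o_def .
qed

lemma morphismI:
  assumes U: "openin (top X) U" and "\<And>x. x \<in> U \<Longrightarrow> \<phi> x \<in> pts Y"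
    "\<And>V. openin (top Y) V \<Longrightarrow> openin (top X) {x \<in> U. \<phi> x \<in> V}"
    "\<And>V f. openin (top Y) V \<Longrightarrow> f \<in> reg Y V \<Longrightarrow> (\<lambda>x. f (\<phi> x)) \<in> reg X {x \<in> U. \<phi> x \<in> V}"
  shows "morphism (open_sub X U) Y \<phi>"
  unfolding morphism_def continuous_map_def open_sub_simps topspace_open_sub[OF U]
    openin_open_subtopology[OF U] o_def
  using assms(2-4) by blast

lemma morphism_restrict:
  assumes X: "function_sheaf X" and U: "openin (top X) U" and \<phi>: "morphism (open_sub X U) Y \<phi>"
    and V: "openin (top X) V" "V \<subseteq> U"
  shows "morphism (open_sub X V) Y \<phi>"
proof (rule morphismI[OF V(1)])
  show "\<phi> x \<in> pts Y" if "x \<in> V" for x using morphism_mapsto[OF \<phi> U] V that by blast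
  fix T assume T: "openin (top Y) T"
  have *: "{x \<in> V. \<phi> x \<in> T} = V \<inter> {x \<in> U. \<phi> x \<in> T}" using V by auto
  show o: "openin (top X) {x \<in> V. \<phi> x \<in> T}"
    unfolding * using morphism_preimage[OF \<phi> U T] V by blast
  show "(\<lambda>x. f (\<phi> x)) \<in> reg X {x \<in> V. \<phi> x \<in> T}" if "f \<in> reg Y T" for f
    by (rule reg_mono[OF X morphism_preimage[OF \<phi> U T] o _ morphism_pullback[OF \<phi> U T that]])
       (use * in auto)
qed

lemma morphism_compose:
  assumes U: "openin (top X) U" and \<phi>: "morphism (open_sub X U) Y \<phi>"
    and V: "openin (top Y) V" and \<psi>: "morphism (open_sub Y V) Z \<psi>"
  shows "morphism (open_sub X {x \<in> U. \<phi> x \<in> V}) Z (\<psi> \<circ> \<phi>)"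
proof (rule morphismI[OF morphism_preimage[OF \<phi> U V]])
  show "(\<psi> \<circ> \<phi>) x \<in> pts Z" if "x \<in> {x \<in> U. \<phi> x \<in> V}" for x
    using morphism_mapsto[OF \<psi> V] that by auto
  fix T assume T: "openin (top Z) T"
  have *: "{x \<in> {x \<in> U. \<phi> x \<in> V}. (\<psi> \<circ> \<phi>) x \<in> T} = {x \<in> U. \<phi> x \<in> {y \<in> V. \<psi> y \<in> T}}" by auto
  show "openin (top X) {x \<in> {x \<in> U. \<phi> x \<in> V}. (\<psi> \<circ> \<phi>) x \<in> T}"
    unfolding * by (rule morphism_preimage[OF \<phi> U morphism_preimage[OF \<psi> V T]])
  show "(\<lambda>x. f ((\<psi> \<circ> \<phi>) x)) \<in> reg X {x \<in> {x \<in> U. \<phi> x \<in> V}. (\<psi> \<circ> \<phi>) x \<in> T}" if "f \<in> reg Z T" for f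
    unfolding * using morphism_pullback[OF \<phi> U morphism_preimage[OF \<psi> V T] morphism_pullback[OF \<psi> V T that]]
    by simp
qed

text \<open>Polynomials in the coordinates of \<phi> are regular, so preimages of principal open
  sets are open and quotients of polynomials pull back to regular functions. Morphisms to affine
  varieties can thus be given by regular coordinates.\<close>

lemma morphism_affineI:
  assumes X: "prevariety X" and U: "openin (top X) U"
    and \<phi>: "\<And>x. x \<in> U \<Longrightarrow> \<phi> x \<in> Z" "\<And>i. i < n \<Longrightarrow> (\<lambda>x. \<phi> x $ i) \<in> reg X U"
  shows "morphism (open_sub X U) (affine_variety n Z) \<phi>"
proof (rule morphismI[OF U])
  note sh = prevariety_sheaf[OF X]
  have regp: "(\<lambda>x. p (\<phi> x)) \<in> reg X U" if "p \<in> poly_fun n" for p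
    by (rule reg_poly_fun[OF sh U that \<phi>(2)])
  have pre: "openin (top X) {x \<in> U. \<phi> x \<in> V}" if V: "openin (zariski n Z) V" for V
  proof (subst openin_subopen, intro ballI)
    fix x assume x: "x \<in> {x \<in> U. \<phi> x \<in> V}"
    then obtain p where p: "p \<in> poly_fun n" "p (\<phi> x) \<noteq> 0" "{v \<in> Z. p v \<noteq> 0} \<subseteq> V"
      using V unfolding openin_zariski by blast
    show "\<exists>T. openin (top X) T \<and> x \<in> T \<and> T \<subseteq> {x \<in> U. \<phi> x \<in> V}"
      using openin_neq_0[OF X U regp[OF p(1)]] p \<phi>(1) x
      by (intro exI[of _ "{x \<in> U. p (\<phi> x) \<noteq> 0}"]) auto
  qed
  show "\<phi> x \<in> pts (affine_variety n Z)" if "x \<in> U" for x using \<phi> that by simp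
  fix V assume V: "openin (top (affine_variety n Z)) V"
  then show "openin (top X) {x \<in> U. \<phi> x \<in> V}" using pre by simp
  fix f assume f: "f \<in> reg (affine_variety n Z) V"
  show "(\<lambda>x. f (\<phi> x)) \<in> reg X {x \<in> U. \<phi> x \<in> V}"
  proof (rule reg_local[OF sh])
    fix x assume x: "x \<in> {x \<in> U. \<phi> x \<in> V}"
    obtain p q where pq: "p \<in> poly_fun n" "q \<in> poly_fun n" "q (\<phi> x) \<noteq> 0"
       "\<And>x. x \<in> Z \<Longrightarrow> q x \<noteq> 0 \<Longrightarrow> x \<in> V \<and> f x = p x / q x"
      using zariski_reg_local[of n Z V f "\<phi> x"] V f x by auto
    let ?W = "{x \<in> U. q (\<phi> x) \<noteq> 0}"
    have W: "openin (top X) ?W" by (rule openin_neq_0[OF X U regp[OF pq(2)]])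
    have r: "(\<lambda>x. r (\<phi> x)) \<in> reg X ?W" if "r \<in> poly_fun n" for r
      by (rule reg_mono[OF sh U W _ regp[OF that]]) auto
    have "(\<lambda>x. p (\<phi> x) * (1 / q (\<phi> x))) \<in> reg X ?W"
      by (rule reg_mult[OF sh W r[OF pq(1)] reg_inverse[OF X W r[OF pq(2)]]]) auto
    then have "(\<lambda>x. f (\<phi> x)) \<in> reg X ?W"
      by (rule reg_cong[OF sh W]) (use pq \<phi>(1) in auto)
    then show "\<exists>W. openin (top X) W \<and> x \<in> W \<and> W \<subseteq> {x \<in> U. \<phi> x \<in> V} \<and> (\<lambda>x. f (\<phi> x)) \<in> reg X W"
      using W x pq \<phi>(1) by (intro exI[of _ ?W]) auto
  qed
qed

lemma affine_coord_reg:
  assumes "i < n" shows "(\<lambda>v. v $ i) \<in> reg (affine_variety n Z) Z"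
  using affine_quotient_reg[OF poly_fun.coord[OF assms] poly_fun.const[of 1], of Z] by simp

section \<open>Product topology and separatedness\<close>

lemma openin_prod_zariski_basic:
  fixes r :: nat
  assumes "openin (top X) U" "openin (top Y) V" "\<And>i. f i \<in> reg X U" "\<And>i. g i \<in> reg Y V"
  shows "openin (prod_zariski X Y) {(x, y). x \<in> U \<and> y \<in> V \<and> (\<Sum>i<r. f i x * g i y) \<noteq> 0}"
  unfolding prod_zariski_def by (rule topology_generated_by_Basis) (use assms in blast)

lemma topspace_prod_zariski:
  assumes "function_sheaf X" "function_sheaf Y"
  shows "topspace (prod_zariski X Y) = pts X \<times> pts Y"
proof (rule subset_antisym)
  let ?B = "{{(x, y). x \<in> U \<and> y \<in> V \<and> (\<Sum>i<r. f i x * g i y) \<noteq> 0} | U V r f g.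
        openin (top X) U \<and> openin (top Y) V \<and> (\<forall>i<(r::nat). f i \<in> reg X U \<and> g i \<in> reg Y V)}"
  have 1: "topspace (prod_zariski X Y) = \<Union>?B"
    unfolding prod_zariski_def by (rule topology_generated_by_topspace)
  have "B \<subseteq> pts X \<times> pts Y" if "B \<in> ?B" for B
  proof -
    from that obtain U V where UV: "openin (top X) U" "openin (top Y) V" "B \<subseteq> U \<times> V"
      by (elim CollectE exE conjE) blast
    then show ?thesis using openin_subset[OF UV(1)] openin_subset[OF UV(2)] by blast
  qed
  then show "topspace (prod_zariski X Y) \<subseteq> pts X \<times> pts Y" unfolding 1 by (rule Union_least)
  have "pts X \<times> pts Y \<in> ?B"
    by (rule CollectI, rule exI[of _ "pts X"], rule exI[of _ "pts Y"], rule exI[of _ "1::nat"],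
        rule exI[of _ "\<lambda>_ _. 1"], rule exI[of _ "\<lambda>_ _. 1"])
       (auto simp: reg_const[OF assms(1) openin_topspace] reg_const[OF assms(2) openin_topspace])
  then show "pts X \<times> pts Y \<subseteq> topspace (prod_zariski X Y)" unfolding 1 by (rule Union_upper)
qed

text \<open>A tensor pulls back along the pair of maps to a regular function on \<open>X\<close>,
  whose nonvanishing locus is open.\<close>

lemma prod_zariski_preimage:
  assumes X: "prevariety X" and U: "openin (top X) U"
    and \<phi>: "morphism (open_sub X U) Y \<phi>" and \<psi>: "morphism (open_sub X U) Z \<psi>"
    and T: "openin (prod_zariski Y Z) T"
  shows "openin (top X) {x \<in> U. (\<phi> x, \<psi> x) \<in> T}"
proof -
  let ?B = "{{(x, y). x \<in> U \<and> y \<in> V \<and> (\<Sum>i<r. f i x * g i y) \<noteq> 0} | U V r f g.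
        openin (top Y) U \<and> openin (top Z) V \<and> (\<forall>i<(r::nat). f i \<in> reg Y U \<and> g i \<in> reg Z V)}"
  have "generate_topology_on ?B T"
    using T unfolding prod_zariski_def openin_topology_generated_by_iff .
  then show ?thesis
  proof (induction rule: generate_topology_on.induct)
    case (Int a b)
    have "{x \<in> U. (\<phi> x, \<psi> x) \<in> a \<inter> b} = {x \<in> U. (\<phi> x, \<psi> x) \<in> a} \<inter> {x \<in> U. (\<phi> x, \<psi> x) \<in> b}"
      by auto
    then show ?case using openin_Int[OF Int.IH] by metis
  next
    case (UN K)
    have "{x \<in> U. (\<phi> x, \<psi> x) \<in> \<Union>K} = \<Union>((\<lambda>k. {x \<in> U. (\<phi> x, \<psi> x) \<in> k}) ` K)" by auto
    then show ?case using openin_Union[of "(\<lambda>k. {x \<in> U. (\<phi> x, \<psi> x) \<in> k}) ` K" "top X"] UN.IH by auto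
  next
    case (Basis s)
    then obtain A B r f g where s: "s = {(x, y). x \<in> A \<and> y \<in> B \<and> (\<Sum>i<r. f i x * g i y) \<noteq> 0}"
      and A: "openin (top Y) A" and B: "openin (top Z) B"
      and fg: "\<forall>i<(r::nat). f i \<in> reg Y A \<and> g i \<in> reg Z B" by (elim CollectE exE conjE) blast
    note sh = prevariety_sheaf[OF X]
    let ?W = "{x \<in> U. \<phi> x \<in> A} \<inter> {x \<in> U. \<psi> x \<in> B}"
    note oA = morphism_preimage[OF \<phi> U A] and oB = morphism_preimage[OF \<psi> U B]
    have W: "openin (top X) ?W" using oA oB by blast
    have "(\<lambda>x. \<Sum>i<r. f i (\<phi> x) * g i (\<psi> x)) \<in> reg X ?W"
    proof (intro reg_sum[OF sh W] reg_mult[OF sh W])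
      fix i assume i: "i \<in> {..<r}"
      show "(\<lambda>x. f i (\<phi> x)) \<in> reg X ?W"
        by (rule reg_mono[OF sh oA W _ morphism_pullback[OF \<phi> U A]]) (use i fg in auto)
      show "(\<lambda>x. g i (\<psi> x)) \<in> reg X ?W"
        by (rule reg_mono[OF sh oB W _ morphism_pullback[OF \<psi> U B]]) (use i fg in auto)
    qed
    from openin_neq_0[OF X W this] show ?case
      by (rule back_subst[of "openin (top X)"]) (auto simp: s)
  qed simp
qed

lemma variety_prevariety: "variety X \<Longrightarrow> prevariety X"
  by (simp add: variety_def)

text \<open>Separatedness at work: the locus is the preimage of the complement of the diagonal under
  the pair of morphisms.\<close>

lemma openin_morphism_neq:
  assumes X: "prevariety X" and Y: "variety Y" and U: "openin (top X) U"
    and \<phi>: "morphism (open_sub X U) Y \<phi>" and \<psi>: "morphism (open_sub X U) Y \<psi>"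
  shows "openin (top X) {x \<in> U. \<phi> x \<noteq> \<psi> x}"
proof -
  note sh = prevariety_sheaf[OF variety_prevariety[OF Y]]
  have "openin (prod_zariski Y Y) (pts Y \<times> pts Y - {(x, x) | x. x \<in> pts Y})"
    using Y unfolding variety_def closedin_def topspace_prod_zariski[OF sh sh] by (elim conjE)
  from prod_zariski_preimage[OF X U \<phi> \<psi> this] show ?thesis
    by (rule back_subst[of "openin (top X)"])
       (use morphism_mapsto[OF \<phi> U] morphism_mapsto[OF \<psi> U] in auto)
qed

lemma affine_prevariety:
  assumes "algebraic_set n Z"
  shows "prevariety (affine_variety n Z)"
proof -
  have o: "openin (zariski n Z) Z" using openin_topspace[of "zariski n Z"] by simp
  have "open_sub (affine_variety n Z) Z = affine_variety n Z"
    using open_sub_pts[of "affine_variety n Z"] by simp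
  moreover have "morphism (affine_variety n Z) (affine_variety n Z) id"
    unfolding morphism_def
  proof (intro conjI allI impI)
    fix V f
    assume V: "openin (top (affine_variety n Z)) V" and f: "f \<in> reg (affine_variety n Z) V"
    have "{x \<in> Z. x \<in> V} = V" using openin_subset[OF V] by auto
    then show "f \<circ> id \<in> reg (affine_variety n Z) {x \<in> pts (affine_variety n Z). id x \<in> V}"
      using f by simp
  qed (simp add: id_def)
  then have "isomorphic (affine_variety n Z) (affine_variety n Z)"
    unfolding isomorphic_def iso_pair_def by fastforce
  ultimately show ?thesis unfolding prevariety_def
    using assms affine_function_sheaf o
    by (intro conjI exI[of _ "{Z}"]) auto
qed

text \<open>Off the diagonal two points differ in some coordinate \<open>i\<close>, and the
  difference of the \<open>i\<close>-th coordinates is a tensor of two terms: the coordinate times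
  1, plus 1 times the negated coordinate.\<close>

lemma affine_variety_variety:
  assumes "algebraic_set n Z"
  shows "variety (affine_variety n Z)"
proof -
  let ?Y = "affine_variety n Z" and ?D = "{(x, x) | x. x \<in> Z}"
  have o: "openin (zariski n Z) Z" using openin_topspace[of "zariski n Z"] by simp
  note sh = affine_function_sheaf[of n Z]
  have 1: "openin (prod_zariski ?Y ?Y) {(x, y). x \<in> Z \<and> y \<in> Z \<and> x $ i - y $ i \<noteq> 0}" if i: "i < n" for i
  proof -
    define f where "f j = (if j = 0 then (\<lambda>v. v $ i) else (\<lambda>_. 1 :: 'a))" for j :: nat
    define g where "g j = (if j = 0 then (\<lambda>_. 1) else (\<lambda>v. - (v $ i) :: 'a))" for j :: nat
    have f: "f j \<in> reg ?Y Z" for j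
      unfolding f_def using affine_coord_reg[OF i, of Z] reg_const[OF sh, of Z 1] o by (cases "j = 0") auto
    have "(\<lambda>v. - (v $ i)) \<in> reg ?Y Z" using reg_smult[OF sh, of Z "\<lambda>v. v $ i" "-1"] affine_coord_reg[OF i, of Z] o by simp
    then have g: "g j \<in> reg ?Y Z" for j
      unfolding g_def using reg_const[OF sh, of Z 1] o by (cases "j = 0") auto
    have "openin (prod_zariski ?Y ?Y) {(x, y). x \<in> Z \<and> y \<in> Z \<and> (\<Sum>j<2. f j x * g j y) \<noteq> 0}"
      by (rule openin_prod_zariski_basic) (use f g o in \<open>simp_all only: top_affine_variety\<close>)
    moreover have "(\<Sum>j<2. f j x * g j y) = x $ i - y $ i" for x y
      by (simp add: f_def g_def numeral_2_eq_2)
    ultimately show ?thesis by simp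
  qed
  have "Z \<times> Z - ?D = (\<Union>i\<in>{..<n}. {(x, y). x \<in> Z \<and> y \<in> Z \<and> x $ i - y $ i \<noteq> 0})"
  proof -
    have "\<exists>i<n. x $ i \<noteq> y $ i" if "x \<in> Z" "y \<in> Z" "x \<noteq> y" for x y
      using algebraic_set_carrier[OF assms] that by (metis carrier_vecD eq_vecI subsetD)
    then show ?thesis by fastforce
  qed
  moreover have "openin (prod_zariski ?Y ?Y) (\<Union>i\<in>{..<n}. {(x, y). x \<in> Z \<and> y \<in> Z \<and> x $ i - y $ i \<noteq> 0})"
    using 1 by (intro openin_Union) auto
  ultimately show ?thesis unfolding variety_def closedin_def topspace_prod_zariski[OF sh sh]
    using affine_prevariety[OF assms] by auto
qed

section \<open>Irreducibility: density of open sets and identity theorems\<close>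

lemma irreducible_open_Int:
  assumes "irreducible_variety X" "openin (top X) U" "U \<noteq> {}" "openin (top X) V" "V \<noteq> {}"
  shows "U \<inter> V \<noteq> {}"
proof
  assume "U \<inter> V = {}"
  moreover have "U \<subseteq> pts X" "V \<subseteq> pts X" using openin_subset assms by blast+
  ultimately have "(pts X - U) \<union> (pts X - V) = pts X" by blast
  moreover have "closedin (top X) (pts X - U)" "closedin (top X) (pts X - V)" using assms by blast+
  ultimately have "pts X - U = pts X \<or> pts X - V = pts X"
    using assms(1) unfolding irreducible_variety_def by meson
  then show False using assms(3,5) \<open>U \<subseteq> pts X\<close> \<open>V \<subseteq> pts X\<close> by blast
qed

lemma irreducible_open_Inter:
  assumes X: "irreducible_variety X" and I: "finite I"
    and V: "\<And>i. i \<in> I \<Longrightarrow> openin (top X) (V i) \<and> V i \<noteq> {}"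
  shows "openin (top X) (pts X \<inter> (\<Inter>i\<in>I. V i)) \<and> pts X \<inter> (\<Inter>i\<in>I. V i) \<noteq> {}"
  using I V
proof (induction I)
  case empty
  then show ?case using X by (simp add: irreducible_variety_def)
next
  case (insert i I)
  then have "openin (top X) (V i)" "V i \<noteq> {}"
    "openin (top X) (pts X \<inter> (\<Inter>i\<in>I. V i))" "pts X \<inter> (\<Inter>i\<in>I. V i) \<noteq> {}" by auto
  from irreducible_open_Int[OF X this] openin_Int[OF this(1,3)]
  show ?case by (simp add: Int_ac)
qed

lemma irreducible_variety_variety: "irreducible_variety X \<Longrightarrow> variety X"
  and irreducible_variety_prevariety: "irreducible_variety X \<Longrightarrow> prevariety X"
  and irreducible_variety_sheaf: "irreducible_variety X \<Longrightarrow> function_sheaf X"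
  by (auto simp: irreducible_variety_def variety_def prevariety_def)

lemma irreducible_variety_nonempty: "irreducible_variety X \<Longrightarrow> pts X \<noteq> {}"
  unfolding irreducible_variety_def by (elim conjE)

text \<open>Identity theorem: a nonempty disagreement locus would be open, and irreducibility would
  make it meet \<open>W\<close>.\<close>

lemma morphism_eqI:
  assumes X: "irreducible_variety X" and Y: "variety Y" and U: "openin (top X) U"
    and \<phi>: "morphism (open_sub X U) Y \<phi>" and \<psi>: "morphism (open_sub X U) Y \<psi>"
    and W: "openin (top X) W" "W \<noteq> {}" "W \<subseteq> U" "\<And>x. x \<in> W \<Longrightarrow> \<phi> x = \<psi> x" and x: "x \<in> U"
  shows "\<phi> x = \<psi> x"
proof (rule ccontr)
  assume "\<phi> x \<noteq> \<psi> x"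
  then have "{x \<in> U. \<phi> x \<noteq> \<psi> x} \<noteq> {}" using x by blast
  then have "W \<inter> {x \<in> U. \<phi> x \<noteq> \<psi> x} \<noteq> {}"
    using irreducible_open_Int[OF X W(1,2) openin_morphism_neq[OF irreducible_variety_prevariety[OF X] Y U \<phi> \<psi>]]
    by blast
  then show False using W(4) by blast
qed

lemma reg_zeroI:
  assumes X: "irreducible_variety X" and U: "openin (top X) U" and f: "f \<in> reg X U"
    and W: "openin (top X) W" "W \<noteq> {}" "\<And>x. x \<in> W \<Longrightarrow> x \<in> U \<Longrightarrow> f x = 0" and x: "x \<in> U"
  shows "f x = 0"
proof (rule ccontr)
  assume "f x \<noteq> 0"
  then have "{x \<in> U. f x \<noteq> 0} \<noteq> {}" using x by blast
  then have "W \<inter> {x \<in> U. f x \<noteq> 0} \<noteq> {}"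
    using irreducible_open_Int[OF X W(1,2) openin_neq_0[OF irreducible_variety_prevariety[OF X] U f]]
    by blast
  then show False using W(3) by blast
qed

text \<open>The assumption says that the vanishing ideal of \<open>Z\<close> is prime, phrased by
  witnesses. Two proper closed sets miss points \<open>a\<close> and \<open>b\<close>, and principal
  open sets around these points inside the complements must meet.\<close>

lemma affine_irreducibleI:
  fixes Z :: "'k::field vec set"
  assumes Z: "algebraic_set n Z" "Z \<noteq> {}"
    and prime: "\<And>p q a b. p \<in> poly_fun n \<Longrightarrow> q \<in> poly_fun n \<Longrightarrow> a \<in> Z \<Longrightarrow> p a \<noteq> 0 \<Longrightarrow> b \<in> Z \<Longrightarrow> q b \<noteq> 0 \<Longrightarrow>
       \<exists>z\<in>Z. p z \<noteq> 0 \<and> q z \<noteq> 0"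
  shows "irreducible_variety (affine_variety n Z)"
  unfolding irreducible_variety_def
proof (intro conjI allI impI)
  show "variety (affine_variety n Z)" by (rule affine_variety_variety[OF Z(1)])
  show "pts (affine_variety n Z) \<noteq> {}" using Z by simp
  fix A B assume A: "closedin (top (affine_variety n Z)) A" and B: "closedin (top (affine_variety n Z)) B"
    and AB: "A \<union> B = pts (affine_variety n Z)"
  show "A = pts (affine_variety n Z) \<or> B = pts (affine_variety n Z)"
  proof (rule ccontr)
    assume "\<not> ?thesis"
    then obtain a b where ab: "a \<in> Z - A" "b \<in> Z - B" using AB by auto
    have oA: "openin (zariski n Z) (Z - A)" using A by (auto simp: closedin_def)
    have oB: "openin (zariski n Z) (Z - B)" using B by (auto simp: closedin_def)
    obtain p where p: "p \<in> poly_fun n" "p a \<noteq> 0" "{v \<in> Z. p v \<noteq> 0} \<subseteq> Z - A"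
      using oA ab unfolding openin_zariski by blast
    obtain q where q: "q \<in> poly_fun n" "q b \<noteq> 0" "{v \<in> Z. q v \<noteq> 0} \<subseteq> Z - B"
      using oB ab unfolding openin_zariski by blast
    obtain z where "z \<in> Z" "p z \<noteq> 0" "q z \<noteq> 0" using prime[OF p(1) q(1)] ab p q by blast
    then show False using p q AB by auto
  qed
qed

lemma algebraic_set_carrier_vec: "algebraic_set n (carrier_vec n)"
  unfolding algebraic_set_def by (rule exI[of _ "{}"]) auto

lemma affine_space_irreducible:
  "irreducible_variety (affine_space n :: ('k::field_char_0 vec, 'k) fspace)"
  unfolding affine_space_def
proof (rule affine_irreducibleI[OF algebraic_set_carrier_vec])
  show "carrier_vec n \<noteq> ({} :: 'k vec set)" using zero_carrier_vec by blast
qed (use poly_fun_no_zero_divisors in blast)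


section \<open>Rational maps\<close>

lemma rat_reps_iff:
  "(U, \<phi>) \<in> rat_reps X Y \<longleftrightarrow> openin (top X) U \<and> U \<noteq> {} \<and> morphism (open_sub X U) Y \<phi>"
  by (simp add: rat_reps_def)

text \<open>Both maps restrict to \<open>U \<inter> V\<close>, which meets \<open>W\<close> by
  irreducibility, so the identity theorem for morphisms applies there.\<close>

lemma rat_reps_eqI:
  assumes X: "irreducible_variety X" and Y: "variety Y"
    and U: "(U, \<phi>) \<in> rat_reps X Y" and V: "(V, \<psi>) \<in> rat_reps X Y"
    and W: "openin (top X) W" "W \<noteq> {}" "\<And>x. x \<in> W \<Longrightarrow> x \<in> U \<Longrightarrow> x \<in> V \<Longrightarrow> \<phi> x = \<psi> x"
    and x: "x \<in> U" "x \<in> V"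
  shows "\<phi> x = \<psi> x"
proof -
  note sh = irreducible_variety_sheaf[OF X]
  have U': "openin (top X) U" "U \<noteq> {}" "morphism (open_sub X U) Y \<phi>"
    and V': "openin (top X) V" "V \<noteq> {}" "morphism (open_sub X V) Y \<psi>"
    using U V by (auto simp: rat_reps_iff)
  have UV: "openin (top X) (U \<inter> V)" "U \<inter> V \<noteq> {}"
    using U' V' irreducible_open_Int[OF X] by auto
  have UVW: "openin (top X) (U \<inter> V \<inter> W)" "U \<inter> V \<inter> W \<noteq> {}"
    using UV W(1,2) irreducible_open_Int[OF X] by auto
  show ?thesis
    by (rule morphism_eqI[OF X Y UV(1) morphism_restrict[OF sh U'(1,3) UV(1)]
         morphism_restrict[OF sh V'(1,3) UV(1)] UVW]) (use W x in auto)
qed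

text \<open>Only transitivity has content: agreement of the outer representatives is known on the
  domain of the middle one and spreads from there to their whole overlap.\<close>

lemma equiv_rat_eq:
  assumes X: "irreducible_variety X" and Y: "variety Y"
  shows "equiv (rat_reps X Y) (rat_eq X Y)"
proof (rule equivI)
  show "rat_eq X Y \<subseteq> rat_reps X Y \<times> rat_reps X Y" by (auto simp: rat_eq_def)
  show "refl_on (rat_reps X Y) (rat_eq X Y)" by (rule refl_onI) (auto simp: rat_eq_def)
  show "sym (rat_eq X Y)" by (rule symI) (auto simp: rat_eq_def)
  show "trans (rat_eq X Y)"
  proof (rule transI, safe)
    fix U \<phi> V \<psi> W \<chi>
    assume 1: "((U, \<phi>), (V, \<psi>)) \<in> rat_eq X Y" and 2: "((V, \<psi>), (W, \<chi>)) \<in> rat_eq X Y"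
    have reps: "(U, \<phi>) \<in> rat_reps X Y" "(W, \<chi>) \<in> rat_reps X Y" "(V, \<psi>) \<in> rat_reps X Y"
      using 1 2 by (auto simp: rat_eq_def)
    have "\<phi> x = \<chi> x" if "x \<in> U" "x \<in> W" for x
      by (rule rat_reps_eqI[OF X Y reps(1,2), of V])
        (use 1 2 reps that in \<open>auto simp: rat_eq_def rat_reps_iff\<close>)
    then show "((U, \<phi>), (W, \<chi>)) \<in> rat_eq X Y" using reps by (simp add: rat_eq_def)
  qed
qed

lemma rat_maps_subset: "c \<in> rat_maps X Y \<Longrightarrow> (U, \<phi>) \<in> c \<Longrightarrow> (U, \<phi>) \<in> rat_reps X Y"
  by (auto simp: rat_maps_def quotient_def rat_eq_def)

lemma rat_maps_morphism:
  assumes "c \<in> rat_maps X Y" "(U, \<phi>) \<in> c"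
  shows "openin (top X) U" "U \<noteq> {}" "morphism (open_sub X U) Y \<phi>"
  using rat_maps_subset[OF assms] by (auto simp: rat_reps_iff)

lemma rat_maps_class:
  assumes X: "irreducible_variety X" and Y: "variety Y" and c: "c \<in> rat_maps X Y" and "(U, \<phi>) \<in> c"
  shows "c = rat_eq X Y `` {(U, \<phi>)}"
proof -
  from c obtain r where r: "c = rat_eq X Y `` {r}" unfolding rat_maps_def by (rule quotientE)
  then have "(r, (U, \<phi>)) \<in> rat_eq X Y" using assms(4) by simp
  from equiv_class_eq[OF equiv_rat_eq[OF X Y] this] show ?thesis using r by simp
qed

lemma rat_class:
  assumes X: "irreducible_variety X" and Y: "variety Y" and "(U, \<phi>) \<in> rat_reps X Y"
  shows "rat_eq X Y `` {(U, \<phi>)} \<in> rat_maps X Y" "(U, \<phi>) \<in> rat_eq X Y `` {(U, \<phi>)}"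
proof -
  show "rat_eq X Y `` {(U, \<phi>)} \<in> rat_maps X Y" unfolding rat_maps_def by (rule quotientI) (rule assms(3))
  show "(U, \<phi>) \<in> rat_eq X Y `` {(U, \<phi>)}" using assms(3) by (simp add: rat_eq_def)
qed

lemma rat_maps_rep:
  assumes "irreducible_variety X" "variety Y" "c \<in> rat_maps X Y"
  obtains U \<phi> where "(U, \<phi>) \<in> c"
proof -
  from assms(3) obtain r where r: "r \<in> rat_reps X Y" "c = rat_eq X Y `` {r}"
    unfolding rat_maps_def by (rule quotientE)
  obtain U \<phi> where "r = (U, \<phi>)" by (cases r)
  then show thesis using that r rat_class[OF assms(1,2)] by blast
qed

lemma rat_maps_agree:
  assumes X: "irreducible_variety X" and Y: "variety Y" and c: "c \<in> rat_maps X Y"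
    and "(U, \<phi>) \<in> c" "(V, \<psi>) \<in> c" "x \<in> U" "x \<in> V"
  shows "\<phi> x = \<psi> x"
  using rat_maps_class[OF X Y c assms(4)] assms(5-7) by (auto simp: rat_eq_def)

text \<open>This allows a representative to be replaced by any other one that agrees with it on some
  nonempty open set, in particular by a restriction.\<close>

lemma rat_maps_memI:
  assumes X: "irreducible_variety X" and Y: "variety Y" and c: "c \<in> rat_maps X Y"
    and U: "(U, \<phi>) \<in> c" and V: "(V, \<psi>) \<in> rat_reps X Y"
    and W: "openin (top X) W" "W \<noteq> {}" "\<And>x. x \<in> W \<Longrightarrow> x \<in> U \<Longrightarrow> x \<in> V \<Longrightarrow> \<phi> x = \<psi> x"
  shows "(V, \<psi>) \<in> c"
proof -
  have "((U, \<phi>), (V, \<psi>)) \<in> rat_eq X Y"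
    unfolding rat_eq_def using rat_maps_subset[OF c U] V rat_reps_eqI[OF X Y rat_maps_subset[OF c U] V W]
    by simp
  then show ?thesis using rat_maps_class[OF X Y c U] by blast
qed

lemma rat_maps_eqI:
  assumes X: "irreducible_variety X" and Y: "variety Y" and c: "c \<in> rat_maps X Y" and d: "d \<in> rat_maps X Y"
    and U: "(U, \<phi>) \<in> c" and V: "(V, \<psi>) \<in> d"
    and W: "openin (top X) W" "W \<noteq> {}" "\<And>x. x \<in> W \<Longrightarrow> x \<in> U \<Longrightarrow> x \<in> V \<Longrightarrow> \<phi> x = \<psi> x"
  shows "c = d"
proof -
  have "(V, \<psi>) \<in> c" by (rule rat_maps_memI[OF X Y c U rat_maps_subset[OF d V] W])
  then show ?thesis using rat_maps_class[OF X Y c] rat_maps_class[OF X Y d V] by metis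
qed

lemma rat_of_class:
  assumes X: "irreducible_variety X" and Y: "variety Y" and \<phi>: "morphism X Y \<phi>"
  shows "rat_of X Y \<phi> \<in> rat_maps X Y" "(pts X, \<phi>) \<in> rat_of X Y \<phi>"
proof -
  have "(pts X, \<phi>) \<in> rat_reps X Y" using X \<phi> by (simp add: rat_reps_iff irreducible_variety_def)
  from rat_class[OF X Y this] show "rat_of X Y \<phi> \<in> rat_maps X Y" "(pts X, \<phi>) \<in> rat_of X Y \<phi>"
    by (simp_all add: rat_of_def)
qed

lemma rat_of_cong:
  assumes X: "irreducible_variety X" and Y: "variety Y" and \<phi>: "morphism X Y \<phi>" "morphism X Y \<psi>"
    and "\<And>x. x \<in> pts X \<Longrightarrow> \<phi> x = \<psi> x"
  shows "rat_of X Y \<phi> = rat_of X Y \<psi>"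
  by (rule rat_maps_eqI[OF X Y rat_of_class(1)[OF X Y \<phi>(1)] rat_of_class(1)[OF X Y \<phi>(2)]
        rat_of_class(2)[OF X Y \<phi>(1)] rat_of_class(2)[OF X Y \<phi>(2)], of "pts X"])
     (use X assms(5) in \<open>auto simp: irreducible_variety_def\<close>)

lemma rat_of_eqD:
  assumes X: "irreducible_variety X" and Y: "variety Y" and \<phi>: "morphism X Y \<phi>" "morphism X Y \<psi>"
    and eq: "rat_of X Y \<phi> = rat_of X Y \<psi>" and x: "x \<in> pts X"
  shows "\<phi> x = \<psi> x"
  by (rule rat_maps_agree[OF X Y rat_of_class(1)[OF X Y \<phi>(1)] rat_of_class(2)[OF X Y \<phi>(1)] _ x x])
     (simp add: eq rat_of_class(2)[OF X Y \<phi>(2)])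

lemma dominant_preimage:
  assumes "dominant Y c" "(U, \<phi>) \<in> c" "openin (top Y) V" "V \<noteq> {}"
  shows "{x \<in> U. \<phi> x \<in> V} \<noteq> {}"
proof -
  obtain y where "y \<in> V" using assms(4) by blast
  have "(top Y) closure_of (\<phi> ` U) = pts Y" using assms(1,2) unfolding dominant_def by blast
  then have "y \<in> (top Y) closure_of (\<phi> ` U)" using \<open>y \<in> V\<close> openin_subset[OF assms(3)] by blast
  then show ?thesis using \<open>y \<in> V\<close> assms(3) unfolding in_closure_of by blast
qed

text \<open>\<open>dominant\<close> quantifies over all representatives. One with dense image
  suffices: the preimage of \<open>V\<close> under it is a nonempty open set, hence meets the domain
  of any other representative, and both maps agree there.\<close>

lemma dominantI:
  assumes X: "irreducible_variety X" and Y: "variety Y" and c: "c \<in> rat_maps X Y" "(U, \<phi>) \<in> c"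
    and dense: "\<And>V. openin (top Y) V \<Longrightarrow> V \<noteq> {} \<Longrightarrow> \<exists>x\<in>U. \<phi> x \<in> V"
  shows "dominant Y c"
  unfolding dominant_def
proof (safe)
  fix U' \<phi>' assume U': "(U', \<phi>') \<in> c"
  fix x
  show "x \<in> top Y closure_of \<phi>' ` U' \<Longrightarrow> x \<in> pts Y" by (simp add: in_closure_of)
  assume x: "x \<in> pts Y"
  show "x \<in> top Y closure_of \<phi>' ` U'" unfolding in_closure_of
  proof (intro conjI x allI impI)
    fix V assume V: "x \<in> V \<and> openin (top Y) V"
    note \<phi>m = rat_maps_morphism[OF c]
    have o: "openin (top X) {x \<in> U. \<phi> x \<in> V}" using morphism_preimage[OF \<phi>m(3,1)] V by blast
    have "{x \<in> U. \<phi> x \<in> V} \<noteq> {}" using dense V by blast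
    from irreducible_open_Int[OF X o this] rat_maps_morphism[OF c(1) U']
    obtain z where "z \<in> U'" "z \<in> U" "\<phi> z \<in> V" by blast
    then show "\<exists>y. y \<in> \<phi>' ` U' \<and> y \<in> V" using rat_maps_agree[OF X Y c(1) c(2) U'] by auto
  qed
qed

text \<open>Dominance of \<open>c\<close> keeps the domain of every composite nonempty, and all
  composites agree on overlaps, so the union of classes in \<open>rat_comp\<close> is one class.
  Composition can then be computed with any chosen representatives.\<close>

lemma rat_comp_class:
  assumes X: "irreducible_variety X" and Y: "irreducible_variety Y" and Z: "variety Z"
    and c: "c \<in> rat_maps X Y" "dominant Y c" and d: "d \<in> rat_maps Y Z"
    and U: "(U, \<phi>) \<in> c" and V: "(V, \<psi>) \<in> d"
  shows "rat_comp X Z d c \<in> rat_maps X Z" "({x \<in> U. \<phi> x \<in> V}, \<psi> \<circ> \<phi>) \<in> rat_comp X Z d c"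
proof -
  note vY = irreducible_variety_variety[OF Y]
  let ?S = "{(U \<inter> \<phi> -` V, \<psi> \<circ> \<phi>) | U \<phi> V \<psi>. (U, \<phi>) \<in> c \<and> (V, \<psi>) \<in> d}"
  have eq: "U \<inter> \<phi> -` V = {x \<in> U. \<phi> x \<in> V}" for U \<phi> V by auto
  have reps: "({x \<in> U. \<phi> x \<in> V}, \<psi> \<circ> \<phi>) \<in> rat_reps X Z" if "(U, \<phi>) \<in> c" "(V, \<psi>) \<in> d" for U \<phi> V \<psi>
  proof -
    note 1 = rat_maps_morphism[OF c(1) that(1)] and 2 = rat_maps_morphism[OF d that(2)]
    show ?thesis unfolding rat_reps_iff
      using morphism_preimage[OF 1(3,1) 2(1)] dominant_preimage[OF c(2) that(1) 2(1,2)]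
        morphism_compose[OF 1(1,3) 2(1,3)] by blast
  qed
  have rel: "(({x \<in> U. \<phi> x \<in> V}, \<psi> \<circ> \<phi>), ({x \<in> U'. \<phi>' x \<in> V'}, \<psi>' \<circ> \<phi>')) \<in> rat_eq X Z"
    if "(U, \<phi>) \<in> c" "(V, \<psi>) \<in> d" "(U', \<phi>') \<in> c" "(V', \<psi>') \<in> d" for U \<phi> V \<psi> U' \<phi>' V' \<psi>'
  proof -
    have "(\<psi> \<circ> \<phi>) x = (\<psi>' \<circ> \<phi>') x" if x: "x \<in> U" "\<phi> x \<in> V" "x \<in> U'" "\<phi>' x \<in> V'" for x
      using rat_maps_agree[OF X vY c(1) \<open>(U, \<phi>) \<in> c\<close> \<open>(U', \<phi>') \<in> c\<close> x(1,3)]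
        rat_maps_agree[OF Y Z d \<open>(V, \<psi>) \<in> d\<close> \<open>(V', \<psi>') \<in> d\<close>, of "\<phi> x"] x by simp
    then show ?thesis unfolding rat_eq_def using reps[OF that(1,2)] reps[OF that(3,4)] by simp
  qed
  have "rat_comp X Z d c = rat_eq X Z `` {({x \<in> U. \<phi> x \<in> V}, \<psi> \<circ> \<phi>)}"
  proof (rule subset_antisym)
    show "rat_eq X Z `` {({x \<in> U. \<phi> x \<in> V}, \<psi> \<circ> \<phi>)} \<subseteq> rat_comp X Z d c"
      unfolding rat_comp_def by (rule Image_mono[OF subset_refl]) (use U V in \<open>force simp: eq\<close>)
    show "rat_comp X Z d c \<subseteq> rat_eq X Z `` {({x \<in> U. \<phi> x \<in> V}, \<psi> \<circ> \<phi>)}"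
    proof
      fix r assume "r \<in> rat_comp X Z d c"
      then obtain U' \<phi>' V' \<psi>' where *: "(U', \<phi>') \<in> c" "(V', \<psi>') \<in> d"
        "(({x \<in> U'. \<phi>' x \<in> V'}, \<psi>' \<circ> \<phi>'), r) \<in> rat_eq X Z"
        unfolding rat_comp_def eq by blast
      have "(({x \<in> U. \<phi> x \<in> V}, \<psi> \<circ> \<phi>), r) \<in> rat_eq X Z"
        using rel[OF U V *(1,2)] *(3) equiv_rat_eq[OF X Z] by (meson equivE transD)
      then show "r \<in> rat_eq X Z `` {({x \<in> U. \<phi> x \<in> V}, \<psi> \<circ> \<phi>)}" by blast
    qed
  qed
  then show "rat_comp X Z d c \<in> rat_maps X Z" "({x \<in> U. \<phi> x \<in> V}, \<psi> \<circ> \<phi>) \<in> rat_comp X Z d c"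
    using rat_class[OF X Z reps[OF U V]] by auto
qed

lemma rat_comp_eqI:
  assumes X: "irreducible_variety X" and Y: "irreducible_variety Y" and Z: "variety Z"
    and c: "c \<in> rat_maps X Y" "dominant Y c" and d: "d \<in> rat_maps Y Z" and e: "e \<in> rat_maps X Z"
    and U: "(U, \<phi>) \<in> c" and V: "(V, \<psi>) \<in> d" and T: "(T, \<chi>) \<in> e"
    and W: "openin (top X) W" "W \<noteq> {}"
      "\<And>x. x \<in> W \<Longrightarrow> x \<in> U \<Longrightarrow> \<phi> x \<in> V \<Longrightarrow> x \<in> T \<Longrightarrow> \<psi> (\<phi> x) = \<chi> x"
  shows "rat_comp X Z d c = e"
  by (rule rat_maps_eqI[OF X Z rat_comp_class(1)[OF X Y Z c d U V] e rat_comp_class(2)[OF X Y Z c d U V] T W(1,2)])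
    (use W(3) in auto)

lemma rat_comp_eqD:
  assumes X: "irreducible_variety X" and Y: "irreducible_variety Y" and Z: "variety Z"
    and c: "c \<in> rat_maps X Y" "dominant Y c" and d: "d \<in> rat_maps Y Z"
    and U: "(U, \<phi>) \<in> c" and V: "(V, \<psi>) \<in> d" and T: "(T, \<chi>) \<in> rat_comp X Z d c"
    and x: "x \<in> U" "\<phi> x \<in> V" "x \<in> T"
  shows "\<psi> (\<phi> x) = \<chi> x"
  using rat_maps_agree[OF X Z rat_comp_class[OF X Y Z c d U V] T, of x] x by simp

lemma morphism_id: "function_sheaf X \<Longrightarrow> morphism X X (id :: 'p \<Rightarrow> 'p)" for X :: "('p, 'k::field) fspace"
proof -
  assume X: "function_sheaf X"
  have "morphism (open_sub X (pts X)) X id"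
  proof (rule morphismI)
    fix V assume V: "openin (top X) V"
    have *: "{x \<in> pts X. id x \<in> V} = V" using openin_subset[OF V] by auto
    show "openin (top X) {x \<in> pts X. id x \<in> V}" using V * by simp
    show "(\<lambda>x. f (id x)) \<in> reg X {x \<in> pts X. id x \<in> V}" if "f \<in> reg X V" for f
      unfolding * using that by simp
  qed auto
  then show ?thesis by simp
qed

lemma dominant_rat_of:
  assumes X: "irreducible_variety X" and Y: "variety Y" and \<phi>: "morphism X Y \<phi>"
    and surj: "\<And>y. y \<in> pts Y \<Longrightarrow> \<exists>x\<in>pts X. \<phi> x = y"
  shows "dominant Y (rat_of X Y \<phi>)"
proof (rule dominantI[OF X Y rat_of_class[OF X Y \<phi>]])
  fix V assume "openin (top Y) V" "V \<noteq> {}"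
  then obtain y where "y \<in> V" "y \<in> pts Y" using openin_subset by blast
  then show "\<exists>x\<in>pts X. \<phi> x \<in> V" using surj by metis
qed

lemma morphism_pts: "morphism X Y \<phi> \<Longrightarrow> x \<in> pts X \<Longrightarrow> \<phi> x \<in> pts (Y :: ('q, 'k) fspace)"
  for X :: "('p, 'k) fspace"
  using continuous_map_image_subset_topspace unfolding morphism_def by fastforce

lemma rat_comp_rat_of:
  assumes X: "irreducible_variety X" and Y: "irreducible_variety Y" and Z: "variety Z"
    and \<phi>: "morphism X Y \<phi>" "dominant Y (rat_of X Y \<phi>)" and \<psi>: "morphism Y Z \<psi>" and \<chi>: "morphism X Z \<chi>"
    and eq: "\<And>x. x \<in> pts X \<Longrightarrow> \<psi> (\<phi> x) = \<chi> x"
  shows "rat_comp X Z (rat_of Y Z \<psi>) (rat_of X Y \<phi>) = rat_of X Z \<chi>"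
proof -
  note vY = irreducible_variety_variety[OF Y]
  show ?thesis
    by (rule rat_comp_eqI[OF X Y Z rat_of_class(1)[OF X vY \<phi>(1)] \<phi>(2) rat_of_class(1)[OF Y Z \<psi>]
          rat_of_class(1)[OF X Z \<chi>] rat_of_class(2)[OF X vY \<phi>(1)] rat_of_class(2)[OF Y Z \<psi>]
          rat_of_class(2)[OF X Z \<chi>], of "pts X"])
       (use X eq in \<open>auto simp: irreducible_variety_def\<close>)
qed

text \<open>The map of the inverse group element inverts \<beta> g on points, which makes \<beta> g
  surjective, hence dominant, and then birational.\<close>

lemma rational_action_of_morphisms:
  fixes G :: "('g, 'b) monoid_scheme" and Y :: "('p, 'k::field) fspace"
  assumes G: "group G" and Y: "irreducible_variety Y"
    and mor: "\<And>g. g \<in> carrier G \<Longrightarrow> morphism Y Y (\<beta> g)"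
    and mult: "\<And>g h y. g \<in> carrier G \<Longrightarrow> h \<in> carrier G \<Longrightarrow> y \<in> pts Y \<Longrightarrow> \<beta> (g \<otimes>\<^bsub>G\<^esub> h) y = \<beta> g (\<beta> h y)"
    and one: "\<And>y. y \<in> pts Y \<Longrightarrow> \<beta> \<one>\<^bsub>G\<^esub> y = y"
    and faithful: "\<And>g. g \<in> carrier G \<Longrightarrow> (\<And>y. y \<in> pts Y \<Longrightarrow> \<beta> g y = y) \<Longrightarrow> g = \<one>\<^bsub>G\<^esub>"
  shows "rational_action G Y (\<lambda>g. rat_of Y Y (\<beta> g))"
proof -
  interpret group G by fact
  note vY = irreducible_variety_variety[OF Y]
  have inv: "\<beta> g (\<beta> (inv\<^bsub>G\<^esub> g) y) = y" "\<beta> (inv\<^bsub>G\<^esub> g) (\<beta> g y) = y" if "g \<in> carrier G" "y \<in> pts Y" for g y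
    using mult[of g "inv\<^bsub>G\<^esub> g" y] mult[of "inv\<^bsub>G\<^esub> g" g y] one that by auto
  have dom: "dominant Y (rat_of Y Y (\<beta> g))" if g: "g \<in> carrier G" for g
    by (rule dominant_rat_of[OF Y vY mor[OF g]])
      (use inv[OF g] morphism_pts[OF mor[of "inv\<^bsub>G\<^esub> g"]] g in blast)
  note cls = rat_of_class[OF Y vY]
  have id: "morphism Y Y id" by (rule morphism_id[OF irreducible_variety_sheaf[OF Y]])
  have bir: "birational Y Y (rat_of Y Y (\<beta> g))" if g: "g \<in> carrier G" for g
    unfolding birational_def
  proof (intro conjI bexI[of _ "rat_of Y Y (\<beta> (inv\<^bsub>G\<^esub> g))"])
    show "rat_comp Y Y (rat_of Y Y (\<beta> (inv\<^bsub>G\<^esub> g))) (rat_of Y Y (\<beta> g)) = rat_of Y Y id"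
      by (rule rat_comp_rat_of[OF Y Y vY mor[OF g] dom[OF g] mor id]) (use g inv in auto)
    show "rat_comp Y Y (rat_of Y Y (\<beta> g)) (rat_of Y Y (\<beta> (inv\<^bsub>G\<^esub> g))) = rat_of Y Y id"
      by (rule rat_comp_rat_of[OF Y Y vY mor dom mor[OF g] id]) (use g inv in auto)
  qed (use g mor dom cls in auto)
  show ?thesis unfolding rational_action_def
  proof (intro conjI Y)
    show "(\<lambda>g. rat_of Y Y (\<beta> g)) \<in> hom G (Bir Y)"
    proof (rule homI)
      show "rat_of Y Y (\<beta> g) \<in> carrier (Bir Y)" if "g \<in> carrier G" for g
        using bir[OF that] by (simp add: Bir_def)
      show "rat_of Y Y (\<beta> (g \<otimes>\<^bsub>G\<^esub> h)) = rat_of Y Y (\<beta> g) \<otimes>\<^bsub>Bir Y\<^esub> rat_of Y Y (\<beta> h)"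
        if "g \<in> carrier G" "h \<in> carrier G" for g h
        using rat_comp_rat_of[OF Y Y vY mor[OF that(2)] dom[OF that(2)] mor[OF that(1)] mor, of "g \<otimes>\<^bsub>G\<^esub> h"]
          that mult by (simp add: Bir_def)
    qed
    show "inj_on (\<lambda>g. rat_of Y Y (\<beta> g)) (carrier G)"
    proof (rule inj_onI)
      fix g h assume gh: "g \<in> carrier G" "h \<in> carrier G" and eq: "rat_of Y Y (\<beta> g) = rat_of Y Y (\<beta> h)"
      have "\<beta> (inv\<^bsub>G\<^esub> h \<otimes>\<^bsub>G\<^esub> g) y = y" if "y \<in> pts Y" for y
        using rat_of_eqD[OF Y vY mor[OF gh(1)] mor[OF gh(2)] eq that] mult[of "inv\<^bsub>G\<^esub> h" g y] inv(2)[OF gh(2) that]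
          gh that by simp
      then have "inv\<^bsub>G\<^esub> h \<otimes>\<^bsub>G\<^esub> g = \<one>\<^bsub>G\<^esub>" using faithful gh by simp
      then show "g = h" using gh by (metis inv_closed inv_inv inv_equality)
    qed
  qed
qed


section \<open>Restricting a rational action to an invariant open set\<close>

text \<open>An honest action on one open set that represents \<rho>. Containment in a single chart
  is required because the coordinates of that chart later separate the points of an orbit.\<close>

definition action_model ::
  "('g, 'b) monoid_scheme \<Rightarrow> ('p, 'k::field) fspace \<Rightarrow> ('g \<Rightarrow> ('p, 'p) rat_map) \<Rightarrow>
   'p set \<Rightarrow> ('g \<Rightarrow> 'p \<Rightarrow> 'p) \<Rightarrow> bool" where
  "action_model G X \<rho> W \<alpha> \<longleftrightarrow> openin (top X) W \<and> W \<noteq> {} \<and>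
     (\<forall>g\<in>carrier G. (W, \<alpha> g) \<in> \<rho> g) \<and> (\<forall>g\<in>carrier G. \<forall>x\<in>W. \<alpha> g x \<in> W) \<and>
     (\<forall>g\<in>carrier G. \<forall>h\<in>carrier G. \<forall>x\<in>W. \<alpha> (g \<otimes>\<^bsub>G\<^esub> h) x = \<alpha> g (\<alpha> h x)) \<and>
     (\<forall>x\<in>W. \<alpha> \<one>\<^bsub>G\<^esub> x = x) \<and>
     (\<forall>g\<in>carrier G. g \<noteq> \<one>\<^bsub>G\<^esub> \<longrightarrow> (\<exists>x\<in>W. \<alpha> g x \<noteq> x)) \<and>
     (\<exists>A N \<xi>. chart X A N \<xi> \<and> W \<subseteq> A)"

lemma action_modelD:
  assumes "action_model G X \<rho> W \<alpha>"
  shows "openin (top X) W" "W \<noteq> {}" "\<And>g. g \<in> carrier G \<Longrightarrow> (W, \<alpha> g) \<in> \<rho> g"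
    "\<And>g x. g \<in> carrier G \<Longrightarrow> x \<in> W \<Longrightarrow> \<alpha> g x \<in> W"
    "\<And>g h x. g \<in> carrier G \<Longrightarrow> h \<in> carrier G \<Longrightarrow> x \<in> W \<Longrightarrow> \<alpha> (g \<otimes>\<^bsub>G\<^esub> h) x = \<alpha> g (\<alpha> h x)"
    "\<And>x. x \<in> W \<Longrightarrow> \<alpha> \<one>\<^bsub>G\<^esub> x = x"
    "\<And>g. g \<in> carrier G \<Longrightarrow> g \<noteq> \<one>\<^bsub>G\<^esub> \<Longrightarrow> \<exists>x\<in>W. \<alpha> g x \<noteq> x"
    "\<exists>A N \<xi>. chart X A N \<xi> \<and> W \<subseteq> A"
  using assms unfolding action_model_def by simp_all

lemma rational_actionD:
  assumes "rational_action G X \<rho>"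
  shows "irreducible_variety X" "\<And>g. g \<in> carrier G \<Longrightarrow> \<rho> g \<in> rat_maps X X"
    "\<And>g. g \<in> carrier G \<Longrightarrow> dominant X (\<rho> g)"
    "\<And>g h. g \<in> carrier G \<Longrightarrow> h \<in> carrier G \<Longrightarrow> \<rho> (g \<otimes>\<^bsub>G\<^esub> h) = rat_comp X X (\<rho> g) (\<rho> h)"
    "inj_on \<rho> (carrier G)"
proof -
  have hom: "\<rho> \<in> hom G (Bir X)" and "irreducible_variety X" "inj_on \<rho> (carrier G)"
    using assms by (simp_all add: rational_action_def)
  then show "irreducible_variety X" "inj_on \<rho> (carrier G)" by simp_all
  have bir: "birational X X (\<rho> g)" if "g \<in> carrier G" for g
    using hom_in_carrier[OF hom that] by (simp add: Bir_def)
  show "\<rho> g \<in> rat_maps X X" "dominant X (\<rho> g)" if "g \<in> carrier G" for g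
    using bir[OF that] by (simp_all add: birational_def)
  show "\<rho> (g \<otimes>\<^bsub>G\<^esub> h) = rat_comp X X (\<rho> g) (\<rho> h)" if "g \<in> carrier G" "h \<in> carrier G" for g h
    using hom_mult[OF hom that] by (simp add: Bir_def)
qed

lemma action_model_exists:
  fixes G :: "('g, 'b) monoid_scheme" and X :: "('p, 'k::field) fspace"
  assumes G: "group G" and fin: "finite (carrier G)" and act: "rational_action G X \<rho>"
  obtains W \<alpha> where "action_model G X \<rho> W \<alpha>"
proof -
  interpret group G by fact
  note ra = rational_actionD[OF act]
  note X = ra(1) note vX = irreducible_variety_variety[OF X] note pX = irreducible_variety_prevariety[OF X]
  obtain x0 where "x0 \<in> pts X" using irreducible_variety_nonempty[OF X] by blast
  then obtain A N \<xi> where A: "x0 \<in> A" "chart X A N \<xi>" using prevariety_chart[OF pX] by metis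
  have oA: "openin (top X) A" "A \<noteq> {}" using A chart_openin by auto
  have "\<exists>r. r \<in> \<rho> g" if "g \<in> carrier G" for g using rat_maps_rep[OF X vX ra(2)[OF that]] by blast
  then obtain R where R: "\<And>g. g \<in> carrier G \<Longrightarrow> R g \<in> \<rho> g" by metis
  define U where "U g = fst (R g)" for g
  define \<alpha> where "\<alpha> g = snd (R g)" for g
  have U\<alpha>: "(U g, \<alpha> g) \<in> \<rho> g" if "g \<in> carrier G" for g using R[OF that] by (simp add: U_def \<alpha>_def)
  note m = rat_maps_morphism[OF ra(2) U\<alpha>]
  have mult: "\<alpha> g (\<alpha> h x) = \<alpha> (g \<otimes>\<^bsub>G\<^esub> h) x"
    if "g \<in> carrier G" "h \<in> carrier G" "x \<in> U h" "\<alpha> h x \<in> U g" "x \<in> U (g \<otimes>\<^bsub>G\<^esub> h)" for g h x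
    by (rule rat_comp_eqD[OF X X vX ra(2)[OF that(2)] ra(3)[OF that(2)] ra(2)[OF that(1)]
          U\<alpha>[OF that(2)] U\<alpha>[OF that(1)] _ that(3-5)])
       (use U\<alpha>[of "g \<otimes>\<^bsub>G\<^esub> h"] ra(4) that in simp)
  have D: "openin (top X) {x \<in> U g. \<alpha> g x \<in> V}" "{x \<in> U g. \<alpha> g x \<in> V} \<noteq> {}"
    if "g \<in> carrier G" "openin (top X) V" "V \<noteq> {}" for g V
    using morphism_preimage[OF m(3)[OF that(1,1)] m(1)[OF that(1,1)] that(2)]
      dominant_preimage[OF ra(3)[OF that(1)] U\<alpha>[OF that(1)] that(2,3)] by auto
  \<comment> \<open>Membership in every \<open>E (g, h)\<close> says that all translates of
    \<open>x\<close> lie in the chart and in the domain of every representative, which is what the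
    composition law \<open>mult\<close> asks for. The condition is inherited by translates, since a
    translate of a translate is again a translate.\<close>
  define E where "E = (\<lambda>(g, h). A \<inter> ({x \<in> U g. \<alpha> g x \<in> A} \<inter> {x \<in> U g. \<alpha> g x \<in> U h}))"
  have E: "openin (top X) (E i) \<and> E i \<noteq> {}" if "i \<in> carrier G \<times> carrier G" for i
  proof -
    from that obtain g h where gh: "i = (g, h)" "g \<in> carrier G" "h \<in> carrier G" by auto
    note 1 = D[OF gh(2) oA] and 2 = D[OF gh(2) m(1,2)[OF gh(3,3)]]
    have 3: "openin (top X) ({x \<in> U g. \<alpha> g x \<in> A} \<inter> {x \<in> U g. \<alpha> g x \<in> U h})" using 1 2 by blast
    have 4: "{x \<in> U g. \<alpha> g x \<in> A} \<inter> {x \<in> U g. \<alpha> g x \<in> U h} \<noteq> {}"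
      by (rule irreducible_open_Int[OF X 1 2])
    show ?thesis unfolding E_def gh(1) prod.case
      using irreducible_open_Int[OF X oA 3 4] openin_Int[OF oA(1) 3] by blast
  qed
  define W where "W = pts X \<inter> (\<Inter>i\<in>carrier G \<times> carrier G. E i)"
  have W: "openin (top X) W" "W \<noteq> {}"
    using irreducible_open_Inter[OF X _ E, of "carrier G \<times> carrier G"] fin by (auto simp: W_def)
  have Wpts: "W \<subseteq> pts X" by (auto simp: W_def)
  have WD: "x \<in> A" "x \<in> U g" "\<alpha> g x \<in> A" "\<alpha> g x \<in> U h" if "x \<in> W" "g \<in> carrier G" "h \<in> carrier G" for x g h
  proof -
    have "x \<in> E (g, h)" using that by (auto simp: W_def)
    then show "x \<in> A" "x \<in> U g" "\<alpha> g x \<in> A" "\<alpha> g x \<in> U h" by (auto simp: E_def)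
  qed
  have WI: "x \<in> W" if "x \<in> A" "\<And>g h. g \<in> carrier G \<Longrightarrow> h \<in> carrier G \<Longrightarrow> x \<in> U g \<and> \<alpha> g x \<in> A \<and> \<alpha> g x \<in> U h" for x
  proof -
    have "x \<in> E i" if "i \<in> carrier G \<times> carrier G" for i
    proof -
      from that obtain g h where "i = (g, h)" "g \<in> carrier G" "h \<in> carrier G" by auto
      then show ?thesis using \<open>x \<in> A\<close> \<open>\<And>g h. g \<in> carrier G \<Longrightarrow> h \<in> carrier G \<Longrightarrow> x \<in> U g \<and> \<alpha> g x \<in> A \<and> \<alpha> g x \<in> U h\<close>[of g h]
        by (simp add: E_def)
    qed
    moreover have "x \<in> pts X" using \<open>x \<in> A\<close> openin_subset[OF oA(1)] by blast
    ultimately show ?thesis by (simp add: W_def)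
  qed
  have multW: "\<alpha> (g \<otimes>\<^bsub>G\<^esub> h) x = \<alpha> g (\<alpha> h x)" if "g \<in> carrier G" "h \<in> carrier G" "x \<in> W" for g h x
    using mult[OF that(1,2)] WD[OF that(3)] that by simp
  have stable: "\<alpha> g x \<in> W" if g: "g \<in> carrier G" and x: "x \<in> W" for g x
  proof (rule WI)
    show "\<alpha> g x \<in> A" using WD[OF x g g] by simp
    fix l h assume lh: "l \<in> carrier G" "h \<in> carrier G"
    have "\<alpha> l (\<alpha> g x) = \<alpha> (l \<otimes>\<^bsub>G\<^esub> g) x" using multW[OF lh(1) g x] by simp
    then show "\<alpha> g x \<in> U l \<and> \<alpha> l (\<alpha> g x) \<in> A \<and> \<alpha> l (\<alpha> g x) \<in> U h"
      using WD[OF x g lh(1)] WD[OF x m_closed[OF lh(1) g] lh(2)] by simp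
  qed
  have repW: "(W, \<alpha> g) \<in> \<rho> g" if g: "g \<in> carrier G" for g
  proof (rule rat_maps_memI[OF X vX ra(2)[OF g] U\<alpha>[OF g] _ W])
    have "W \<subseteq> U g" using WD(2) g by blast
    then show "(W, \<alpha> g) \<in> rat_reps X X"
      using W morphism_restrict[OF irreducible_variety_sheaf[OF X] m(1)[OF g g] m(3)[OF g g] W(1)]
      by (simp add: rat_reps_iff)
  qed simp
  have idm: "morphism (open_sub X W) X id"
    using morphism_restrict[OF irreducible_variety_sheaf[OF X] openin_topspace _ W(1) Wpts]
      morphism_id[OF irreducible_variety_sheaf[OF X]] by simp
  \<comment> \<open>By multiplicativity \<alpha> of the unit is idempotent on \<open>W\<close>. If
    it moved a point, the set \<open>?E\<close> of moved points would be open and nonempty, and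
    dominance would give a point of \<open>W\<close> sent into \<open>?E\<close>, contradicting
    idempotency.\<close>
  have one: "\<alpha> \<one>\<^bsub>G\<^esub> x = x" if x: "x \<in> W" for x
  proof (rule ccontr)
    assume ne: "\<alpha> \<one>\<^bsub>G\<^esub> x \<noteq> x"
    let ?E = "{x \<in> W. \<alpha> \<one>\<^bsub>G\<^esub> x \<noteq> id x}"
    have oE: "openin (top X) ?E"
      by (rule openin_morphism_neq[OF pX vX W(1) rat_maps_morphism(3)[OF ra(2) repW] idm]) auto
    have "?E \<noteq> {}" using x ne by auto
    from D[OF one_closed oE this] irreducible_open_Int[OF X _ _ W]
    obtain y where y: "y \<in> W" "\<alpha> \<one>\<^bsub>G\<^esub> y \<in> ?E" by blast
    then show False using multW[OF one_closed one_closed y(1)] by simp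
  qed
  have faithful: "\<exists>x\<in>W. \<alpha> g x \<noteq> x" if g: "g \<in> carrier G" "g \<noteq> \<one>\<^bsub>G\<^esub>" for g
  proof (rule ccontr)
    assume n: "\<not> ?thesis"
    have "\<rho> g = \<rho> \<one>\<^bsub>G\<^esub>"
      by (rule rat_maps_eqI[OF X vX ra(2)[OF g(1)] ra(2)[OF one_closed] repW[OF g(1)] repW[OF one_closed] W])
         (use n one in auto)
    then show False using ra(5) g by (auto dest: inj_onD)
  qed
  have "action_model G X \<rho> W \<alpha>" unfolding action_model_def
    using W repW stable multW one faithful A(2) WD(1)[OF _ one_closed one_closed]
    by (intro conjI exI[of _ A] exI[of _ N] exI[of _ \<xi>]) auto
  then show thesis by (rule that)
qed


section \<open>Equivariant maps to linear representations\<close>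

lemma faithful_repD:
  assumes "faithful_rep G n r" and G: "group G"
  shows "\<And>g. g \<in> carrier G \<Longrightarrow> r g \<in> carrier_mat n n"
    "\<And>g h. g \<in> carrier G \<Longrightarrow> h \<in> carrier G \<Longrightarrow> r (g \<otimes>\<^bsub>G\<^esub> h) = r g * r h"
    "r \<one>\<^bsub>G\<^esub> = 1\<^sub>m n" "\<And>g. g \<in> carrier G \<Longrightarrow> r g = 1\<^sub>m n \<Longrightarrow> g = \<one>\<^bsub>G\<^esub>"
proof -
  have hom: "r \<in> hom G (GL n)" and inj: "inj_on r (carrier G)" using assms by (auto simp: faithful_rep_def)
  interpret R: ring "ring_mat TYPE('c) n ()" by (rule ring_mat)
  have GL: "group (GL n :: 'c mat monoid)" unfolding GL_def by (rule R.units_group)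
  show "r g \<in> carrier_mat n n" if "g \<in> carrier G" for g
    using hom_in_carrier[OF hom that] by (auto simp: GL_def units_of_carrier Units_def ring_mat_simps)
  show "r (g \<otimes>\<^bsub>G\<^esub> h) = r g * r h" if "g \<in> carrier G" "h \<in> carrier G" for g h
    using hom_mult[OF hom that] by (simp add: GL_def units_of_mult ring_mat_simps)
  show one: "r \<one>\<^bsub>G\<^esub> = 1\<^sub>m n"
    using hom_one[OF hom G GL] by (simp add: GL_def units_of_one ring_mat_simps)
  show "g = \<one>\<^bsub>G\<^esub>" if "g \<in> carrier G" "r g = 1\<^sub>m n" for g
    using inj_onD[OF inj] one that group.is_monoid[OF G] monoid.one_closed by metis
qed

lemma mult_mat_vec_nth:
  assumes "A \<in> carrier_mat n n" "v \<in> carrier_vec n" "i < n"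
  shows "(A *\<^sub>v v) $ i = (\<Sum>j<n. A $$ (i, j) * v $ j)"
  using assms by (auto simp: scalar_prod_def atLeast0LessThan intro!: sum.cong)

lemma mult_mat_vec_poly_fun:
  "i < n \<Longrightarrow> (\<lambda>v. \<Sum>j<n. A $$ (i, j) * v $ j) \<in> poly_fun n"
  by (intro poly_fun_sum poly_fun_smult poly_fun.coord) simp

lemma poly_fun_common_nonzero:
  fixes p :: "'i \<Rightarrow> 'k::field_char_0 vec \<Rightarrow> 'k"
  assumes "finite I" "\<And>i. i \<in> I \<Longrightarrow> p i \<in> poly_fun n" "\<And>i. i \<in> I \<Longrightarrow> \<exists>v\<in>carrier_vec n. p i v \<noteq> 0"
  shows "\<exists>v\<in>carrier_vec n. \<forall>i\<in>I. p i v \<noteq> 0"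
proof -
  have "\<exists>v\<in>carrier_vec n. (\<Prod>i\<in>I. p i v) \<noteq> 0"
    using assms
  proof (induction I)
    case empty
    then show ?case by (auto intro: exI[of _ "0\<^sub>v n"])
  next
    case (insert i I)
    obtain a where a: "a \<in> carrier_vec n" "p i a \<noteq> 0" using insert.prems by blast
    obtain b where b: "b \<in> carrier_vec n" "(\<Prod>i\<in>I. p i b) \<noteq> 0" using insert by blast
    have "\<exists>v\<in>carrier_vec n. p i v \<noteq> 0 \<and> (\<Prod>i\<in>I. p i v) \<noteq> 0"
      by (rule poly_fun_no_zero_divisors[where p = "p i" and q = "\<lambda>v. \<Prod>i\<in>I. p i v", OF _ poly_fun_prod a b])
         (use insert.prems in auto)
    then show ?case using insert by auto
  qed
  then show ?thesis using assms(1) by (metis prod_zero_iff)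
qed

lemma mat_eq_one:
  fixes A :: "'k::field mat"
  assumes A: "A \<in> carrier_mat n n" and "\<And>v. v \<in> carrier_vec n \<Longrightarrow> A *\<^sub>v v = v"
  shows "A = 1\<^sub>m n"
proof (rule eq_matI)
  fix i j assume ij: "i < dim_row (1\<^sub>m n :: 'k mat)" "j < dim_col (1\<^sub>m n :: 'k mat)"
  have "A $$ (i, j) = (A *\<^sub>v unit_vec n j) $ i"
    using A ij by (simp add: row_def scalar_prod_right_unit)
  then show "A $$ (i, j) = 1\<^sub>m n $$ (i, j)" using assms(2)[of "unit_vec n j"] ij by simp
qed (use A in auto)

text \<open>Each nontrivial \<open>g\<close> moves some vector, so some coordinate of
  \<open>r g - 1\<close> is a nonzero linear form. Finitely many nonzero polynomial functions have a
  common point of nonvanishing.\<close>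

lemma free_vector_exists:
  fixes r :: "'g \<Rightarrow> 'k::field_char_0 mat"
  assumes r: "faithful_rep G n r" and G: "group G" and fin: "finite (carrier G)"
  obtains w where "w \<in> carrier_vec n" "\<And>g. g \<in> carrier G \<Longrightarrow> g \<noteq> \<one>\<^bsub>G\<^esub> \<Longrightarrow> r g *\<^sub>v w \<noteq> w"
proof -
  note rD = faithful_repD[OF r G]
  let ?I = "carrier G - {\<one>\<^bsub>G\<^esub>}"
  have "\<exists>i<n. \<exists>v\<in>carrier_vec n. (r g *\<^sub>v v) $ i \<noteq> v $ i" if g: "g \<in> ?I" for g
  proof (rule ccontr)
    assume n: "\<not> ?thesis"
    have gG: "g \<in> carrier G" using g by simp
    have "r g *\<^sub>v v = v" if v: "v \<in> carrier_vec n" for v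
      by (rule eq_vecI) (use n rD(1)[OF gG] v in auto)
    then have "r g = 1\<^sub>m n" using mat_eq_one rD(1)[OF gG] by blast
    then show False using rD(4)[OF gG] g by simp
  qed
  then obtain i where i: "\<And>g. g \<in> ?I \<Longrightarrow> i g < n \<and> (\<exists>v\<in>carrier_vec n. (r g *\<^sub>v v) $ i g \<noteq> v $ i g)"
    by metis
  define p where "p g = (\<lambda>v. (\<Sum>j<n. r g $$ (i g, j) * v $ j) - v $ i g)" for g
  have "\<exists>v\<in>carrier_vec n. \<forall>g\<in>?I. p g v \<noteq> 0"
  proof (rule poly_fun_common_nonzero)
    show "p g \<in> poly_fun n" if "g \<in> ?I" for g
      unfolding p_def by (intro poly_fun_diff mult_mat_vec_poly_fun poly_fun.coord) (use i[OF that] in auto)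
    show "\<exists>v\<in>carrier_vec n. p g v \<noteq> 0" if "g \<in> ?I" for g
    proof -
      from i[OF that] obtain v where v: "v \<in> carrier_vec n" "(r g *\<^sub>v v) $ i g \<noteq> v $ i g" by blast
      have "(r g *\<^sub>v v) $ i g = (\<Sum>j<n. r g $$ (i g, j) * v $ j)"
        by (rule mult_mat_vec_nth[OF rD(1) v(1)]) (use i[OF that] that in auto)
      then have "p g v \<noteq> 0" using v(2) by (simp add: p_def)
      then show ?thesis using v(1) by blast
    qed
  qed (use fin in simp)
  then obtain w where w: "w \<in> carrier_vec n" "\<And>g. g \<in> ?I \<Longrightarrow> p g w \<noteq> 0" by blast
  have "r g *\<^sub>v w \<noteq> w" if g: "g \<in> carrier G" "g \<noteq> \<one>\<^bsub>G\<^esub>" for g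
  proof
    assume "r g *\<^sub>v w = w"
    then have "p g w = 0" using mult_mat_vec_nth[OF rD(1)[OF g(1)] w(1), of "i g"] i[of g] g by (simp add: p_def)
    then show False using w(2)[of g] g by simp
  qed
  then show thesis using that w by blast
qed

lemma action_model_morphism:
  assumes "rational_action G X \<rho>" "action_model G X \<rho> W \<alpha>" "g \<in> carrier G"
  shows "morphism (open_sub X W) X (\<alpha> g)"
  using rat_maps_morphism(3) rational_actionD(2)[OF assms(1,3)] action_modelD(3)[OF assms(2,3)] by metis

lemma action_model_pullback:
  assumes act: "rational_action G X \<rho>" and W: "action_model G X \<rho> W \<alpha>" and g: "g \<in> carrier G" and f: "f \<in> reg X W"
  shows "(\<lambda>x. f (\<alpha> g x)) \<in> reg X W"
proof -
  note wD = action_modelD[OF W]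
  have "{x \<in> W. \<alpha> g x \<in> W} = W" using wD(4)[OF g] by auto
  then show ?thesis using morphism_pullback[OF action_model_morphism[OF act W g] wD(1) wD(1) f] by simp
qed

lemma free_point_exists:
  assumes G: "group G" and fin: "finite (carrier G)" and act: "rational_action G X \<rho>"
    and W: "action_model G X \<rho> W \<alpha>"
  obtains x0 where "x0 \<in> W" "\<And>g. g \<in> carrier G \<Longrightarrow> g \<noteq> \<one>\<^bsub>G\<^esub> \<Longrightarrow> \<alpha> g x0 \<noteq> x0"
proof -
  note X = rational_actionD(1)[OF act] note wD = action_modelD[OF W]
  have idm: "morphism (open_sub X W) X id"
    using morphism_restrict[OF irreducible_variety_sheaf[OF X] openin_topspace _ wD(1) openin_subset[OF wD(1)]]
      morphism_id[OF irreducible_variety_sheaf[OF X]] by simp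
  \<comment> \<open>Setting \<open>V\<close> to \<open>W\<close> at the unit keeps the intersection
    inside \<open>W\<close>; the other sets are nonempty by faithfulness and open by
    separatedness.\<close>
  define V where "V g = (if g = \<one>\<^bsub>G\<^esub> then W else {x \<in> W. \<alpha> g x \<noteq> id x})" for g
  have "openin (top X) (V g) \<and> V g \<noteq> {}" if g: "g \<in> carrier G" for g
  proof (cases "g = \<one>\<^bsub>G\<^esub>")
    case True then show ?thesis using wD(1,2) by (simp add: V_def)
  next
    case False
    then show ?thesis
      using openin_morphism_neq[OF irreducible_variety_prevariety[OF X] irreducible_variety_variety[OF X] wD(1)
          action_model_morphism[OF act W g] idm] wD(7)[OF g False] by (auto simp: V_def)
  qed
  from irreducible_open_Inter[OF X fin, of V, OF this] obtain x0 where x0: "\<And>g. g \<in> carrier G \<Longrightarrow> x0 \<in> V g" by blast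
  have "x0 \<in> W" using x0[of "\<one>\<^bsub>G\<^esub>"] G by (simp add: V_def group.is_monoid monoid.one_closed)
  moreover have "\<alpha> g x0 \<noteq> x0" if "g \<in> carrier G" "g \<noteq> \<one>\<^bsub>G\<^esub>" for g
    using x0[OF that(1)] that by (simp add: V_def)
  ultimately show thesis by (rule that)
qed

text \<open>The map is the average \<open>x \<mapsto> \<Sum>g. u (g x) \<cdot> g\<^sup>-\<^sup>1 w\<close>, where \<open>w\<close> and \<open>x0\<close> have trivial stabilizers
  and \<open>u\<close> vanishes at all \<open>g x0\<close> other than \<open>x0\<close>, so that \<open>x0\<close> is sent to a multiple of \<open>w\<close>.\<close>

lemma equivariant_map_exists:
  fixes r :: "'g \<Rightarrow> 'k::field_char_0 mat"
  assumes G: "group G" and fin: "finite (carrier G)" and act: "rational_action G X \<rho>"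
    and W: "action_model G X \<rho> W \<alpha>" and r: "faithful_rep G n r"
  obtains \<phi> x0 where "\<And>x. \<phi> x \<in> carrier_vec n" "\<And>i. i < n \<Longrightarrow> (\<lambda>x. \<phi> x $ i) \<in> reg X W"
    "\<And>g x. g \<in> carrier G \<Longrightarrow> x \<in> W \<Longrightarrow> \<phi> (\<alpha> g x) = r g *\<^sub>v \<phi> x"
    "x0 \<in> W" "\<And>g. g \<in> carrier G \<Longrightarrow> g \<noteq> \<one>\<^bsub>G\<^esub> \<Longrightarrow> r g *\<^sub>v \<phi> x0 \<noteq> \<phi> x0"
proof -
  interpret group G by fact
  note X = rational_actionD(1)[OF act] note sh = irreducible_variety_sheaf[OF X]
  note wD = action_modelD[OF W] note rD = faithful_repD[OF r G]
  obtain A N \<xi> where A: "chart X A N \<xi>" "W \<subseteq> A" using wD(8) by blast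
  obtain x0 where x0: "x0 \<in> W" "\<And>g. g \<in> carrier G \<Longrightarrow> g \<noteq> \<one>\<^bsub>G\<^esub> \<Longrightarrow> \<alpha> g x0 \<noteq> x0"
    using free_point_exists[OF G fin act W] by metis
  obtain w where w: "w \<in> carrier_vec n" "\<And>g. g \<in> carrier G \<Longrightarrow> g \<noteq> \<one>\<^bsub>G\<^esub> \<Longrightarrow> r g *\<^sub>v w \<noteq> w"
    using free_vector_exists[OF r G fin] by metis
  let ?I = "carrier G - {\<one>\<^bsub>G\<^esub>}"
  \<comment> \<open>Orbits of points of \<open>W\<close> stay in the chart, on which \<xi> is
    injective, so some coordinate separates \<open>\<alpha> g x0\<close> from \<open>x0\<close>. The
    polynomial \<open>q\<close> has one linear factor in such a coordinate for each nontrivial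
    \<open>g\<close>.\<close>
  have "\<exists>i<N. \<xi> (\<alpha> g x0) $ i \<noteq> \<xi> x0 $ i" if g: "g \<in> ?I" for g
  proof (rule ccontr)
    assume n: "\<not> ?thesis"
    have in_A: "\<alpha> g x0 \<in> A" "x0 \<in> A" using wD(4) g x0(1) A(2) by auto
    have "\<xi> (\<alpha> g x0) = \<xi> x0"
      by (rule eq_vecI) (use n carrier_vecD[OF chart_carrier[OF A(1) in_A(1)]]
          carrier_vecD[OF chart_carrier[OF A(1) in_A(2)]] in auto)
    then have "\<alpha> g x0 = x0" using inj_onD[OF chart_inj[OF A(1)]] in_A by blast
    then show False using x0(2) g by auto
  qed
  then obtain i where i: "\<And>g. g \<in> ?I \<Longrightarrow> i g < N \<and> \<xi> (\<alpha> g x0) $ i g \<noteq> \<xi> x0 $ i g" by metis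
  define q where "q v = (\<Prod>g\<in>?I. v $ i g - \<xi> (\<alpha> g x0) $ i g)" for v
  define u where "u x = q (\<xi> x)" for x
  have q: "q \<in> poly_fun N"
    unfolding q_def by (intro poly_fun_prod poly_fun_diff poly_fun.coord poly_fun.const) (use i in blast)
  have u: "u \<in> reg X W" unfolding u_def
    by (rule reg_mono[OF sh chart_openin[OF A(1)] wD(1) A(2) chart_reg_poly[OF A(1) q]])
  have "\<xi> x0 $ i g - \<xi> (\<alpha> g x0) $ i g \<noteq> 0" if "g \<in> ?I" for g using i[OF that] by auto
  then have u0: "u x0 \<noteq> 0" unfolding u_def q_def using fin by (subst prod_zero_iff) blast+
  have u1: "u (\<alpha> g x0) = 0" if "g \<in> ?I" for g
    using that fin by (auto simp: u_def q_def intro!: prod_zero)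
  define \<phi> where "\<phi> x = vec n (\<lambda>i. \<Sum>g\<in>carrier G. u (\<alpha> g x) * (r (inv\<^bsub>G\<^esub> g) *\<^sub>v w) $ i)" for x
  have \<phi>c: "\<phi> x \<in> carrier_vec n" for x by (simp add: \<phi>_def)
  have \<phi>reg: "(\<lambda>x. \<phi> x $ i) \<in> reg X W" if "i < n" for i
  proof -
    have "(\<lambda>x. \<Sum>g\<in>carrier G. u (\<alpha> g x) * (r (inv\<^bsub>G\<^esub> g) *\<^sub>v w) $ i) \<in> reg X W"
      by (intro reg_sum[OF sh wD(1)] reg_mult[OF sh wD(1)] reg_const[OF sh wD(1)]
          action_model_pullback[OF act W _ u])
    then show ?thesis using that by (simp add: \<phi>_def)
  qed
  have \<phi>eq: "\<phi> (\<alpha> h x) = r h *\<^sub>v \<phi> x" if h: "h \<in> carrier G" and x: "x \<in> W" for h x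
  proof (rule eq_vecI)
    show dim: "dim_vec (\<phi> (\<alpha> h x)) = dim_vec (r h *\<^sub>v \<phi> x)" using rD(1)[OF h] by (simp add: \<phi>_def)
    fix k assume "k < dim_vec (r h *\<^sub>v \<phi> x)"
    then have k: "k < n" using dim by (simp add: \<phi>_def)
    \<comment> \<open>Replacing g by g h in the sum turns \<open>u (\<alpha> g x)\<close> into
      \<open>u\<close> at the translate of \<open>\<alpha> h x\<close> by g, while h times the
      inverse of g h collapses to the inverse of g.\<close>
    have bij: "bij_betw (\<lambda>g. g \<otimes>\<^bsub>G\<^esub> h) (carrier G) (carrier G)"
      by (rule bij_betwI[of _ _ _ "\<lambda>g. g \<otimes>\<^bsub>G\<^esub> inv\<^bsub>G\<^esub> h"]) (use h in \<open>auto simp: m_assoc\<close>)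
    have "(r h *\<^sub>v \<phi> x) $ k = (\<Sum>j<n. r h $$ (k, j) * (\<Sum>g\<in>carrier G. u (\<alpha> g x) * (r (inv\<^bsub>G\<^esub> g) *\<^sub>v w) $ j))"
      unfolding mult_mat_vec_nth[OF rD(1)[OF h] \<phi>c k] by (simp add: \<phi>_def)
    also have "\<dots> = (\<Sum>g\<in>carrier G. \<Sum>j<n. r h $$ (k, j) * (u (\<alpha> g x) * (r (inv\<^bsub>G\<^esub> g) *\<^sub>v w) $ j))"
      unfolding sum_distrib_left by (rule sum.swap)
    also have "\<dots> = (\<Sum>g\<in>carrier G. u (\<alpha> g x) * (r h *\<^sub>v (r (inv\<^bsub>G\<^esub> g) *\<^sub>v w)) $ k)"
    proof (rule sum.cong[OF refl])
      fix g assume g: "g \<in> carrier G"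
      have "r (inv\<^bsub>G\<^esub> g) *\<^sub>v w \<in> carrier_vec n" using rD(1)[of "inv\<^bsub>G\<^esub> g"] g w by simp
      from mult_mat_vec_nth[OF rD(1)[OF h] this k]
      show "(\<Sum>j<n. r h $$ (k, j) * (u (\<alpha> g x) * (r (inv\<^bsub>G\<^esub> g) *\<^sub>v w) $ j)) = u (\<alpha> g x) * (r h *\<^sub>v (r (inv\<^bsub>G\<^esub> g) *\<^sub>v w)) $ k"
        by (simp add: sum_distrib_left mult.left_commute)
    qed
    also have "\<dots> = (\<Sum>g\<in>carrier G. u (\<alpha> (g \<otimes>\<^bsub>G\<^esub> h) x) * (r h *\<^sub>v (r (inv\<^bsub>G\<^esub> (g \<otimes>\<^bsub>G\<^esub> h)) *\<^sub>v w)) $ k)"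
      using sum.reindex_bij_betw[OF bij, of "\<lambda>g. u (\<alpha> g x) * (r h *\<^sub>v (r (inv\<^bsub>G\<^esub> g) *\<^sub>v w)) $ k"] by simp
    also have "\<dots> = (\<Sum>g\<in>carrier G. u (\<alpha> g (\<alpha> h x)) * (r (inv\<^bsub>G\<^esub> g) *\<^sub>v w) $ k)"
    proof (rule sum.cong[OF refl])
      fix g assume g: "g \<in> carrier G"
      have "r h *\<^sub>v (r (inv\<^bsub>G\<^esub> (g \<otimes>\<^bsub>G\<^esub> h)) *\<^sub>v w) = (r h * r (inv\<^bsub>G\<^esub> (g \<otimes>\<^bsub>G\<^esub> h))) *\<^sub>v w"
        using assoc_mult_mat_vec[OF rD(1)[OF h] rD(1)[of "inv\<^bsub>G\<^esub> (g \<otimes>\<^bsub>G\<^esub> h)"] w(1)] g h by simp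
      also have "r h * r (inv\<^bsub>G\<^esub> (g \<otimes>\<^bsub>G\<^esub> h)) = r (inv\<^bsub>G\<^esub> g)"
        using rD(2)[of h "inv\<^bsub>G\<^esub> (g \<otimes>\<^bsub>G\<^esub> h)"] g h by (simp add: inv_mult_group m_assoc[symmetric])
      finally show "u (\<alpha> (g \<otimes>\<^bsub>G\<^esub> h) x) * (r h *\<^sub>v (r (inv\<^bsub>G\<^esub> (g \<otimes>\<^bsub>G\<^esub> h)) *\<^sub>v w)) $ k
         = u (\<alpha> g (\<alpha> h x)) * (r (inv\<^bsub>G\<^esub> g) *\<^sub>v w) $ k"
        using wD(5)[OF g h x] by simp
    qed
    finally show "\<phi> (\<alpha> h x) $ k = (r h *\<^sub>v \<phi> x) $ k" using k by (simp add: \<phi>_def)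
  qed
  \<comment> \<open>At \<open>x0\<close> every summand but that of the unit is killed by
    \<open>u\<close>, and \<open>u x0\<close> is nonzero, so \<phi> x0 inherits the trivial
    stabilizer of \<open>w\<close>.\<close>
  have \<phi>0: "\<phi> x0 = u x0 \<cdot>\<^sub>v w"
  proof (rule eq_vecI)
    fix k assume "k < dim_vec (u x0 \<cdot>\<^sub>v w)"
    then have k: "k < n" using w by simp
    have "(\<Sum>g\<in>carrier G. u (\<alpha> g x0) * (r (inv\<^bsub>G\<^esub> g) *\<^sub>v w) $ k) =
       (\<Sum>g\<in>{\<one>\<^bsub>G\<^esub>}. u (\<alpha> g x0) * (r (inv\<^bsub>G\<^esub> g) *\<^sub>v w) $ k)"
      by (rule sum.mono_neutral_right) (use fin u1 in auto)
    then show "\<phi> x0 $ k = (u x0 \<cdot>\<^sub>v w) $ k" using k w rD(3) wD(6)[OF x0(1)] by (simp add: \<phi>_def)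
  qed (use w in \<open>simp add: \<phi>_def\<close>)
  have "r g *\<^sub>v \<phi> x0 \<noteq> \<phi> x0" if g: "g \<in> carrier G" "g \<noteq> \<one>\<^bsub>G\<^esub>" for g
  proof
    assume "r g *\<^sub>v \<phi> x0 = \<phi> x0"
    then have *: "u x0 \<cdot>\<^sub>v (r g *\<^sub>v w) = u x0 \<cdot>\<^sub>v w"
      unfolding \<phi>0 mult_mat_vec[OF rD(1)[OF g(1)] w(1)] .
    have "r g *\<^sub>v w = w"
    proof (rule eq_vecI)
      fix k assume k: "k < dim_vec w"
      have "u x0 * (r g *\<^sub>v w) $ k = u x0 * w $ k"
        using arg_cong[OF *, of "\<lambda>v. v $ k"] k w rD(1)[OF g(1)] by simp
      then show "(r g *\<^sub>v w) $ k = w $ k" using u0 by simp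
    qed (use w rD(1)[OF g(1)] in auto)
    then show False using w(2)[OF g] by simp
  qed
  then show thesis using that[OF \<phi>c \<phi>reg \<phi>eq x0(1)] by blast
qed

lemma mult_mat_vec_morphism:
  fixes A :: "'k::field mat"
  assumes Z: "algebraic_set n Z" and A: "A \<in> carrier_mat n n" and AZ: "\<And>v. v \<in> Z \<Longrightarrow> A *\<^sub>v v \<in> Z"
  shows "morphism (affine_variety n Z) (affine_variety n Z) (\<lambda>v. A *\<^sub>v v)"
proof -
  let ?Y = "affine_variety n Z"
  note Zc = algebraic_set_carrier[OF Z]
  have o: "openin (top ?Y) (pts ?Y)" by (rule openin_topspace)
  have "morphism (open_sub ?Y (pts ?Y)) ?Y (\<lambda>v. A *\<^sub>v v)"
  proof (rule morphism_affineI[OF affine_prevariety[OF Z] o])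
    show "A *\<^sub>v v \<in> Z" if "v \<in> pts ?Y" for v using AZ that by simp
    show "(\<lambda>v. (A *\<^sub>v v) $ i) \<in> reg ?Y (pts ?Y)" if i: "i < n" for i
      by (rule reg_cong[OF affine_function_sheaf o, of "\<lambda>v. \<Sum>j<n. A $$ (i, j) * v $ j"])
        (use chart_reg_poly[OF chart_affine[OF Zc] mult_mat_vec_poly_fun[OF i, of A]] mult_mat_vec_nth[OF A _ i] Zc
          in \<open>auto simp del: index_mult_mat_vec\<close>)
  qed
  then show ?thesis by (simp only: open_sub_pts)
qed

text \<open>The hypothesis \<open>dense\<close> says that no principal open set of \<open>Z\<close>
  misses the image, and these sets form a base.\<close>

lemma affine_dense_dominant:
  assumes X: "irreducible_variety X" and Z: "algebraic_set n Z" and W: "openin (top X) W" "W \<noteq> {}"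
    and \<phi>Z: "\<And>x. x \<in> W \<Longrightarrow> \<phi> x \<in> Z" and \<phi>: "\<And>i. i < n \<Longrightarrow> (\<lambda>x. \<phi> x $ i) \<in> reg X W"
    and dense: "\<forall>p\<in>poly_fun n. (\<forall>x\<in>W. p (\<phi> x) = 0) \<longrightarrow> (\<forall>z\<in>Z. p z = 0)"
  defines "c \<equiv> rat_eq X (affine_variety n Z) `` {(W, \<phi>)}"
  shows "c \<in> rat_maps X (affine_variety n Z)" "(W, \<phi>) \<in> c" "dominant (affine_variety n Z) c"
proof -
  let ?Y = "affine_variety n Z"
  have "(W, \<phi>) \<in> rat_reps X ?Y" unfolding rat_reps_iff
    using W morphism_affineI[OF irreducible_variety_prevariety[OF X] W(1) \<phi>Z \<phi>] by blast
  from rat_class[OF X affine_variety_variety[OF Z] this]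
  show c: "c \<in> rat_maps X ?Y" "(W, \<phi>) \<in> c" by (simp_all add: c_def)
  show "dominant ?Y c"
  proof (rule dominantI[OF X affine_variety_variety[OF Z] c])
    fix V assume "openin (top ?Y) V" "V \<noteq> {}"
    then have V: "openin (zariski n Z) V" "V \<noteq> {}" by simp_all
    then obtain z where z: "z \<in> V" by blast
    obtain p where p: "p \<in> poly_fun n" "p z \<noteq> 0" "{v \<in> Z. p v \<noteq> 0} \<subseteq> V"
      using V(1) z unfolding openin_zariski by blast
    have "z \<in> Z" using V(1) z unfolding openin_zariski by blast
    then obtain x where "x \<in> W" "p (\<phi> x) \<noteq> 0" using dense p(1,2) by blast
    then show "\<exists>x\<in>W. \<phi> x \<in> V" using p(3) \<phi>Z by blast
  qed
qed

lemma compression_of_dense_map: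
  fixes r :: "'g \<Rightarrow> 'k::field mat"
  assumes G: "group G" and act: "rational_action G X \<rho>" and W: "action_model G X \<rho> W \<alpha>"
    and Z: "algebraic_set n Z" and Y: "irreducible_variety (affine_variety n Z)"
    and r: "\<And>g. g \<in> carrier G \<Longrightarrow> r g \<in> carrier_mat n n"
    and rZ: "\<And>g v. g \<in> carrier G \<Longrightarrow> v \<in> Z \<Longrightarrow> r g *\<^sub>v v \<in> Z"
    and \<phi>Z: "\<And>x. x \<in> W \<Longrightarrow> \<phi> x \<in> Z" and \<phi>: "\<And>i. i < n \<Longrightarrow> (\<lambda>x. \<phi> x $ i) \<in> reg X W"
    and eq: "\<And>g x. g \<in> carrier G \<Longrightarrow> x \<in> W \<Longrightarrow> \<phi> (\<alpha> g x) = r g *\<^sub>v \<phi> x"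
    and dense: "\<forall>p\<in>poly_fun n. (\<forall>x\<in>W. p (\<phi> x) = 0) \<longrightarrow> (\<forall>z\<in>Z. p z = 0)"
  shows "compression G X \<rho> (affine_variety n Z)
      (\<lambda>g. rat_of (affine_variety n Z) (affine_variety n Z) (\<lambda>v. r g *\<^sub>v v))
      (rat_eq X (affine_variety n Z) `` {(W, \<phi>)})"
proof -
  let ?Y = "affine_variety n Z"
  let ?c = "rat_eq X ?Y `` {(W, \<phi>)}"
  note X = rational_actionD(1)[OF act] note ra = rational_actionD[OF act] note wD = action_modelD[OF W]
  note vY = irreducible_variety_variety[OF Y]
  note c = affine_dense_dominant[where \<phi> = \<phi>, OF X Z wD(1,2) \<phi>Z \<phi> dense]
  have "equivariant G X \<rho> ?Y (\<lambda>g. rat_of ?Y ?Y (\<lambda>v. r g *\<^sub>v v)) ?c"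
    unfolding equivariant_def
  proof
    fix g assume g: "g \<in> carrier G"
    note m = rat_of_class[OF Y vY mult_mat_vec_morphism[OF Z r[OF g] rZ[OF g]]]
    note cl = rat_comp_class[OF X Y vY c(1,3) m(1) c(2) m(2)]
    show "rat_comp X ?Y ?c (\<rho> g) = rat_comp X ?Y (rat_of ?Y ?Y (\<lambda>v. r g *\<^sub>v v)) ?c"
      by (rule rat_comp_eqI[OF X X vY ra(2)[OF g] ra(3)[OF g] c(1) cl(1) wD(3)[OF g] c(2) cl(2) wD(1,2)])
         (simp_all add: eq[OF g] rZ[OF g])
  qed
  then show ?thesis unfolding compression_def using c by blast
qed

text \<open>\<open>Z\<close> is the Zariski closure of the image of \<open>W\<close>. It is
  irreducible because nonempty open subsets of \<open>W\<close> meet, stable because precomposition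
  with \<open>r g\<close> preserves the polynomials vanishing on the image, and the single vector
  \<phi> x0 of \<open>Z\<close> witnesses faithfulness.\<close>

lemma compression_onto_closure:
  fixes r :: "'g \<Rightarrow> 'k::field_char_0 mat"
  assumes G: "group G" and fin: "finite (carrier G)" and act: "rational_action G X \<rho>"
    and W: "action_model G X \<rho> W \<alpha>" and r: "faithful_rep G n r"
    and \<phi>c: "\<And>x. \<phi> x \<in> carrier_vec n" and \<phi>: "\<And>i. i < n \<Longrightarrow> (\<lambda>x. \<phi> x $ i) \<in> reg X W"
    and eq: "\<And>g x. g \<in> carrier G \<Longrightarrow> x \<in> W \<Longrightarrow> \<phi> (\<alpha> g x) = r g *\<^sub>v \<phi> x"
    and x0: "x0 \<in> W" "\<And>g. g \<in> carrier G \<Longrightarrow> g \<noteq> \<one>\<^bsub>G\<^esub> \<Longrightarrow> r g *\<^sub>v \<phi> x0 \<noteq> \<phi> x0"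
  defines "Z \<equiv> {v \<in> carrier_vec n. \<forall>p\<in>poly_fun n. (\<forall>x\<in>W. p (\<phi> x) = 0) \<longrightarrow> p v = 0}"
  shows "algebraic_set n Z" "irreducible_variety (affine_variety n Z)"
    "\<exists>\<sigma>. rational_action G (affine_variety n Z) \<sigma> \<and> compressible_into G X \<rho> (affine_variety n Z) \<sigma>"
proof -
  interpret group G by fact
  note X = rational_actionD(1)[OF act] note sh = irreducible_variety_sheaf[OF X]
  note pX = irreducible_variety_prevariety[OF X]
  note wD = action_modelD[OF W] note rD = faithful_repD[OF r G]
  have "Z = {v \<in> carrier_vec n. \<forall>p\<in>{p \<in> poly_fun n. \<forall>x\<in>W. p (\<phi> x) = 0}. p v = 0}"
    unfolding Z_def by blast
  then show Z: "algebraic_set n Z" unfolding algebraic_set_def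
    by (intro exI[of _ "{p \<in> poly_fun n. \<forall>x\<in>W. p (\<phi> x) = 0}"]) blast
  have Zc: "Z \<subseteq> carrier_vec n" by (auto simp: Z_def)
  have \<phi>Z: "\<phi> x \<in> Z" if "x \<in> W" for x using that \<phi>c by (auto simp: Z_def)
  have dense: "\<forall>p\<in>poly_fun n. (\<forall>x\<in>W. p (\<phi> x) = 0) \<longrightarrow> (\<forall>z\<in>Z. p z = 0)"
    by (auto simp: Z_def)
  show Y: "irreducible_variety (affine_variety n Z)"
  proof (rule affine_irreducibleI[OF Z])
    show "Z \<noteq> {}" using \<phi>Z x0 by blast
    fix p q a b assume p: "p \<in> poly_fun n" and q: "q \<in> poly_fun n" and a: "a \<in> Z" "p a \<noteq> 0" and b: "b \<in> Z" "q b \<noteq> 0"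
    have o: "openin (top X) {x \<in> W. s (\<phi> x) \<noteq> 0}" if "s \<in> poly_fun n" for s
      by (rule openin_neq_0[OF pX wD(1) reg_poly_fun[OF sh wD(1) that \<phi>]])
    have "{x \<in> W. p (\<phi> x) \<noteq> 0} \<noteq> {}" using dense p a by blast
    moreover have "{x \<in> W. q (\<phi> x) \<noteq> 0} \<noteq> {}" using dense q b by blast
    ultimately have "{x \<in> W. p (\<phi> x) \<noteq> 0} \<inter> {x \<in> W. q (\<phi> x) \<noteq> 0} \<noteq> {}"
      using irreducible_open_Int[OF X o[OF p] _ o[OF q]] by blast
    then show "\<exists>z\<in>Z. p z \<noteq> 0 \<and> q z \<noteq> 0" using \<phi>Z by blast
  qed
  have rZ: "r g *\<^sub>v v \<in> Z" if g: "g \<in> carrier G" and v: "v \<in> Z" for g v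
    unfolding Z_def
  proof (intro CollectI conjI ballI impI)
    show "r g *\<^sub>v v \<in> carrier_vec n" using rD(1)[OF g] v Zc by auto
    fix p assume p: "p \<in> poly_fun n" "\<forall>x\<in>W. p (\<phi> x) = 0"
    define p' where "p' v = p (vec n (\<lambda>i. \<Sum>j<n. r g $$ (i, j) * v $ j))" for v
    have p': "p' \<in> poly_fun n"
      unfolding p'_def by (rule poly_fun_compose[OF p(1) mult_mat_vec_poly_fun])
    have p'eq: "p' v = p (r g *\<^sub>v v)" if "v \<in> carrier_vec n" for v
      unfolding p'_def by (rule poly_fun_agree[OF p(1)]) (simp add: mult_mat_vec_nth[OF rD(1)[OF g] that])
    have "p' (\<phi> x) = 0" if "x \<in> W" for x
      using p'eq[OF \<phi>c] eq[OF g that] p(2) wD(4)[OF g that] by metis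
    then have "p' v = 0" using dense p' v by blast
    then show "p (r g *\<^sub>v v) = 0" using p'eq v Zc by auto
  qed
  have "rational_action G (affine_variety n Z)
      (\<lambda>g. rat_of (affine_variety n Z) (affine_variety n Z) (\<lambda>v. r g *\<^sub>v v))"
  proof (rule rational_action_of_morphisms[OF G Y])
    show "morphism (affine_variety n Z) (affine_variety n Z) (\<lambda>v. r g *\<^sub>v v)" if g: "g \<in> carrier G" for g
      by (rule mult_mat_vec_morphism[OF Z rD(1)[OF g] rZ[OF g]])
    show "r (g \<otimes>\<^bsub>G\<^esub> h) *\<^sub>v y = r g *\<^sub>v (r h *\<^sub>v y)"
      if "g \<in> carrier G" "h \<in> carrier G" "y \<in> pts (affine_variety n Z)" for g h y
      using rD(2)[OF that(1,2)] assoc_mult_mat_vec[OF rD(1)[OF that(1)] rD(1)[OF that(2)]] that(3) Zc by auto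
    show "r \<one>\<^bsub>G\<^esub> *\<^sub>v y = y" if "y \<in> pts (affine_variety n Z)" for y using rD(3) that Zc by auto
    show "g = \<one>\<^bsub>G\<^esub>" if "g \<in> carrier G" "\<And>y. y \<in> pts (affine_variety n Z) \<Longrightarrow> r g *\<^sub>v y = y" for g
      using x0(2)[OF that(1)] that(2)[of "\<phi> x0"] \<phi>Z[OF x0(1)] by auto
  qed
  then show "\<exists>\<sigma>. rational_action G (affine_variety n Z) \<sigma> \<and> compressible_into G X \<rho> (affine_variety n Z) \<sigma>"
    unfolding compressible_into_def
    using compression_of_dense_map[where \<phi> = \<phi> and r = r, OF G act W Z Y rD(1) rZ \<phi>Z \<phi> eq dense] by blast
qed


section \<open>Dimension of affine varieties\<close>

text \<open>The dimension count for indexed families: repeated members, which a set of vectors would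
  hide, also yield a relation.\<close>

lemma (in vector_space) dependent_family:
  assumes I: "finite I" and S: "finite S" and F: "\<And>i. i \<in> I \<Longrightarrow> F i \<in> span S" and less: "card S < card I"
  obtains c i where "i \<in> I" "c i \<noteq> 0" "(\<Sum>i\<in>I. scale (c i) (F i)) = 0"
proof (cases "inj_on F I")
  case True
  have "dependent (F ` I)"
  proof (rule ccontr)
    assume "independent (F ` I)"
    from independent_span_bound[OF S this] F have "card (F ` I) \<le> card S" by blast
    then show False using less card_image[OF True] by simp
  qed
  then obtain u v where u: "v \<in> F ` I" "u v \<noteq> 0" "(\<Sum>v\<in>F ` I. scale (u v) v) = 0"
    using dependent_finite[of "F ` I"] I by blast
  then obtain i where "i \<in> I" "u (F i) \<noteq> 0" by blast
  moreover have "(\<Sum>i\<in>I. scale (u (F i)) (F i)) = 0" using u(3) by (simp add: sum.reindex[OF True])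
  ultimately show thesis using that[of i "\<lambda>i. u (F i)"] by blast
next
  case False
  then obtain i j where ij: "i \<in> I" "j \<in> I" "i \<noteq> j" "F i = F j" by (auto simp: inj_on_def)
  \<comment> \<open>For two equal members the relation is their difference.\<close>
  define c where "c k = (if k = i then 1 else if k = j then - 1 else (0 :: 'a))" for k
  have "(\<Sum>k\<in>I. scale (c k) (F k)) = (\<Sum>k\<in>{i, j}. scale (c k) (F k))"
    by (rule sum.mono_neutral_right) (use I ij in \<open>auto simp: c_def\<close>)
  also have "\<dots> = 0" using ij by (simp add: c_def)
  finally show thesis using that[of i c] ij by (simp add: c_def)
qed

section \<open>Polynomial functions of bounded degree in each variable\<close>

interpretation fun_space: vector_space fun_scale by (rule vector_space_fun_scale)

lemma sum_fun_scale: "(\<Sum>i\<in>I. fun_scale (c i) (F i)) v = (\<Sum>i\<in>I. c i * F i v)"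
  by (induction I rule: infinite_finite_induct) (auto simp: fun_scale_def)

text \<open>Degrees are bounded in each variable separately, so the exponents form a box: for a
  constant bound \<open>M\<close> there are \<open>(M + 1) ^ n\<close> of them, the same shape as
  the number of points of a grid.\<close>

definition monomials :: "nat \<Rightarrow> (nat \<Rightarrow> nat) \<Rightarrow> ('k::field vec \<Rightarrow> 'k) set" where
  "monomials n B = (\<lambda>a v. \<Prod>i<n. v $ i ^ a i) ` (PiE {..<n} (\<lambda>i. {..B i}))"

definition bounded_degree :: "nat \<Rightarrow> (nat \<Rightarrow> nat) \<Rightarrow> ('k::field vec \<Rightarrow> 'k) set" where
  "bounded_degree n B = fun_space.span (monomials n B)"

lemma finite_monomials: "finite (monomials n B)"
  and card_monomials: "card (monomials n (\<lambda>_. M)) \<le> (M + 1) ^ n"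
proof -
  have fin: "finite (PiE {..<n} (\<lambda>i. {..B i}))" for B :: "nat \<Rightarrow> nat" by (intro finite_PiE) auto
  show "finite (monomials n B)" unfolding monomials_def using fin by simp
  have "card (monomials n (\<lambda>_. M)) \<le> card (PiE {..<n} (\<lambda>i. {..M}))"
    unfolding monomials_def by (rule card_image_le[OF fin])
  then show "card (monomials n (\<lambda>_. M)) \<le> (M + 1) ^ n" by (simp add: card_PiE)
qed

lemma monomialsI: "(\<And>i. i < n \<Longrightarrow> a i \<le> B i) \<Longrightarrow> (\<lambda>v. \<Prod>i<n. v $ i ^ a i) \<in> monomials n B"
  unfolding monomials_def by (rule image_eqI[of _ _ "restrict a {..<n}"]) auto

lemma bounded_degree_smult: "p \<in> bounded_degree n B \<Longrightarrow> (\<lambda>v. c * p v) \<in> bounded_degree n B"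
  unfolding bounded_degree_def using fun_space.span_scale[of p _ c] by (simp add: fun_scale_def)

lemma bounded_degree_add:
  "p \<in> bounded_degree n B \<Longrightarrow> q \<in> bounded_degree n B \<Longrightarrow> (\<lambda>v. p v + q v) \<in> bounded_degree n B"
  unfolding bounded_degree_def using fun_space.span_add[of p _ q] by (simp add: plus_fun_def)

lemma bounded_degree_diff:
  "p \<in> bounded_degree n B \<Longrightarrow> q \<in> bounded_degree n B \<Longrightarrow> (\<lambda>v. p v - q v) \<in> bounded_degree n B"
  unfolding bounded_degree_def using fun_space.span_diff[of p _ q] by (simp add: fun_diff_def)

lemma bounded_degree_mono:
  assumes "\<And>i. i < n \<Longrightarrow> B i \<le> B' i" "p \<in> bounded_degree n B"
  shows "p \<in> bounded_degree n B'"
proof -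
  have "PiE {..<n} (\<lambda>i. {..B i}) \<subseteq> PiE {..<n} (\<lambda>i. {..B' i})" using assms(1) by (intro PiE_mono) auto
  then have "monomials n B \<subseteq> monomials n B'" unfolding monomials_def by (rule image_mono)
  then show ?thesis using assms(2) fun_space.span_mono unfolding bounded_degree_def by blast
qed

lemma bounded_degree_const: "(\<lambda>_. c) \<in> bounded_degree n B"
proof -
  have "(\<lambda>v :: 'a vec. \<Prod>i<n. v $ i ^ 0) \<in> monomials n B" by (rule monomialsI) simp
  then have "(\<lambda>_ :: 'a vec. 1) \<in> bounded_degree n B" unfolding bounded_degree_def by (simp add: fun_space.span_base)
  from bounded_degree_smult[OF this, of c] show ?thesis by simp
qed

lemma bounded_degree_coord:
  assumes "i < n"
  shows "(\<lambda>v. v $ i) \<in> bounded_degree n (\<lambda>j. if j = i then 1 else 0)"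
proof -
  have "(\<lambda>v :: 'a vec. \<Prod>j<n. v $ j ^ (if j = i then 1 else 0)) \<in> monomials n (\<lambda>j. if j = i then 1 else 0)"
    by (rule monomialsI) simp
  moreover have "(\<Prod>j<n. v $ j ^ (if j = i then 1 else 0)) = v $ i" for v :: "'a vec"
  proof -
    have "(\<Prod>j<n. v $ j ^ (if j = i then 1 else 0)) = (\<Prod>j<n. if j = i then v $ j else 1)"
      by (rule prod.cong) auto
    then show ?thesis using assms by (simp add: prod.delta)
  qed
  ultimately show ?thesis unfolding bounded_degree_def by (simp add: fun_space.span_base)
qed

lemma bounded_degree_mult:
  assumes p: "p \<in> bounded_degree n B" and q: "q \<in> bounded_degree n B'"
  shows "(\<lambda>v. p v * q v) \<in> bounded_degree n (\<lambda>i. B i + B' i)"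
proof -
  have mono: "(\<lambda>v. a v * b v) \<in> bounded_degree n (\<lambda>i. B i + B' i)"
    if "a \<in> monomials n B" "b \<in> monomials n B'" for a b :: "'a vec \<Rightarrow> 'a"
  proof -
    from that obtain s t where s: "s \<in> PiE {..<n} (\<lambda>i. {..B i})" "a = (\<lambda>v. \<Prod>i<n. v $ i ^ s i)"
      and t: "t \<in> PiE {..<n} (\<lambda>i. {..B' i})" "b = (\<lambda>v. \<Prod>i<n. v $ i ^ t i)"
      unfolding monomials_def by (elim imageE) blast
    have "(\<lambda>v :: 'a vec. \<Prod>i<n. v $ i ^ (s i + t i)) \<in> monomials n (\<lambda>i. B i + B' i)"
      by (rule monomialsI) (use s t in \<open>auto intro!: add_mono dest: PiE_mem\<close>)
    then show ?thesis unfolding bounded_degree_def s t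
      by (simp add: fun_space.span_base power_add prod.distrib)
  qed
  have 1: "(\<lambda>v. a v * q v) \<in> bounded_degree n (\<lambda>i. B i + B' i)" if a: "a \<in> monomials n B" for a
    using q[unfolded bounded_degree_def]
  proof (induction rule: fun_space.span_induct_alt)
    case base
    then show ?case using bounded_degree_const[of 0] by (simp add: zero_fun_def)
  next
    case (step c x y)
    from bounded_degree_add[OF bounded_degree_smult[OF mono[OF a step(1)], of c] step(2)]
    show ?case by (simp add: fun_scale_def algebra_simps)
  qed
  from p[unfolded bounded_degree_def] show ?thesis
  proof (induction rule: fun_space.span_induct_alt)
    case base
    then show ?case using bounded_degree_const[of 0] by (simp add: zero_fun_def)
  next
    case (step c x y)
    from bounded_degree_add[OF bounded_degree_smult[OF 1[OF step(1)], of c] step(2)]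
    show ?case by (simp add: fun_scale_def algebra_simps)
  qed
qed

lemma bounded_degree_prod:
  assumes "finite I" "\<And>i. i \<in> I \<Longrightarrow> f i \<in> bounded_degree n (B i)"
  shows "(\<lambda>v. \<Prod>i\<in>I. f i v) \<in> bounded_degree n (\<lambda>j. \<Sum>i\<in>I. B i j)"
  using assms
proof (induction I)
  case empty
  then show ?case using bounded_degree_const[of 1] by simp
next
  case (insert i I)
  then show ?case using bounded_degree_mult[of "f i" n "B i" "\<lambda>v. \<Prod>i\<in>I. f i v"] by simp
qed

lemma poly_fun_bounded_degree:
  assumes "p \<in> poly_fun n"
  obtains D where "\<And>D'. D \<le> D' \<Longrightarrow> p \<in> bounded_degree n (\<lambda>_. D')"
proof -
  have "\<exists>D. p \<in> bounded_degree n (\<lambda>_. D)" using assms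
  proof (induction rule: poly_fun.induct)
    case (const c)
    then show ?case using bounded_degree_const by blast
  next
    case (coord i)
    have "(\<lambda>v. v $ i) \<in> bounded_degree n (\<lambda>_. 1)"
      by (rule bounded_degree_mono[OF _ bounded_degree_coord[OF coord]]) simp
    then show ?case by blast
  next
    case (add p q)
    then obtain D D' where "p \<in> bounded_degree n (\<lambda>_. D)" "q \<in> bounded_degree n (\<lambda>_. D')" by blast
    then have "p \<in> bounded_degree n (\<lambda>_. max D D')" "q \<in> bounded_degree n (\<lambda>_. max D D')"
      by (auto intro: bounded_degree_mono[rotated])
    then show ?case using bounded_degree_add by blast
  next
    case (mult p q)
    then obtain D D' where "p \<in> bounded_degree n (\<lambda>_. D)" "q \<in> bounded_degree n (\<lambda>_. D')" by blast
    from bounded_degree_mult[OF this] show ?case by blast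
  qed
  then obtain D where D: "p \<in> bounded_degree n (\<lambda>_. D)" by blast
  show thesis
  proof (rule that)
    fix D' assume "D \<le> D'"
    then show "p \<in> bounded_degree n (\<lambda>_. D')" using bounded_degree_mono[OF _ D, of "\<lambda>_. D'"] by simp
  qed
qed

text \<open>Unnormalized Lagrange polynomials for the grid \<open>{0..N}\<^sup>l\<close>.\<close>

definition grid_poly :: "nat \<Rightarrow> nat \<Rightarrow> (nat \<Rightarrow> nat) \<Rightarrow> 'k::field vec \<Rightarrow> 'k" where
  "grid_poly l N s v = (\<Prod>i<l. \<Prod>k\<in>{..N} - {s i}. v $ i - of_nat k)"

abbreviation grid :: "nat \<Rightarrow> nat \<Rightarrow> (nat \<Rightarrow> nat) set" where
  "grid l N \<equiv> PiE {..<l} (\<lambda>_. {..N})"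

lemma finite_grid: "finite (grid l N)" by (intro finite_PiE) auto

lemma card_grid: "card (grid l N) = (N + 1) ^ l" by (simp add: card_PiE)

lemma grid_poly_poly_fun: "grid_poly l N s \<in> poly_fun l"
  unfolding grid_poly_def
  by (intro poly_fun_prod poly_fun_diff poly_fun.coord poly_fun.const) simp

text \<open>Variable \<open>i\<close> occurs exactly in the \<open>N\<close> linear factors indexed
  by \<open>{..N} - {s i}\<close>.\<close>

lemma grid_poly_bounded_degree:
  assumes "s \<in> grid l N"
  shows "grid_poly l N s \<in> bounded_degree l (\<lambda>_. N)"
proof -
  have "(\<lambda>v. v $ i - of_nat k) \<in> bounded_degree l (\<lambda>j. if j = i then 1 else 0)" if "i < l" for i k
    by (rule bounded_degree_diff[OF bounded_degree_coord[OF that] bounded_degree_const])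
  then have "grid_poly l N s \<in> bounded_degree l (\<lambda>j. \<Sum>i<l. \<Sum>k\<in>{..N} - {s i}. if j = i then 1 else 0)"
    unfolding grid_poly_def by (intro bounded_degree_prod) auto
  moreover have "(\<Sum>i<l. \<Sum>k\<in>{..N} - {s i}. if j = i then 1 else 0) \<le> N" if "j < l" for j
  proof -
    have "(\<Sum>i<l. \<Sum>k\<in>{..N} - {s i}. if j = i then 1 else 0) = (\<Sum>i<l. if j = i then card ({..N} - {s i}) else 0)"
      by (rule sum.cong) auto
    also have "\<dots> = card ({..N} - {s j})" using that by simp
    also have "\<dots> = N" using assms that by (auto simp: card_Diff_singleton dest!: PiE_mem)
    finally show ?thesis by simp
  qed
  ultimately show ?thesis by (rule bounded_degree_mono[rotated])
qed

text \<open>At a grid point different from \<open>s\<close> some coordinate is a root of one of the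
  factors; at \<open>s\<close> itself no factor vanishes, since distinct naturals stay distinct in
  characteristic zero.\<close>

lemma grid_poly_at_grid:
  fixes s t :: "nat \<Rightarrow> nat"
  assumes "s \<in> grid l N" "t \<in> grid l N"
  shows "grid_poly l N s (vec l (\<lambda>i. of_nat (t i))) = (0 :: 'k::field_char_0) \<longleftrightarrow> s \<noteq> t"
proof
  assume "grid_poly l N s (vec l (\<lambda>i. of_nat (t i))) = (0 :: 'k)"
  then show "s \<noteq> t" by (auto simp: grid_poly_def)
next
  assume "s \<noteq> t"
  then obtain i where i: "i < l" "s i \<noteq> t i" using PiE_ext[OF assms] by auto
  have "t i \<in> {..N} - {s i}" using i assms(2) by (auto dest: PiE_mem)
  then have "(\<Prod>k\<in>{..N} - {s i}. of_nat (t i) - of_nat k) = (0 :: 'k)" by (intro prod_zero) auto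
  then show "grid_poly l N s (vec l (\<lambda>i. of_nat (t i))) = (0 :: 'k)"
    unfolding grid_poly_def using i by (intro prod_zero) auto
qed

text \<open>Evaluation at the grid point \<open>t\<close> leaves only the summand of
  \<open>t\<close>.\<close>

lemma grid_poly_independent:
  fixes c :: "(nat \<Rightarrow> nat) \<Rightarrow> 'k::field_char_0"
  assumes "\<And>v. v \<in> carrier_vec l \<Longrightarrow> (\<Sum>s\<in>grid l N. c s * grid_poly l N s v) = 0" and t: "t \<in> grid l N"
  shows "c t = 0"
proof -
  let ?v = "vec l (\<lambda>i. of_nat (t i)) :: 'k vec"
  have "(\<Sum>s\<in>grid l N. c s * grid_poly l N s ?v) = (\<Sum>s\<in>{t}. c s * grid_poly l N s ?v)"
    by (rule sum.mono_neutral_right) (use finite_grid t grid_poly_at_grid[OF _ t] in auto)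
  then have "c t * grid_poly l N t ?v = 0" using assms(1)[of ?v] by simp
  then show ?thesis using grid_poly_at_grid[OF t t, where 'k = 'k] by simp
qed

text \<open>All local quotients are taken around one point \<open>z\<close> and brought to the
  product of their denominators. The further factor \<open>r\<close> confines the nonvanishing locus
  to \<open>U\<close>, also when \<open>l\<close> is 0.\<close>

lemma zariski_common_denominator:
  fixes l :: nat
  assumes U: "openin (zariski n Z) U" "U \<noteq> {}" and Y: "irreducible_variety (affine_variety n Z)"
    and f: "\<And>i. i < l \<Longrightarrow> f i \<in> reg (affine_variety n Z) U"
  obtains p q z where "\<And>i. i < l \<Longrightarrow> p i \<in> poly_fun n" "q \<in> poly_fun n" "z \<in> Z" "q z \<noteq> 0"
    "\<And>x. x \<in> Z \<Longrightarrow> q x \<noteq> 0 \<Longrightarrow> x \<in> U" "\<And>x i. x \<in> Z \<Longrightarrow> q x \<noteq> 0 \<Longrightarrow> i < l \<Longrightarrow> f i x = p i x / q x"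
proof -
  obtain z where z: "z \<in> U" using U(2) by blast
  have zZ: "z \<in> Z" using U(1) z unfolding openin_zariski by blast
  obtain r where r: "r \<in> poly_fun n" "r z \<noteq> 0" "{v \<in> Z. r v \<noteq> 0} \<subseteq> U"
    using U(1) z unfolding openin_zariski by blast
  have "\<exists>p q. p \<in> poly_fun n \<and> q \<in> poly_fun n \<and> q z \<noteq> 0 \<and> (\<forall>x. x \<in> Z \<longrightarrow> q x \<noteq> 0 \<longrightarrow> x \<in> U \<and> f i x = p x / q x)"
    if "i < l" for i
    using zariski_reg_local[OF U(1) f[OF that] z] by metis
  then obtain P Q where P: "\<And>i. i < l \<Longrightarrow> P i \<in> poly_fun n" and Q: "\<And>i. i < l \<Longrightarrow> Q i \<in> poly_fun n"
    and Qz: "\<And>i. i < l \<Longrightarrow> Q i z \<noteq> 0"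
    and PQ: "\<And>i x. i < l \<Longrightarrow> x \<in> Z \<Longrightarrow> Q i x \<noteq> 0 \<Longrightarrow> f i x = P i x / Q i x" by metis
  define q where "q x = r x * (\<Prod>i<l. Q i x)" for x
  define p where "p i x = P i x * (r x * (\<Prod>j\<in>{..<l} - {i}. Q j x))" for i x
  show thesis
  proof (rule that[of p q z])
    show "p i \<in> poly_fun n" if "i < l" for i
      unfolding p_def by (intro poly_fun.mult poly_fun_prod P r(1) Q that) auto
    show "q \<in> poly_fun n" unfolding q_def by (intro poly_fun.mult poly_fun_prod r(1) Q) auto
    show "q z \<noteq> 0" using r(2) Qz by (auto simp: q_def)
    show "x \<in> U" if "x \<in> Z" "q x \<noteq> 0" for x using that r(3) by (auto simp: q_def)
    show "f i x = p i x / q x" if x: "x \<in> Z" "q x \<noteq> 0" and i: "i < l" for x i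
    proof -
      have eq: "(\<Prod>i<l. Q i x) = Q i x * (\<Prod>j\<in>{..<l} - {i}. Q j x)"
        using i by (intro prod.remove) auto
      have "r x * (\<Prod>j\<in>{..<l} - {i}. Q j x) \<noteq> 0" "Q i x \<noteq> 0" using x(2) by (auto simp: q_def eq)
      moreover have "q x = Q i x * (r x * (\<Prod>j\<in>{..<l} - {i}. Q j x))" by (simp add: q_def eq)
      ultimately show ?thesis using PQ[OF i x(1)] by (simp add: p_def)
    qed
  qed (rule zZ)
qed

text \<open>The functions \<open>q\<^sup>N\<^sup>l \<cdot> grid_poly s (f)\<close> are polynomials of degree \<open>O(N)\<close>; a nontrivial linear relation
  between them is an algebraic relation between the \<open>f i\<close>.\<close>

lemma alg_indep_grid:
  fixes Z :: "'k::field_char_0 vec set"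
  assumes Y: "irreducible_variety (affine_variety n Z)" and U: "openin (zariski n Z) U" "U \<noteq> {}"
    and f: "\<And>i. i < l \<Longrightarrow> f i \<in> reg (affine_variety n Z) U" and indep: "alg_indep_on U l f"
  shows "\<exists>D Q. D > 0 \<and> (\<forall>N. \<forall>s\<in>grid l N. Q N s \<in> bounded_degree n (\<lambda>_. D * N)) \<and>
    (\<forall>N c. (\<forall>x\<in>Z. (\<Sum>s\<in>grid l N. c s * Q N s x) = 0) \<longrightarrow> (\<forall>s\<in>grid l N. c s = 0))"
proof -
  obtain p q z where p: "\<And>i. i < l \<Longrightarrow> p i \<in> poly_fun n" and q: "q \<in> poly_fun n" and z: "z \<in> Z" "q z \<noteq> 0"
    and fpq: "\<And>x i. x \<in> Z \<Longrightarrow> q x \<noteq> 0 \<Longrightarrow> i < l \<Longrightarrow> f i x = p i x / q x"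
    using zariski_common_denominator[OF U Y, of l f] f by metis
  have "\<exists>D. \<forall>D'\<ge>D. p i \<in> bounded_degree n (\<lambda>_. D')" if "i < l" for i
    using poly_fun_bounded_degree[OF p[OF that]] by metis
  then obtain Dp where Dp: "\<And>i D'. i < l \<Longrightarrow> Dp i \<le> D' \<Longrightarrow> p i \<in> bounded_degree n (\<lambda>_. D')" by metis
  obtain Dq where Dq: "\<And>D'. Dq \<le> D' \<Longrightarrow> q \<in> bounded_degree n (\<lambda>_. D')"
    using poly_fun_bounded_degree[OF q] by metis
  define E where "E = Dq + (\<Sum>i<l. Dp i)"
  have E: "p i \<in> bounded_degree n (\<lambda>_. E)" if "i < l" for i
    by (rule Dp[OF that]) (use member_le_sum[of i "{..<l}" Dp] that in \<open>simp add: E_def\<close>)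
  have Eq: "q \<in> bounded_degree n (\<lambda>_. E)" by (rule Dq) (simp add: E_def)
  \<comment> \<open>Each of the \<open>N * l\<close> linear factors of the Lagrange polynomial in
    the \<open>f i\<close> is multiplied by \<open>q\<close>, which clears its denominator. The
    result is a polynomial function on the ambient space.\<close>
  define Q where "Q N s x = (\<Prod>i<l. \<Prod>k\<in>{..N} - {s i}. p i x - of_nat k * q x)" for N and s :: "nat \<Rightarrow> nat" and x
  have cardN: "card ({..N} - {s i}) = N" if "s \<in> grid l N" "i < l" for s N i
    using that by (auto simp: card_Diff_singleton dest!: PiE_mem)
  \<comment> \<open>The true bound is \<open>l * E * N\<close>; the summand 1 only makes the
    constant positive.\<close>
  have Qdeg: "Q N s \<in> bounded_degree n (\<lambda>_. (l * E + 1) * N)" if s: "s \<in> grid l N" for N s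
  proof -
    have "(\<lambda>x. p i x - of_nat k * q x) \<in> bounded_degree n (\<lambda>_. E)" if "i < l" for i k
      by (rule bounded_degree_diff[OF E[OF that] bounded_degree_smult[OF Eq]])
    then have "Q N s \<in> bounded_degree n (\<lambda>j. \<Sum>i<l. \<Sum>k\<in>{..N} - {s i}. E)"
      unfolding Q_def by (intro bounded_degree_prod) auto
    moreover have "(\<Sum>i<l. \<Sum>k\<in>{..N} - {s i}. E) \<le> (l * E + 1) * N"
    proof -
      have "(\<Sum>i<l. \<Sum>k\<in>{..N} - {s i}. E) = (\<Sum>i<l. N * E)"
        by (rule sum.cong) (use cardN[OF s] in auto)
      then show ?thesis by (simp add: algebra_simps)
    qed
    ultimately show ?thesis by (rule bounded_degree_mono[rotated])
  qed
  have QL: "Q N s x = q x ^ (N * l) * grid_poly l N s (vec l (\<lambda>i. f i x))"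
    if s: "s \<in> grid l N" and x: "x \<in> Z" "q x \<noteq> 0" for N s x
  proof -
    have "(\<Prod>k\<in>{..N} - {s i}. p i x - of_nat k * q x) = q x ^ N * (\<Prod>k\<in>{..N} - {s i}. f i x - of_nat k)"
      if i: "i < l" for i
    proof -
      have "(\<Prod>k\<in>{..N} - {s i}. p i x - of_nat k * q x) = (\<Prod>k\<in>{..N} - {s i}. q x * (f i x - of_nat k))"
        by (rule prod.cong) (use fpq[OF x i] x(2) in \<open>auto simp: field_simps\<close>)
      then show ?thesis by (simp add: prod.distrib cardN[OF s i])
    qed
    then have "Q N s x = (\<Prod>i<l. q x ^ N * (\<Prod>k\<in>{..N} - {s i}. f i x - of_nat k))"
      unfolding Q_def by (intro prod.cong) auto
    then show ?thesis by (simp add: prod.distrib grid_poly_def power_mult)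
  qed
  have rel: "c s = 0" if c: "\<And>x. x \<in> Z \<Longrightarrow> (\<Sum>s\<in>grid l N. c s * Q N s x) = 0" and s: "s \<in> grid l N" for N c s
  proof -
    define P where "P v = (\<Sum>s\<in>grid l N. c s * grid_poly l N s v)" for v
    have P: "P \<in> poly_fun l" unfolding P_def by (intro poly_fun_sum poly_fun_smult grid_poly_poly_fun)
    have PW: "P (vec l (\<lambda>i. f i x)) = 0" if x: "x \<in> Z" "q x \<noteq> 0" for x
    proof -
      have "0 = (\<Sum>s\<in>grid l N. c s * (q x ^ (N * l) * grid_poly l N s (vec l (\<lambda>i. f i x))))"
        using c[OF x(1)] QL[OF _ x] by simp
      also have "\<dots> = q x ^ (N * l) * P (vec l (\<lambda>i. f i x))"
        by (simp add: P_def sum_distrib_left mult.left_commute)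
      finally show ?thesis using x(2) by simp
    qed
    have U': "openin (top (affine_variety n Z)) U" using U(1) by simp
    have o: "openin (top (affine_variety n Z)) {x \<in> Z. q x \<noteq> 0}" using openin_zariski_basic[OF q] by simp
    \<comment> \<open>This function is known to vanish where \<open>q\<close> does not. That locus
      is a nonempty open subset of the irreducible \<open>Z\<close>, so the function vanishes on all
      of \<open>U\<close>, where independence is assumed.\<close>
    have "(\<lambda>x. P (vec l (\<lambda>i. f i x))) \<in> reg (affine_variety n Z) U"
      by (rule reg_poly_fun[OF affine_function_sheaf U' P]) (simp add: f)
    then have "P (vec l (\<lambda>i. f i x)) = 0" if "x \<in> U" for x
      using reg_zeroI[OF Y U' _ o _ _ that, of "\<lambda>x. P (vec l (\<lambda>i. f i x))"] z PW by blast
    then have "P v = 0" if "v \<in> carrier_vec l" for v using indep P that unfolding alg_indep_on_def by blast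
    then show ?thesis using grid_poly_independent[OF _ s, of c] by (simp add: P_def)
  qed
  show ?thesis
  proof (intro exI[of _ "l * E + 1"] exI[of _ Q] conjI allI impI ballI)
    show "Q N s \<in> bounded_degree n (\<lambda>_. (l * E + 1) * N)" if "s \<in> grid l N" for N s by (rule Qdeg[OF that])
    show "c s = 0" if "\<forall>x\<in>Z. (\<Sum>s\<in>grid l N. c s * Q N s x) = 0" "s \<in> grid l N" for N c s
      by (rule rel[OF _ that(2)]) (use that(1) in blast)
  qed simp
qed

text \<open>For \<open>l > n\<close> the \<open>(N + 1) ^ l\<close> independent functions of
  \<open>alg_indep_grid\<close> outgrow the at most \<open>(D * N + 1) ^ n\<close> monomials that
  span them.\<close>

lemma affine_alg_indep_le:
  fixes Z :: "'k::field_char_0 vec set"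
  assumes Y: "irreducible_variety (affine_variety n Z)" and U: "openin (zariski n Z) U" "U \<noteq> {}"
    and f: "\<And>i. i < l \<Longrightarrow> f i \<in> reg (affine_variety n Z) U" and indep: "alg_indep_on U l f"
  shows "l \<le> n"
proof (rule ccontr)
  assume "\<not> l \<le> n"
  then have l: "l \<ge> n + 1" by simp
  obtain D Q where D: "D > 0" and Q: "\<And>N s. s \<in> grid l N \<Longrightarrow> Q N s \<in> bounded_degree n (\<lambda>_. D * N)"
    and rel: "\<And>N c. \<forall>x\<in>Z. (\<Sum>s\<in>grid l N. c s * Q N s x) = 0 \<Longrightarrow> \<forall>s\<in>grid l N. c s = 0"
    using alg_indep_grid[OF Y U f indep] by blast
  \<comment> \<open>Chosen so that \<open>((D + 1) * (N + 1)) ^ n\<close> equals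
    \<open>N * (N + 1) ^ n\<close>, which is below \<open>(N + 1) ^ (n + 1)\<close>.\<close>
  define N where "N = (D + 1) ^ n"
  have "card (monomials n (\<lambda>_. D * N) :: ('k vec \<Rightarrow> 'k) set) \<le> (D * N + 1) ^ n" by (rule card_monomials)
  also have "\<dots> \<le> ((D + 1) * (N + 1)) ^ n" by (rule power_mono) auto
  also have "\<dots> = N * (N + 1) ^ n" by (simp only: N_def power_mult_distrib)
  also have "\<dots> < (N + 1) ^ (n + 1)" by simp
  also have "\<dots> \<le> (N + 1) ^ l" by (rule power_increasing) (use l in auto)
  also have "\<dots> = card (grid l N)" by (simp only: card_grid)
  finally have less: "card (monomials n (\<lambda>_. D * N) :: ('k vec \<Rightarrow> 'k) set) < card (grid l N)" .
  have "Q N s \<in> fun_space.span (monomials n (\<lambda>_. D * N))" if "s \<in> grid l N" for s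
    using Q[OF that] by (simp add: bounded_degree_def)
  then obtain c s where c: "s \<in> grid l N" "c s \<noteq> 0" "(\<Sum>s\<in>grid l N. fun_scale (c s) (Q N s)) = 0"
    by (rule fun_space.dependent_family[OF finite_grid finite_monomials _ less])
  have "(\<Sum>s\<in>grid l N. c s * Q N s x) = 0" for x
    using fun_cong[OF c(3), of x] by (simp add: sum_fun_scale)
  then have "\<forall>s\<in>grid l N. c s = 0" by (intro rel) blast
  then show False using c by blast
qed

text \<open>A discrete mean value estimate: shifting the base by a constant changes the power only
  by a term with exponent lowered by one.\<close>

lemma power_sum_le: "(x + y :: nat) ^ Suc n \<le> x ^ Suc n + Suc n * y * (x + y) ^ n"
proof (induction n)
  case (Suc n)
  have "(x + y) ^ Suc (Suc n) = x * (x + y) ^ Suc n + y * (x + y) ^ Suc n" by (simp add: algebra_simps)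
  also have "\<dots> \<le> x * (x ^ Suc n + Suc n * y * (x + y) ^ n) + y * (x + y) ^ Suc n"
    using Suc by (intro add_mono mult_left_mono) auto
  also have "\<dots> = x ^ Suc (Suc n) + Suc n * y * (x * (x + y) ^ n) + y * (x + y) ^ Suc n"
    by (simp add: algebra_simps)
  also have "\<dots> \<le> x ^ Suc (Suc n) + Suc n * y * ((x + y) * (x + y) ^ n) + y * (x + y) ^ Suc n"
    by (intro add_mono mult_left_mono mult_right_mono) auto
  also have "\<dots> = x ^ Suc (Suc n) + Suc (Suc n) * y * (x + y) ^ Suc n" by (simp add: algebra_simps)
  finally show ?case .
qed simp

text \<open>Besides the functions \<open>Q N s\<close>, the multiples of \<open>p\<close> by grid
  polynomials of degree \<open>M = D * N - d\<close> also lie in the space of degree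
  \<open>D * N\<close>. For \<open>l \<ge> n\<close> there are too many members in total, so a
  relation exists. On \<open>Z\<close> the multiples of \<open>p\<close> vanish, which kills the
  coefficients of the \<open>Q N s\<close>; what remains is \<open>p\<close> times a polynomial,
  which must be zero, and this kills the others.\<close>

lemma affine_alg_indep_less:
  fixes Z :: "'k::field_char_0 vec set"
  assumes Y: "irreducible_variety (affine_variety n Z)" and U: "openin (zariski n Z) U" "U \<noteq> {}"
    and f: "\<And>i. i < l \<Longrightarrow> f i \<in> reg (affine_variety n Z) U" and indep: "alg_indep_on U l f"
    and n: "n > 0" and p: "p \<in> poly_fun n" "\<And>x. x \<in> Z \<Longrightarrow> p x = 0" and a: "a \<in> carrier_vec n" "p a \<noteq> 0"
  shows "l < n"
proof (rule ccontr)
  assume "\<not> l < n"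
  then have l: "l \<ge> n" by simp
  obtain D Q where D: "D > 0" and Q: "\<And>N s. s \<in> grid l N \<Longrightarrow> Q N s \<in> bounded_degree n (\<lambda>_. D * N)"
    and rel: "\<And>N c. \<forall>x\<in>Z. (\<Sum>s\<in>grid l N. c s * Q N s x) = 0 \<Longrightarrow> \<forall>s\<in>grid l N. c s = 0"
    using alg_indep_grid[OF Y U f indep] by blast
  obtain d where d: "p \<in> bounded_degree n (\<lambda>_. d)" using poly_fun_bounded_degree[OF p(1)] by blast
  obtain m where m: "n = Suc m" using n gr0_implies_Suc by blast
  \<comment> \<open>The excess of \<open>(D * N + 1) ^ n\<close> over \<open>(M + 1) ^ n\<close> is
    at most \<open>n * d * (D + 1) ^ m * (N + 1) ^ m\<close>; the second summand of \<open>N\<close>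
    bounds this by \<open>N * (N + 1) ^ m\<close>, which is less than \<open>(N + 1) ^ n\<close>.
    The first summand gives \<open>d \<le> D * N\<close>, so the subtraction in \<open>M\<close> is
    exact.\<close>
  define N where "N = d + n * d * (D + 1) ^ m"
  define M where "M = D * N - d"
  have "d \<le> N" by (simp add: N_def)
  also have "N \<le> D * N" using D by simp
  finally have M: "D * N = M + d" by (simp add: M_def)
  let ?S = "monomials n (\<lambda>_. D * N) :: ('k vec \<Rightarrow> 'k) set"
  let ?I = "Inl ` grid l N \<union> Inr ` grid n M :: ((nat \<Rightarrow> nat) + (nat \<Rightarrow> nat)) set"
  define F where "F = (\<lambda>Inl s \<Rightarrow> Q N s | Inr t \<Rightarrow> (\<lambda>v. p v * grid_poly n M t v))"
  have "card ?S \<le> (D * N + 1) ^ n" by (rule card_monomials)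
  also have "\<dots> = ((M + 1) + d) ^ Suc m" by (simp add: M m)
  also have "\<dots> \<le> (M + 1) ^ Suc m + Suc m * d * ((M + 1) + d) ^ m" by (rule power_sum_le)
  also have "((M + 1) + d) ^ m \<le> ((D + 1) * (N + 1)) ^ m" using M by (intro power_mono) auto
  also have "((D + 1) * (N + 1)) ^ m = (D + 1) ^ m * (N + 1) ^ m" by (rule power_mult_distrib)
  also have "(M + 1) ^ Suc m + Suc m * d * ((D + 1) ^ m * (N + 1) ^ m) =
     (M + 1) ^ n + n * d * (D + 1) ^ m * (N + 1) ^ m" by (simp add: m algebra_simps)
  also have "\<dots> \<le> (M + 1) ^ n + N * (N + 1) ^ m" by (simp add: N_def)
  also have "\<dots> < (M + 1) ^ n + (N + 1) ^ n" by (simp add: m)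
  also have "\<dots> \<le> (M + 1) ^ n + (N + 1) ^ l" using l by (simp add: power_increasing)
  also have "\<dots> = card (grid n M) + card (grid l N)" by (simp only: card_grid)
  also have "\<dots> = card ?I"
    by (subst card_Un_disjoint) (auto simp: card_image finite_grid)
  finally have less: "card ?S < card ?I" by simp
  have F: "F i \<in> fun_space.span ?S" if "i \<in> ?I" for i
  proof -
    have "(\<lambda>v. p v * grid_poly n M t v) \<in> bounded_degree n (\<lambda>_. D * N)" if "t \<in> grid n M" for t
      using bounded_degree_mult[OF d grid_poly_bounded_degree[OF that]] M by (simp add: add.commute)
    then show ?thesis using that Q unfolding bounded_degree_def F_def by auto
  qed
  have fI: "finite ?I" using finite_grid by blast
  obtain c i where c: "i \<in> ?I" "c i \<noteq> 0" "(\<Sum>i\<in>?I. fun_scale (c i) (F i)) = 0"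
    by (rule fun_space.dependent_family[OF fI finite_monomials F less])
  have sum: "(\<Sum>s\<in>grid l N. c (Inl s) * Q N s v) + p v * (\<Sum>t\<in>grid n M. c (Inr t) * grid_poly n M t v) = 0" for v
  proof -
    have "0 = (\<Sum>i\<in>?I. c i * F i v)" using fun_cong[OF c(3), of v] by (simp add: sum_fun_scale)
    also have "\<dots> = (\<Sum>i\<in>Inl ` grid l N. c i * F i v) + (\<Sum>i\<in>Inr ` grid n M. c i * F i v)"
      by (rule sum.union_disjoint) (auto simp: finite_grid)
    also have "\<dots> = (\<Sum>s\<in>grid l N. c (Inl s) * Q N s v) + p v * (\<Sum>t\<in>grid n M. c (Inr t) * grid_poly n M t v)"
      by (simp add: sum.reindex F_def sum_distrib_left mult.left_commute)
    finally show ?thesis by simp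
  qed
  have "(\<Sum>s\<in>grid l N. c (Inl s) * Q N s x) = 0" if "x \<in> Z" for x using sum[of x] p(2)[OF that] by simp
  then have cl: "\<forall>s\<in>grid l N. c (Inl s) = 0" by (intro rel) blast
  define R where "R v = (\<Sum>t\<in>grid n M. c (Inr t) * grid_poly n M t v)" for v
  have R: "R \<in> poly_fun n" unfolding R_def by (intro poly_fun_sum poly_fun_smult grid_poly_poly_fun)
  have pR: "p v * R v = 0" for v using sum[of v] cl by (simp add: R_def)
  have "R v = 0" if v: "v \<in> carrier_vec n" for v
  proof (rule ccontr)
    assume "R v \<noteq> 0"
    from poly_fun_no_zero_divisors[OF p(1) R a v this] show False using pR by auto
  qed
  then have "c (Inr t) = 0" if "t \<in> grid n M" for t
    using grid_poly_independent[OF _ that, of "\<lambda>t. c (Inr t)"] by (simp add: R_def)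
  then show False using c(1,2) cl by auto
qed

text \<open>\<open>GREATEST\<close> is known to return a member of the set only when the set is
  nonempty and bounded. The bound is assumed; \<open>m = 0\<close> is always a member, because
  polynomial functions of no variables are constant and \<open>X\<close> has a point.\<close>

lemma vdim_le:
  fixes X :: "('p, 'k::field) fspace"
  assumes "pts X \<noteq> {}"
    and bound: "\<And>U f l. openin (top X) U \<Longrightarrow> U \<noteq> {} \<Longrightarrow> (\<And>i. i < l \<Longrightarrow> f i \<in> reg X U) \<Longrightarrow> alg_indep_on U l f \<Longrightarrow> l \<le> e"
  shows "vdim X \<le> e"
proof -
  let ?P = "\<lambda>m. \<exists>U f. openin (top X) U \<and> U \<noteq> {} \<and> (\<forall>i<m. f i \<in> reg X U) \<and> alg_indep_on U m f"
  have "alg_indep_on (pts X) 0 (\<lambda>_ _. 0 :: 'k)"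
    unfolding alg_indep_on_def
  proof (intro ballI impI)
    fix p :: "'k vec \<Rightarrow> 'k" and v :: "'k vec"
    assume p: "p \<in> poly_fun 0" "\<forall>x\<in>pts X. p (vec 0 (\<lambda>i. 0)) = 0"
    then have "p (vec 0 (\<lambda>i. 0)) = 0" using assms(1) by blast
    then show "p v = 0" using poly_fun_agree[OF p(1), of v "vec 0 (\<lambda>i. 0)"] by simp
  qed
  then have "?P 0" using assms(1) by (intro exI[of _ "pts X"] exI[of _ "\<lambda>_ _. 0"]) auto
  moreover have "\<forall>y. ?P y \<longrightarrow> y \<le> e" using bound by blast
  ultimately have "?P (Greatest ?P)" by (intro GreatestI_nat[where P = ?P and b = e]) auto
  then show ?thesis unfolding vdim_def using bound by blast
qed

lemma vdim_affine_le:
  fixes Z :: "'k::field_char_0 vec set"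
  assumes Y: "irreducible_variety (affine_variety n Z)"
  shows "vdim (affine_variety n Z) \<le> n"
  by (rule vdim_le[OF irreducible_variety_nonempty[OF Y]]) (use affine_alg_indep_le[OF Y] in auto)

text \<open>One of the equations of the proper algebraic set \<open>Z\<close> is nonzero at some
  vector; it serves as the polynomial in the strict counting bound.\<close>

lemma vdim_affine_less:
  fixes Z :: "'k::field_char_0 vec set"
  assumes Y: "irreducible_variety (affine_variety n Z)" and Z: "algebraic_set n Z"
    and ne: "Z \<noteq> carrier_vec n" and n: "n > 0"
  shows "vdim (affine_variety n Z) < n"
proof -
  obtain S where S: "S \<subseteq> poly_fun n" "Z = {v \<in> carrier_vec n. \<forall>p\<in>S. p v = 0}"
    using Z unfolding algebraic_set_def by blast
  then obtain a p where ap: "a \<in> carrier_vec n" "p \<in> S" "p a \<noteq> 0" using ne by blast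
  have p: "p \<in> poly_fun n" "\<And>x. x \<in> Z \<Longrightarrow> p x = 0" using ap S by auto
  have "vdim (affine_variety n Z) \<le> n - 1"
  proof (rule vdim_le[OF irreducible_variety_nonempty[OF Y]])
    fix U f l
    assume "openin (top (affine_variety n Z)) U" and U: "U \<noteq> {}" "\<And>i. i < l \<Longrightarrow> f i \<in> reg (affine_variety n Z) U"
      "alg_indep_on U l f"
    then have "openin (zariski n Z) U" by simp
    from affine_alg_indep_less[OF Y this U n p ap(1,3)] show "l \<le> n - 1" by simp
  qed
  then show ?thesis using n by simp
qed


section \<open>Compressions to linear representations\<close>

lemma faithful_repI:
  fixes r :: "'g \<Rightarrow> 'k::field mat"
  assumes G: "group G" and r: "\<And>g. g \<in> carrier G \<Longrightarrow> r g \<in> carrier_mat n n"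
    and mult: "\<And>g h. g \<in> carrier G \<Longrightarrow> h \<in> carrier G \<Longrightarrow> r (g \<otimes>\<^bsub>G\<^esub> h) = r g * r h"
    and one: "r \<one>\<^bsub>G\<^esub> = 1\<^sub>m n" and faithful: "\<And>g. g \<in> carrier G \<Longrightarrow> r g = 1\<^sub>m n \<Longrightarrow> g = \<one>\<^bsub>G\<^esub>"
  shows "faithful_rep G n r"
proof -
  interpret group G by fact
  have inv: "r (inv\<^bsub>G\<^esub> g) * r g = 1\<^sub>m n" "r g * r (inv\<^bsub>G\<^esub> g) = 1\<^sub>m n" if "g \<in> carrier G" for g
    using mult[of "inv\<^bsub>G\<^esub> g" g] mult[of g "inv\<^bsub>G\<^esub> g"] one that by auto
  show ?thesis unfolding faithful_rep_def
  proof
    show "r \<in> hom G (GL n)"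
    proof (rule homI)
      show "r g \<in> carrier (GL n)" if g: "g \<in> carrier G" for g
        unfolding GL_def units_of_carrier Units_def ring_mat_simps
        using r[OF g] r[of "inv\<^bsub>G\<^esub> g"] inv[OF g] g by auto
      show "r (g \<otimes>\<^bsub>G\<^esub> h) = r g \<otimes>\<^bsub>GL n\<^esub> r h" if "g \<in> carrier G" "h \<in> carrier G" for g h
        using mult[OF that] by (simp add: GL_def units_of_mult ring_mat_simps)
    qed
    show "inj_on r (carrier G)"
    proof (rule inj_onI)
      fix g h assume gh: "g \<in> carrier G" "h \<in> carrier G" "r g = r h"
      have "r (inv\<^bsub>G\<^esub> h \<otimes>\<^bsub>G\<^esub> g) = 1\<^sub>m n" using mult[of "inv\<^bsub>G\<^esub> h" g] inv(1)[OF gh(2)] gh by simp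
      then have "inv\<^bsub>G\<^esub> h \<otimes>\<^bsub>G\<^esub> g = \<one>\<^bsub>G\<^esub>" using faithful gh by simp
      then show "g = h" using gh by (metis inv_closed inv_inv inv_equality)
    qed
  qed
qed

text \<open>The regular representation, by permutation matrices of left translation. It ensures that
  the minimum in \<open>rdim\<close> is attained.\<close>

lemma faithful_rep_exists:
  assumes G: "group G" and fin: "finite (carrier G)"
  obtains m and r :: "'g \<Rightarrow> 'k::field mat" where "m > 0" "faithful_rep G m r"
proof -
  interpret group G by fact
  let ?N = "card (carrier G)"
  obtain e where e: "bij_betw e {..<?N} (carrier G)"
    using ex_bij_betw_nat_finite[OF fin] by (auto simp: atLeast0LessThan)
  have eG: "e i \<in> carrier G" if "i < ?N" for i using bij_betwE[OF e] that by simp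
  have e_inj: "e i = e j \<longleftrightarrow> i = j" if "i < ?N" "j < ?N" for i j
    using bij_betw_imp_inj_on[OF e] that by (auto dest: inj_onD)
  have e_surj: "\<exists>i<?N. e i = g" if "g \<in> carrier G" for g
    using bij_betw_imp_surj_on[OF e] that by (metis imageE lessThan_iff)
  define R :: "'g \<Rightarrow> 'k mat" where "R g = mat ?N ?N (\<lambda>(i, j). if e i = g \<otimes>\<^bsub>G\<^esub> e j then 1 else 0)" for g
  have "faithful_rep G ?N R"
  proof (rule faithful_repI[OF G])
    show "R g \<in> carrier_mat ?N ?N" for g by (simp add: R_def)
    show "R \<one>\<^bsub>G\<^esub> = 1\<^sub>m ?N" by (rule eq_matI) (auto simp: R_def eG e_inj)
    show "R (g \<otimes>\<^bsub>G\<^esub> h) = R g * R h" if gh: "g \<in> carrier G" "h \<in> carrier G" for g h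
    proof (rule eq_matI)
      fix i j assume "i < dim_row (R g * R h)" "j < dim_col (R g * R h)"
      then have ij: "i < ?N" "j < ?N" by (simp_all add: R_def)
      obtain l where l: "l < ?N" "e l = h \<otimes>\<^bsub>G\<^esub> e j" using e_surj[of "h \<otimes>\<^bsub>G\<^esub> e j"] gh eG ij by auto
      have "(R g * R h) $$ (i, j) = (\<Sum>k<?N. (if e i = g \<otimes>\<^bsub>G\<^esub> e k then 1 else 0) * (if e k = h \<otimes>\<^bsub>G\<^esub> e j then 1 else 0))"
        using ij by (simp add: R_def scalar_prod_def atLeast0LessThan)
      also have "\<dots> = (\<Sum>k<?N. if k = l then (if e i = g \<otimes>\<^bsub>G\<^esub> e k then 1 else 0) else 0)"
      proof (rule sum.cong[OF refl])
        fix k assume "k \<in> {..<?N}"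
        then have "e k = h \<otimes>\<^bsub>G\<^esub> e j \<longleftrightarrow> k = l" using e_inj[of k l] l by simp
        then show "(if e i = g \<otimes>\<^bsub>G\<^esub> e k then 1 else 0) * (if e k = h \<otimes>\<^bsub>G\<^esub> e j then 1 else 0) =
            (if k = l then (if e i = g \<otimes>\<^bsub>G\<^esub> e k then 1 else 0) else (0 :: 'k))" by simp
      qed
      also have "\<dots> = (if e i = g \<otimes>\<^bsub>G\<^esub> e l then 1 else 0)" using l by simp
      also have "\<dots> = R (g \<otimes>\<^bsub>G\<^esub> h) $$ (i, j)" using ij l gh eG by (simp add: R_def m_assoc)
      finally show "R (g \<otimes>\<^bsub>G\<^esub> h) $$ (i, j) = (R g * R h) $$ (i, j)" by simp
    qed (simp_all add: R_def)
    show "g = \<one>\<^bsub>G\<^esub>" if g: "g \<in> carrier G" "R g = 1\<^sub>m ?N" for g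
    proof -
      obtain j where j: "j < ?N" "e j = \<one>\<^bsub>G\<^esub>" using e_surj[OF one_closed] by blast
      have "R g $$ (j, j) = 1" using g(2) j by simp
      then have "e j = g \<otimes>\<^bsub>G\<^esub> e j" using j by (simp add: R_def split: if_splits)
      then show ?thesis using j g by simp
    qed
  qed
  moreover have "?N > 0" using fin one_closed by (auto simp: card_gt_0_iff)
  ultimately show thesis using that by blast
qed

lemma compressible_to_closure:
  fixes X :: "('p, 'k::field_char_0) fspace" and r :: "'g \<Rightarrow> 'k mat"
  assumes G: "group G" and fin: "finite (carrier G)" and act: "rational_action G X \<rho>"
    and r: "faithful_rep G m r" and less: "m < vdim X"
  shows "compressible_to_smaller_dim G X \<rho>"
proof -
  obtain W \<alpha> where W: "action_model G X \<rho> W \<alpha>" using action_model_exists[OF G fin act] by blast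
  obtain \<phi> x0 where \<phi>: "\<And>x. \<phi> x \<in> carrier_vec m" "\<And>i. i < m \<Longrightarrow> (\<lambda>x. \<phi> x $ i) \<in> reg X W"
    "\<And>g x. g \<in> carrier G \<Longrightarrow> x \<in> W \<Longrightarrow> \<phi> (\<alpha> g x) = r g *\<^sub>v \<phi> x"
    "x0 \<in> W" "\<And>g. g \<in> carrier G \<Longrightarrow> g \<noteq> \<one>\<^bsub>G\<^esub> \<Longrightarrow> r g *\<^sub>v \<phi> x0 \<noteq> \<phi> x0"
    using equivariant_map_exists[OF G fin act W r] by metis
  note c = compression_onto_closure[OF G fin act W r \<phi>]
  show ?thesis unfolding compressible_to_smaller_dim_def
    using c(3) vdim_affine_le[OF c(2)] less by (meson le_less_trans)
qed

section \<open>Dominant equivariant maps that are not birational\<close>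

lemma vec_eq_smult:
  assumes "s \<in> carrier_vec n"
  shows "vec n (\<lambda>i. c * s $ i) = c \<cdot>\<^sub>v s"
  using assms by (intro eq_vecI) auto

text \<open>The norm of a linear form: an invariant form of degree \<open>card (carrier G)\<close>.\<close>

lemma invariant_form_exists:
  fixes r :: "'g \<Rightarrow> 'k::field_char_0 mat"
  assumes G: "group G" and fin: "finite (carrier G)" and r: "faithful_rep G n r" and n: "n > 0"
  obtains f a where "f \<in> poly_fun n" "\<forall>t. \<forall>v\<in>carrier_vec n. f (t \<cdot>\<^sub>v v) = t ^ card (carrier G) * f v"
    "\<forall>h\<in>carrier G. \<forall>v\<in>carrier_vec n. f (r h *\<^sub>v v) = f v" "a \<in> carrier_vec n" "f a \<noteq> 0"
proof -
  interpret group G by fact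
  note rD = faithful_repD[OF r G]
  define L where "L g v = (\<Sum>j<n. r g $$ (0, j) * v $ j)" for g v
  define f where "f v = (\<Prod>g\<in>carrier G. L g v)" for v
  have L: "L g v = (r g *\<^sub>v v) $ 0" if "g \<in> carrier G" "v \<in> carrier_vec n" for g v
    unfolding L_def by (rule mult_mat_vec_nth[OF rD(1)[OF that(1)] that(2) n, symmetric])
  have Lp: "L g \<in> poly_fun n" for g unfolding L_def by (rule mult_mat_vec_poly_fun[OF n])
  have "\<exists>v\<in>carrier_vec n. L g v \<noteq> 0" if g: "g \<in> carrier G" for g
  proof
    \<comment> \<open>The translate of the first basis vector on which \<open>L g\<close> takes the
      value 1.\<close>
    let ?v = "r (inv\<^bsub>G\<^esub> g) *\<^sub>v unit_vec n 0"
    show v: "?v \<in> carrier_vec n" using rD(1)[of "inv\<^bsub>G\<^esub> g"] g by simp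
    have "r g *\<^sub>v ?v = (r g * r (inv\<^bsub>G\<^esub> g)) *\<^sub>v unit_vec n 0"
      using assoc_mult_mat_vec[OF rD(1)[OF g] rD(1)[of "inv\<^bsub>G\<^esub> g"]] g by simp
    also have "r g * r (inv\<^bsub>G\<^esub> g) = 1\<^sub>m n" using rD(2)[of g "inv\<^bsub>G\<^esub> g"] rD(3) g by simp
    also have "1\<^sub>m n *\<^sub>v unit_vec n 0 = (unit_vec n 0 :: 'k vec)" by simp
    finally show "L g ?v \<noteq> 0" using L[OF g v] n by simp
  qed
  then obtain a where a: "a \<in> carrier_vec n" "\<forall>g\<in>carrier G. L g a \<noteq> 0"
    using poly_fun_common_nonzero[OF fin, of L n] Lp by blast
  show thesis
  proof (rule that[of f a])
    show "f \<in> poly_fun n" unfolding f_def by (intro poly_fun_prod Lp)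
    show "\<forall>t. \<forall>v\<in>carrier_vec n. f (t \<cdot>\<^sub>v v) = t ^ card (carrier G) * f v"
    proof (intro allI ballI)
      fix t :: 'k and v :: "'k vec" assume v: "v \<in> carrier_vec n"
      have "L g (t \<cdot>\<^sub>v v) = t * L g v" for g
        using v by (simp add: L_def sum_distrib_left mult.left_commute)
      then show "f (t \<cdot>\<^sub>v v) = t ^ card (carrier G) * f v" by (simp add: f_def prod.distrib)
    qed
    show "\<forall>h\<in>carrier G. \<forall>v\<in>carrier_vec n. f (r h *\<^sub>v v) = f v"
    proof (intro ballI)
      fix h and v :: "'k vec" assume h: "h \<in> carrier G" and v: "v \<in> carrier_vec n"
      have bij: "bij_betw (\<lambda>g. g \<otimes>\<^bsub>G\<^esub> h) (carrier G) (carrier G)"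
        by (rule bij_betwI[of _ _ _ "\<lambda>g. g \<otimes>\<^bsub>G\<^esub> inv\<^bsub>G\<^esub> h"]) (use h in \<open>auto simp: m_assoc\<close>)
      have rv: "r h *\<^sub>v v \<in> carrier_vec n" using rD(1)[OF h] v by simp
      have "f (r h *\<^sub>v v) = (\<Prod>g\<in>carrier G. L (g \<otimes>\<^bsub>G\<^esub> h) v)"
        unfolding f_def
      proof (rule prod.cong[OF refl])
        fix g assume g: "g \<in> carrier G"
        have "L g (r h *\<^sub>v v) = (r g *\<^sub>v (r h *\<^sub>v v)) $ 0" by (rule L[OF g rv])
        also have "r g *\<^sub>v (r h *\<^sub>v v) = r (g \<otimes>\<^bsub>G\<^esub> h) *\<^sub>v v"
          using assoc_mult_mat_vec[OF rD(1)[OF g] rD(1)[OF h] v] rD(2)[OF g h] by simp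
        finally show "L g (r h *\<^sub>v v) = L (g \<otimes>\<^bsub>G\<^esub> h) v" using L[of "g \<otimes>\<^bsub>G\<^esub> h" v] g h v by simp
      qed
      also have "\<dots> = f v" unfolding f_def by (rule prod.reindex_bij_betw[OF bij])
      finally show "f (r h *\<^sub>v v) = f v" .
    qed
    show "f a \<noteq> 0" using a(2) fin by (auto simp: f_def)
  qed (rule a(1))
qed

text \<open>Comparing degrees in the polynomial identity gives
  \<open>d + Suc d * degree Q = Suc d * degree P\<close>, so \<open>d + 1\<close> would divide the
  positive number \<open>d\<close>.\<close>

lemma power_relation_imp_degree:
  fixes P Q :: "'k::field_char_0 poly"
  assumes d: "d > 0" and c: "c \<noteq> 0" and Q: "Q \<noteq> 0"
    and eq: "\<And>t. poly Q t \<noteq> 0 \<Longrightarrow> t ^ d * c * poly Q t ^ Suc d = poly P t ^ Suc d"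
  shows False
proof -
  define E where "E = Polynomial.monom c d * Q ^ Suc d - P ^ Suc d"
  \<comment> \<open>The relation is known only off the roots of \<open>Q\<close>; the factor
    \<open>Q\<close> covers the roots and is cancelled afterwards.\<close>
  have "poly (E * Q) t = 0" for t
    using eq[of t] by (cases "poly Q t = 0") (simp_all add: E_def poly_monom mult_ac)
  then have "E * Q = 0" using poly_all_0_iff_0 by blast
  then have E: "Polynomial.monom c d * Q ^ Suc d = P ^ Suc d" using Q by (simp add: E_def)
  have "degree (Polynomial.monom c d * Q ^ Suc d) = d + Suc d * degree Q"
    using c Q by (simp add: degree_mult_eq degree_monom_eq degree_power_eq monom_eq_0_iff del: power_Suc)
  moreover have "P \<noteq> 0" using E c Q by (auto simp: monom_eq_0_iff)
  then have "degree (P ^ Suc d) = Suc d * degree P" by (simp add: degree_power_eq del: power_Suc)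
  ultimately have "d + Suc d * degree Q = Suc d * degree P" using E by simp
  then have "Suc d dvd d" by (metis dvd_add_left_iff dvd_triv_left)
  then show False using d by (auto dest: dvd_imp_le)
qed

text \<open>A birational \<open>x \<mapsto> f (\<phi> x) \<cdot> \<phi> x\<close> would make \<open>f\<close> the \<open>(d + 1)\<close>-st power of a rational function, where
  \<open>d\<close> is the degree of \<open>f\<close>.\<close>

lemma scaled_map_not_birational:
  fixes X :: "('p, 'k::field_char_0) fspace"
  assumes X: "irreducible_variety X"
    and W: "openin (top X) W" and \<phi>c: "\<And>x. \<phi> x \<in> carrier_vec n" and \<phi>: "\<And>i. i < n \<Longrightarrow> (\<lambda>x. \<phi> x $ i) \<in> reg X W"
    and f: "f \<in> poly_fun n" and hom: "\<And>t v. v \<in> carrier_vec n \<Longrightarrow> f (t \<cdot>\<^sub>v v) = t ^ d * f v" and d: "d > 0"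
    and a: "a \<in> carrier_vec n" "f a \<noteq> 0"
    and c: "c \<in> rat_maps X (affine_space n)" "(W, \<lambda>x. f (\<phi> x) \<cdot>\<^sub>v \<phi> x) \<in> c"
  shows "\<not> birational X (affine_space n) c"
proof
  let ?Y = "affine_space n :: ('k vec, 'k) fspace"
  let ?\<psi> = "\<lambda>x. f (\<phi> x) \<cdot>\<^sub>v \<phi> x"
  assume bir: "birational X ?Y c"
  have Y: "irreducible_variety ?Y" by (rule affine_space_irreducible)
  note vX = irreducible_variety_variety[OF X] and vY = irreducible_variety_variety[OF Y]
  have tY: "top ?Y = zariski n (carrier_vec n)" by (simp add: affine_space_def)
  note shY = irreducible_variety_sheaf[OF Y]
  obtain e where e: "e \<in> rat_maps ?Y X" "dominant X e" "rat_comp ?Y ?Y c e = rat_of ?Y ?Y id"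
    using bir unfolding birational_def by blast
  obtain V \<chi> where V: "(V, \<chi>) \<in> e" using rat_maps_rep[OF Y vX e(1)] by metis
  note mV = rat_maps_morphism[OF e(1) V]
  note mW = rat_maps_morphism[OF c]
  define T where "T = {y \<in> V. \<chi> y \<in> W}"
  have T: "openin (top ?Y) T" "T \<noteq> {}"
    unfolding T_def using morphism_preimage[OF mV(3,1) W] dominant_preimage[OF e(2) V mW(1,2)] by auto
  have inv: "f (\<phi> (\<chi> y)) \<cdot>\<^sub>v \<phi> (\<chi> y) = y" if y: "y \<in> T" for y
  proof -
    have "(pts ?Y, id) \<in> rat_comp ?Y ?Y c e"
      unfolding e(3) by (rule rat_of_class(2)[OF Y vY morphism_id[OF shY]])
    from rat_comp_eqD[OF Y X vY e(1,2) c(1) V c(2) this, of y] show ?thesis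
      using y openin_subset[OF T(1)] by (auto simp: T_def)
  qed
  have pb: "(\<lambda>y. \<phi> (\<chi> y) $ i) \<in> reg ?Y T" if "i < n" for i
    unfolding T_def using morphism_pullback[OF mV(3,1) W \<phi>[OF that]] .
  define u where "u y = f (\<phi> (\<chi> y))" for y
  have u: "u \<in> reg ?Y T" unfolding u_def by (rule reg_poly_fun[OF shY T(1) f pb])
  \<comment> \<open>Since \<open>y\<close> is \<open>u y\<close> times \<phi> (\<chi> y),
    homogeneity gives \<open>u y ^ d\<close> times the value of \<open>f\<close> at \<phi> (\<chi>
    y), and this value is \<open>u y\<close> again.\<close>
  have fu: "f y = u y ^ Suc d" if y: "y \<in> T" for y
  proof -
    have "f y = f (u y \<cdot>\<^sub>v \<phi> (\<chi> y))" using inv[OF y] by (simp add: u_def)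
    also have "\<dots> = u y ^ d * u y" using hom[OF \<phi>c] by (simp add: u_def)
    finally show ?thesis by simp
  qed
  have "openin (top ?Y) {v \<in> carrier_vec n. f v \<noteq> 0}" unfolding tY by (rule openin_zariski_basic[OF f])
  from irreducible_open_Int[OF Y T this] a obtain b where b: "b \<in> T" "b \<in> carrier_vec n" "f b \<noteq> 0" by blast
  have T': "openin (zariski n (carrier_vec n)) T" using T(1) tY by simp
  have u': "u \<in> reg (affine_variety n (carrier_vec n)) T" using u by (simp add: affine_space_def)
  obtain p q where pq: "p \<in> poly_fun n" "q \<in> poly_fun n" "q b \<noteq> 0"
    "\<And>x. x \<in> carrier_vec n \<Longrightarrow> q x \<noteq> 0 \<Longrightarrow> x \<in> T \<and> u x = p x / q x"
    using zariski_reg_local[OF T' u' b(1)] by metis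
  \<comment> \<open>On the line through 0 and \<open>b\<close> the form \<open>f\<close> is the
    monomial \<open>t ^ d * f b\<close>, and \<open>u\<close> becomes a univariate rational function
    whose (d + 1)-st power equals it.\<close>
  have line: "vec n (\<lambda>i. 0 + t * b $ i) = t \<cdot>\<^sub>v b" for t using vec_eq_smult[OF b(2)] by simp
  obtain P where P: "\<And>t. poly P t = p (t \<cdot>\<^sub>v b)" using poly_fun_line[OF pq(1), of "\<lambda>_. 0" "\<lambda>i. b $ i"] line by auto
  obtain Q where Q: "\<And>t. poly Q t = q (t \<cdot>\<^sub>v b)" using poly_fun_line[OF pq(2), of "\<lambda>_. 0" "\<lambda>i. b $ i"] line by auto
  show False
  proof (rule power_relation_imp_degree[OF d b(3)])
    show "Q \<noteq> 0" using Q[of 1] pq(3) b(2) by auto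
    fix t assume "poly Q t \<noteq> 0"
    then have q0: "q (t \<cdot>\<^sub>v b) \<noteq> 0" using Q by simp
    have tb: "t \<cdot>\<^sub>v b \<in> carrier_vec n" using b(2) by simp
    have "t ^ d * f b = (p (t \<cdot>\<^sub>v b) / q (t \<cdot>\<^sub>v b)) ^ Suc d"
      using fu[of "t \<cdot>\<^sub>v b"] pq(4)[OF tb q0] hom[OF b(2)] by simp
    then show "t ^ d * f b * poly Q t ^ Suc d = poly P t ^ Suc d"
      using q0 by (simp only: P Q power_divide) (simp add: field_simps)
  qed
qed

text \<open>A vector \<open>v\<close> with \<open>f v\<close> nonzero is the image of
  \<open>s\<close> times \<open>v\<close>, where s ^ (d + 1) = 1 / f v; the root exists over an
  algebraically closed field. Such a \<open>v\<close> with \<open>p v\<close> nonzero is available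
  because polynomial functions have no zero divisors.\<close>

lemma scaling_dense:
  fixes f :: "'k::{alg_closed_field, field_char_0} vec \<Rightarrow> 'k"
  assumes f: "f \<in> poly_fun n" and hom: "\<And>t v. v \<in> carrier_vec n \<Longrightarrow> f (t \<cdot>\<^sub>v v) = t ^ d * f v"
    and a: "a \<in> carrier_vec n" "f a \<noteq> 0"
    and p: "p \<in> poly_fun n" "\<And>v. v \<in> carrier_vec n \<Longrightarrow> p (f v \<cdot>\<^sub>v v) = 0" and w: "w \<in> carrier_vec n"
  shows "p w = 0"
proof (rule ccontr)
  assume "p w \<noteq> 0"
  from poly_fun_no_zero_divisors[OF p(1) f w this a]
  obtain v where v: "v \<in> carrier_vec n" "p v \<noteq> 0" "f v \<noteq> 0" by blast
  obtain s where s: "s ^ Suc d = 1 / f v" using nth_root_exists[of "Suc d" "1 / f v"] by auto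
  have "f (s \<cdot>\<^sub>v v) \<cdot>\<^sub>v (s \<cdot>\<^sub>v v) = (s ^ Suc d * f v) \<cdot>\<^sub>v v"
    using v(1) hom[OF v(1)] by (intro eq_vecI) (auto simp: mult_ac)
  also have "\<dots> = v" using v s by (intro eq_vecI) auto
  finally show False using p(2)[of "s \<cdot>\<^sub>v v"] v by simp
qed

lemma compressible_or_base_change:
  fixes X :: "('p, 'k::{alg_closed_field, field_char_0}) fspace" and r :: "'g \<Rightarrow> 'k mat"
  assumes G: "group G" and fin: "finite (carrier G)" and act: "rational_action G X \<rho>"
    and r: "faithful_rep G n r" and dim: "vdim X = n" and n: "n > 0"
  shows "compressible_to_smaller_dim G X \<rho> \<or> nontrivial_base_change G X \<rho> (affine_space n) (linear_action n r)"
proof -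
  interpret group G by fact
  note X = rational_actionD(1)[OF act] note sh = irreducible_variety_sheaf[OF X]
  note rD = faithful_repD[OF r G]
  obtain W \<alpha> where W: "action_model G X \<rho> W \<alpha>" using action_model_exists[OF G fin act] by blast
  note wD = action_modelD[OF W]
  obtain \<phi> x0 where \<phi>: "\<And>x. \<phi> x \<in> carrier_vec n" "\<And>i. i < n \<Longrightarrow> (\<lambda>x. \<phi> x $ i) \<in> reg X W"
    "\<And>g x. g \<in> carrier G \<Longrightarrow> x \<in> W \<Longrightarrow> \<phi> (\<alpha> g x) = r g *\<^sub>v \<phi> x"
    "x0 \<in> W" "\<And>g. g \<in> carrier G \<Longrightarrow> g \<noteq> \<one>\<^bsub>G\<^esub> \<Longrightarrow> r g *\<^sub>v \<phi> x0 \<noteq> \<phi> x0"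
    using equivariant_map_exists[OF G fin act W r] by metis
  define Z where "Z = {v \<in> carrier_vec n. \<forall>p\<in>poly_fun n. (\<forall>x\<in>W. p (\<phi> x) = 0) \<longrightarrow> p v = 0}"
  have c: "algebraic_set n Z" "irreducible_variety (affine_variety n Z)"
    "\<exists>\<sigma>. rational_action G (affine_variety n Z) \<sigma> \<and> compressible_into G X \<rho> (affine_variety n Z) \<sigma>"
    unfolding Z_def by (rule compression_onto_closure[OF G fin act W r \<phi>]; assumption)+
  show ?thesis
  proof (cases "Z = carrier_vec n")
    case False
    from vdim_affine_less[OF c(2,1) False n] c(3) dim
    have "compressible_to_smaller_dim G X \<rho>" unfolding compressible_to_smaller_dim_def by metis
    then show ?thesis ..
  next
    case True
    obtain f a where f: "f \<in> poly_fun n"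
      and hom: "\<forall>t. \<forall>v\<in>carrier_vec n. f (t \<cdot>\<^sub>v v) = t ^ card (carrier G) * f v"
      and inv: "\<forall>h\<in>carrier G. \<forall>v\<in>carrier_vec n. f (r h *\<^sub>v v) = f v" and a: "a \<in> carrier_vec n" "f a \<noteq> 0"
      by (rule invariant_form_exists[OF G fin r n])
    have hom': "f (t \<cdot>\<^sub>v v) = t ^ card (carrier G) * f v" if "v \<in> carrier_vec n" for t v using hom that by blast
    have d: "card (carrier G) > 0" using fin one_closed by (auto simp: card_gt_0_iff)
    define \<psi> where "\<psi> x = f (\<phi> x) \<cdot>\<^sub>v \<phi> x" for x
    have \<psi>c: "\<psi> x \<in> carrier_vec n" for x using \<phi>(1) by (simp add: \<psi>_def)
    have \<psi>reg: "(\<lambda>x. \<psi> x $ i) \<in> reg X W" if i: "i < n" for i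
    proof -
      have "(\<lambda>x. f (\<phi> x) * \<phi> x $ i) \<in> reg X W"
        by (rule reg_mult[OF sh wD(1) reg_poly_fun[OF sh wD(1) f \<phi>(2)] \<phi>(2)[OF i]])
      moreover have "\<psi> x $ i = f (\<phi> x) * \<phi> x $ i" for x using i carrier_vecD[OF \<phi>(1)[of x]] by (simp add: \<psi>_def)
      ultimately show ?thesis by simp
    qed
    have \<psi>eq: "\<psi> (\<alpha> g x) = r g *\<^sub>v \<psi> x" if "g \<in> carrier G" "x \<in> W" for g x
      unfolding \<psi>_def using \<phi>(3)[OF that] inv[rule_format, OF that(1) \<phi>(1)]
        mult_mat_vec[OF rD(1)[OF that(1)] \<phi>(1)] by simp
    have dense: "\<forall>p\<in>poly_fun n. (\<forall>x\<in>W. p (\<psi> x) = 0) \<longrightarrow> (\<forall>z\<in>carrier_vec n. p z = 0)"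
    proof (intro ballI impI)
      fix p and w :: "'k vec" assume p: "p \<in> poly_fun n" "\<forall>x\<in>W. p (\<psi> x) = 0" and w: "w \<in> carrier_vec n"
      \<comment> \<open>The pullback of \<open>p\<close> along the scaling map vanishes on the image
        of \<phi>, hence on \<open>Z\<close>, which here is the whole space. This reduces density of
        \<psi> to density of the scaling map.\<close>
      define p' where "p' v = p (vec n (\<lambda>i. f v * v $ i))" for v
      have p': "p' \<in> poly_fun n" unfolding p'_def
        by (rule poly_fun_compose[OF p(1) poly_fun.mult[OF f poly_fun.coord]])
      have p'eq: "p' v = p (f v \<cdot>\<^sub>v v)" if "v \<in> carrier_vec n" for v
        unfolding p'_def using vec_eq_smult[OF that] by simp
      have "\<forall>x\<in>W. p' (\<phi> x) = 0" using p(2) p'eq[OF \<phi>(1)] by (simp add: \<psi>_def)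
      then have "\<forall>v\<in>Z. p' v = 0" using p' by (auto simp: Z_def)
      then have "p (f v \<cdot>\<^sub>v v) = 0" if "v \<in> carrier_vec n" for v using p'eq[OF that] that True by auto
      then show "p w = 0" using scaling_dense[OF f hom' a p(1) _ w] by blast
    qed
    define c where "c = rat_eq X (affine_variety n (carrier_vec n)) `` {(W, \<psi>)}"
    note Y = affine_space_irreducible[of n, where 'k = 'k, unfolded affine_space_def]
    have rc: "r g *\<^sub>v v \<in> carrier_vec n" if "g \<in> carrier G" "v \<in> carrier_vec n" for g v
      using rD(1)[OF that(1)] that(2) by simp
    have comp: "compression G X \<rho> (affine_space n) (linear_action n r) c"
      unfolding c_def affine_space_def linear_action_def
      by (rule compression_of_dense_map[OF G act W algebraic_set_carrier_vec Y rD(1) rc \<psi>c \<psi>reg \<psi>eq dense])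
    have cm: "c \<in> rat_maps X (affine_space n)" using comp by (simp add: compression_def)
    have "(W, \<psi>) \<in> c" unfolding c_def
      by (rule affine_dense_dominant(2)[OF X algebraic_set_carrier_vec wD(1,2) \<psi>c \<psi>reg dense])
    then have "\<not> birational X (affine_space n) c"
      using scaled_map_not_birational[OF X wD(1) \<phi>(1,2) f hom' d a cm] by (simp add: \<psi>_def[abs_def])
    then show ?thesis unfolding nontrivial_base_change_def using comp by blast
  qed
qed


section \<open>The local ring at a point\<close>

text \<open>A basis of \<open>V\<close> together with \<open>h\<close> is independent and extends to
  a basis of the whole space; the functional is the coordinate along \<open>h\<close>.\<close>

lemma (in vector_space) linear_functional_exists:
  assumes V: "subspace V" and h: "h \<notin> V"
  shows "\<exists>l. (\<forall>f g. l (f + g) = l f + l g) \<and> (\<forall>c f. l (scale c f) = c * l f) \<and> (\<forall>f\<in>V. l f = 0) \<and> l h = 1"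
proof -
  obtain B where B: "B \<subseteq> V" "independent B" "V \<subseteq> span B" by (rule basis_exists[of V])
  have "span B = V" using B(1,3) V span_minimal by blast
  then have hB: "h \<notin> span B" using h by simp
  define E where "E = extend_basis (insert h B)"
  have ind: "independent (insert h B)" by (rule independent_insertI[OF hB B(2)])
  have E: "insert h B \<subseteq> E" "independent E" "\<And>f. f \<in> span E"
    using extend_basis_superset[OF ind] independent_extend_basis[OF ind] span_extend_basis[OF ind]
    by (auto simp: E_def)
  show ?thesis
  proof (intro exI[of _ "\<lambda>f. representation E f h"] conjI allI ballI)
    show "representation E (f + g) h = representation E f h + representation E g h" for f g
      by (simp add: representation_add[OF E(2) E(3) E(3)])
    show "representation E (scale c f) h = c * representation E f h" for c f
      by (simp add: representation_scale[OF E(2) E(3)])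
    show "representation E f h = 0" if "f \<in> V" for f
    proof -
      have "representation E f = representation B f"
        by (rule representation_extend[OF E(2)]) (use that B(3) E(1) in auto)
      moreover have "h \<notin> B" using hB span_base by blast
      ultimately show ?thesis using representation_ne_zero by metis
    qed
    show "representation E h h = 1" using representation_basis[OF E(2), of h] E(1) by simp
  qed
qed

text \<open>Germs are kept as total functions. Equality of germs is an \<open>eventually\<close>
  statement for the neighbourhood filter \<open>F\<close>, so finitely many local identities combine
  without naming neighbourhoods.\<close>

locale germs =
  fixes Y :: "('p, 'k::field) fspace" and y :: 'p
  assumes Y: "prevariety Y" and y: "y \<in> pts Y"
begin

abbreviation R :: "('p \<Rightarrow> 'k) set" where "R \<equiv> regular_near Y y"
abbreviation F :: "'p filter" where "F \<equiv> nhdsin (top Y) y"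
definition M :: "('p \<Rightarrow> 'k) set" where "M = {f \<in> R. f y = 0}"

lemma eventually_F: "eventually P F \<longleftrightarrow> (\<exists>W. openin (top Y) W \<and> y \<in> W \<and> (\<forall>x\<in>W. P x))"
  using y by (simp add: eventually_nhdsin)

lemma eventually_F_point: "eventually P F \<Longrightarrow> P y"
  by (auto simp: eventually_F)

lemma sh: "function_sheaf Y" by (rule prevariety_sheaf[OF Y])

lemma R_D: "f \<in> R \<Longrightarrow> \<exists>U. openin (top Y) U \<and> y \<in> U \<and> f \<in> reg Y U"
  by (simp add: regular_near_def)

lemma R_I: "openin (top Y) U \<Longrightarrow> y \<in> U \<Longrightarrow> f \<in> reg Y U \<Longrightarrow> f \<in> R"
  by (auto simp: regular_near_def)

lemma R_D2:
  assumes "f \<in> R" "g \<in> R"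
  obtains U where "openin (top Y) U" "y \<in> U" "f \<in> reg Y U" "g \<in> reg Y U"
proof -
  obtain U V where U: "openin (top Y) U" "y \<in> U" "f \<in> reg Y U" and V: "openin (top Y) V" "y \<in> V" "g \<in> reg Y V"
    using R_D[OF assms(1)] R_D[OF assms(2)] by blast
  have UV: "openin (top Y) (U \<inter> V)" using U V by blast
  show thesis
    by (rule that[OF UV]) (use U V reg_mono[OF sh U(1) UV] reg_mono[OF sh V(1) UV] in auto)
qed

lemma R_const: "(\<lambda>_. c) \<in> R"
  by (rule R_I[OF openin_topspace y reg_const[OF sh openin_topspace]])

lemma R_add:
  assumes "f \<in> R" "g \<in> R" shows "(\<lambda>x. f x + g x) \<in> R"
proof -
  obtain U where U: "openin (top Y) U" "y \<in> U" "f \<in> reg Y U" "g \<in> reg Y U" by (rule R_D2[OF assms])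
  show ?thesis by (rule R_I[OF U(1,2) reg_add[OF sh U(1,3,4)]])
qed

lemma R_mult:
  assumes "f \<in> R" "g \<in> R" shows "(\<lambda>x. f x * g x) \<in> R"
proof -
  obtain U where U: "openin (top Y) U" "y \<in> U" "f \<in> reg Y U" "g \<in> reg Y U" by (rule R_D2[OF assms])
  show ?thesis by (rule R_I[OF U(1,2) reg_mult[OF sh U(1,3,4)]])
qed

lemma R_smult: "f \<in> R \<Longrightarrow> (\<lambda>x. c * f x) \<in> R"
  by (rule R_mult[OF R_const])

lemma R_diff: "f \<in> R \<Longrightarrow> g \<in> R \<Longrightarrow> (\<lambda>x. f x - g x) \<in> R"
  using R_add[of f "\<lambda>x. -1 * g x"] R_smult[of g "-1"] by simp

lemma R_sum: "(\<And>i. i \<in> I \<Longrightarrow> f i \<in> R) \<Longrightarrow> (\<lambda>x. \<Sum>i\<in>I. f i x) \<in> R"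
  by (induction I rule: infinite_finite_induct) (auto intro: R_const R_add)

lemma R_prod: "(\<And>i. i \<in> I \<Longrightarrow> f i \<in> R) \<Longrightarrow> (\<lambda>x. \<Prod>i\<in>I. f i x) \<in> R"
  by (induction I rule: infinite_finite_induct) (auto intro: R_const R_mult)

lemma R_cong:
  assumes f: "f \<in> R" and eq: "eventually (\<lambda>x. g x = f x) F"
  shows "g \<in> R"
proof -
  obtain U W where U: "openin (top Y) U" "y \<in> U" "f \<in> reg Y U" and W: "openin (top Y) W" "y \<in> W" "\<forall>x\<in>W. g x = f x"
    using R_D[OF f] eq unfolding eventually_F by blast
  have UW: "openin (top Y) (U \<inter> W)" using U W by blast
  have "g \<in> reg Y (U \<inter> W)"
    by (rule reg_cong[OF sh UW reg_mono[OF sh U(1) UW _ U(3)]]) (use W in auto)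
  then show ?thesis using R_I[OF UW] U W by blast
qed

lemma eventually_neq_0:
  assumes "f \<in> R" "f y \<noteq> 0" shows "eventually (\<lambda>x. f x \<noteq> 0) F"
proof -
  obtain U where U: "openin (top Y) U" "y \<in> U" "f \<in> reg Y U" using R_D[OF assms(1)] by blast
  show ?thesis unfolding eventually_F
    using openin_neq_0[OF Y U(1,3)] U(2) assms(2) by (intro exI[of _ "{x \<in> U. f x \<noteq> 0}"]) auto
qed

lemma R_inverse:
  assumes "f \<in> R" "f y \<noteq> 0" shows "(\<lambda>x. 1 / f x) \<in> R"
proof -
  obtain U where U: "openin (top Y) U" "y \<in> U" "f \<in> reg Y U" using R_D[OF assms(1)] by blast
  let ?V = "{x \<in> U. f x \<noteq> 0}"
  have V: "openin (top Y) ?V" by (rule openin_neq_0[OF Y U(1,3)])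
  have "(\<lambda>x. 1 / f x) \<in> reg Y ?V"
    by (rule reg_inverse[OF Y V reg_mono[OF sh U(1) V _ U(3)]]) auto
  then show ?thesis using R_I[OF V] U assms(2) by blast
qed

lemma M_R: "f \<in> M \<Longrightarrow> f \<in> R" by (simp add: M_def)

lemma M_I: "f \<in> R \<Longrightarrow> f y = 0 \<Longrightarrow> f \<in> M" by (simp add: M_def)

lemma M_zero: "(\<lambda>_. 0) \<in> M" by (simp add: M_def R_const)

lemma M_add: "f \<in> M \<Longrightarrow> g \<in> M \<Longrightarrow> (\<lambda>x. f x + g x) \<in> M" by (simp add: M_def R_add)

lemma M_mult: "f \<in> M \<Longrightarrow> g \<in> R \<Longrightarrow> (\<lambda>x. g x * f x) \<in> M" by (simp add: M_def R_mult)

text \<open>The square of the maximal ideal \<open>M\<close>, closed under agreement of germs.\<close>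

inductive_set M2 where
  prod: "a \<in> M \<Longrightarrow> b \<in> M \<Longrightarrow> f \<in> R \<Longrightarrow> eventually (\<lambda>x. f x = a x * b x) F \<Longrightarrow> f \<in> M2"
| add: "f \<in> M2 \<Longrightarrow> g \<in> M2 \<Longrightarrow> (\<lambda>x. f x + g x) \<in> M2"

lemma M2_null:
  assumes "f \<in> R" "eventually (\<lambda>x. f x = 0) F" shows "f \<in> M2"
  by (rule M2.prod[OF M_zero M_zero assms(1)]) (use assms(2) in simp)

lemma M2_smult: "f \<in> M2 \<Longrightarrow> (\<lambda>x. c * f x) \<in> M2"
proof (induction rule: M2.induct)
  case (prod a b f)
  show ?case
    by (rule M2.prod[OF M_mult[OF prod(1) R_const[of c]] prod(2) R_smult[OF prod(3)]])
      (use prod(4) in \<open>auto elim: eventually_mono\<close>)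
next
  case (add f g)
  then show ?case using M2.add[of "\<lambda>x. c * f x" "\<lambda>x. c * g x"] by (simp add: algebra_simps)
qed

lemma M2_subspace: "fun_space.subspace M2"
proof (rule fun_space.subspaceI)
  show "0 \<in> M2" using M2_null[OF R_const[of 0]] by (simp add: zero_fun_def)
  show "f + g \<in> M2" if "f \<in> M2" "g \<in> M2" for f g using M2.add[OF that] by (simp add: plus_fun_def)
  show "fun_scale c f \<in> M2" if "f \<in> M2" for c f using M2_smult[OF that] by (simp add: fun_scale_def)
qed

text \<open>A linear functional on \<open>M / M2\<close> is a point derivation.\<close>

lemma tangent_functional:
  assumes add: "\<And>f g. l (f + g) = l f + l g" and scale: "\<And>c f. l (fun_scale c f) = c * l f"
    and null: "\<And>f. f \<in> M2 \<Longrightarrow> l f = 0"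
  shows "(\<lambda>f. if f \<in> R then l (\<lambda>x. f x - f y) else 0) \<in> tangent_space Y y"
proof -
  define D where "D f = (if f \<in> R then l (\<lambda>x. f x - f y) else 0)" for f
  have l0: "l (\<lambda>x. f x + g x) = l f + l g" for f g using add[of f g] by (simp add: plus_fun_def)
  have ls: "l (\<lambda>x. c * f x) = c * l f" for c f using scale[of c f] by (simp add: fun_scale_def)
  have ld: "l (\<lambda>x. f x - g x) = l f - l g" for f g using l0[of f "\<lambda>x. -1 * g x"] ls[of "-1" g] by simp
  have "D \<in> tangent_space Y y" unfolding tangent_space_def
  proof (intro CollectI conjI ballI allI impI)
    show "D f = 0" if "f \<notin> R" for f using that by (simp add: D_def)
    show "D f = D g" if fg: "f \<in> R" "g \<in> R" and ex: "\<exists>W. openin (top Y) W \<and> y \<in> W \<and> (\<forall>x\<in>W. f x = g x)" for f g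
    proof -
      have ev: "eventually (\<lambda>x. f x = g x) F" using ex by (simp add: eventually_F)
      have "f y = g y" by (rule eventually_F_point[OF ev])
      have "(\<lambda>x. (f x - f y) - (g x - g y)) \<in> M2"
        by (rule M2_null) (use fg ev \<open>f y = g y\<close> in \<open>auto intro!: R_diff R_const elim: eventually_mono\<close>)
      from null[OF this] show ?thesis using fg by (simp add: D_def ld)
    qed
    show "D (\<lambda>x. f x + g x) = D f + D g" if "f \<in> R" "g \<in> R" for f g
      using that R_add[OF that] l0[of "\<lambda>x. f x - f y" "\<lambda>x. g x - g y"] by (simp add: D_def algebra_simps)
    show "D (\<lambda>x. c * f x) = c * D f" if "f \<in> R" for c f
      using that R_smult[OF that] ls[of c "\<lambda>x. f x - f y"] by (simp add: D_def algebra_simps)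
    show "D (\<lambda>x. f x * g x) = f y * D g + g y * D f" if fg: "f \<in> R" "g \<in> R" for f g
    proof -
      \<comment> \<open>The product of the two centred functions lies in \<open>M2\<close> and is
        killed by \<open>l\<close>; expanding it is the Leibniz rule.\<close>
      have "(\<lambda>x. (f x - f y) * (g x - g y)) \<in> M2"
        by (rule M2.prod[of "\<lambda>x. f x - f y" "\<lambda>x. g x - g y"])
          (use fg in \<open>auto intro!: M_I R_mult R_diff R_const\<close>)
      from null[OF this] have "0 = l (\<lambda>x. (f x - f y) * (g x - g y))" by simp
      also have "(\<lambda>x. (f x - f y) * (g x - g y)) =
          (\<lambda>x. (f x * g x - f y * g y) - (f y * (g x - g y) + g y * (f x - f y)))"
        by (auto simp: algebra_simps)
      also have "l \<dots> = l (\<lambda>x. f x * g x - f y * g y) - (f y * l (\<lambda>x. g x - g y) + g y * l (\<lambda>x. f x - f y))"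
        by (simp only: ld[of "\<lambda>x. f x * g x - f y * g y" "\<lambda>x. f y * (g x - g y) + g y * (f x - f y)"]
            l0[of "\<lambda>x. f y * (g x - g y)" "\<lambda>x. g y * (f x - f y)"] ls)
      finally show ?thesis using fg R_mult[OF fg] by (simp add: D_def)
    qed
  qed
  then show ?thesis by (simp add: D_def[abs_def])
qed

text \<open>Tangent vectors separate the points of \<open>M\<close> modulo \<open>M2\<close>: if
  \<open>h\<close> were outside \<open>M2\<close>, a functional that vanishes on \<open>M2\<close>
  and is 1 at \<open>h\<close> would give a derivation with value 1 at \<open>h\<close>.\<close>

lemma in_M2_if_derivations_vanish:
  assumes h: "h \<in> R" "h y = 0" and D: "\<And>D. D \<in> tangent_space Y y \<Longrightarrow> D h = 0"
  shows "h \<in> M2"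
proof (rule ccontr)
  assume "h \<notin> M2"
  then obtain l where l: "\<forall>f g. l (f + g) = l f + l g" "\<forall>c f. l (fun_scale c f) = c * l f"
    "\<forall>f\<in>M2. l f = 0" "l h = 1"
    using fun_space.linear_functional_exists[OF M2_subspace] by blast
  have "(\<lambda>f. if f \<in> R then l (\<lambda>x. f x - f y) else 0) \<in> tangent_space Y y"
    by (rule tangent_functional[OF l(1)[rule_format] l(2)[rule_format] l(3)[rule_format]])
  from D[OF this] l h show False by simp
qed

end

lemma (in germs) tangent_space_D:
  assumes "D \<in> tangent_space Y y"
  shows "f \<notin> R \<Longrightarrow> D f = 0"
    "f \<in> R \<Longrightarrow> g \<in> R \<Longrightarrow> eventually (\<lambda>x. f x = g x) F \<Longrightarrow> D f = D g"
    "f \<in> R \<Longrightarrow> g \<in> R \<Longrightarrow> D (\<lambda>x. f x + g x) = D f + D g"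
    "f \<in> R \<Longrightarrow> D (\<lambda>x. c * f x) = c * D f"
    "f \<in> R \<Longrightarrow> g \<in> R \<Longrightarrow> D (\<lambda>x. f x * g x) = f y * D g + g y * D f"
proof -
  note T = assms[unfolded tangent_space_def, THEN CollectD]
  note T2 = conjunct2[OF T] note T3 = conjunct2[OF T2] note T4 = conjunct2[OF T3] note T5 = conjunct2[OF T4]
  show "f \<notin> R \<Longrightarrow> D f = 0" using conjunct1[OF T] by blast
  show "f \<in> R \<Longrightarrow> g \<in> R \<Longrightarrow> eventually (\<lambda>x. f x = g x) F \<Longrightarrow> D f = D g"
    unfolding eventually_F by (rule conjunct1[OF T2, rule_format])
  show "f \<in> R \<Longrightarrow> g \<in> R \<Longrightarrow> D (\<lambda>x. f x + g x) = D f + D g" by (rule conjunct1[OF T3, rule_format])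
  show "f \<in> R \<Longrightarrow> D (\<lambda>x. c * f x) = c * D f" by (rule conjunct1[OF T4, rule_format])
  show "f \<in> R \<Longrightarrow> g \<in> R \<Longrightarrow> D (\<lambda>x. f x * g x) = f y * D g + g y * D f" by (rule T5[rule_format])
qed

lemma (in germs) tangent_space_diff:
  assumes D: "D \<in> tangent_space Y y" and "f \<in> R" "g \<in> R"
  shows "D (\<lambda>x. f x - g x) = D f - D g"
  using tangent_space_D(3)[OF D assms(2) R_smult[OF assms(3), of "-1"]] tangent_space_D(4)[OF D assms(3), of "-1"] by simp

lemma (in germs) tangent_spaceI:
  assumes "\<And>f. f \<notin> R \<Longrightarrow> D f = 0"
    "\<And>f g. f \<in> R \<Longrightarrow> g \<in> R \<Longrightarrow> eventually (\<lambda>x. f x = g x) F \<Longrightarrow> D f = D g"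
    "\<And>f g. f \<in> R \<Longrightarrow> g \<in> R \<Longrightarrow> D (\<lambda>x. f x + g x) = D f + D g"
    "\<And>f c. f \<in> R \<Longrightarrow> D (\<lambda>x. c * f x) = c * D f"
    "\<And>f g. f \<in> R \<Longrightarrow> g \<in> R \<Longrightarrow> D (\<lambda>x. f x * g x) = f y * D g + g y * D f"
  shows "D \<in> tangent_space Y y"
  unfolding tangent_space_def eventually_F[symmetric]
proof (intro CollectI conjI ballI allI impI)
qed (rule assms; assumption)+

text \<open>A symmetry of finite order near a fixed point. The exponent \<open>d\<close> is any
  positive one that annihilates \<phi>; for a group element it is the group order.\<close>

locale germ_map = germs Y y for Y :: "('p, 'k::field_char_0) fspace" and y +
  fixes \<phi> :: "'p \<Rightarrow> 'p" and d :: nat and A N \<xi>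
  assumes \<phi>: "morphism Y Y \<phi>" and \<phi>y: "\<phi> y = y" and d: "d > 0" and \<phi>d: "\<And>x. x \<in> pts Y \<Longrightarrow> (\<phi> ^^ d) x = x"
    and A: "chart Y A N \<xi>" and yA: "y \<in> A"
begin

lemma eventually_\<phi>:
  assumes "eventually P F" shows "eventually (\<lambda>x. P (\<phi> x)) F"
proof -
  obtain W where W: "openin (top Y) W" "y \<in> W" "\<forall>x\<in>W. P x" using assms unfolding eventually_F by blast
  have "openin (top Y) {x \<in> pts Y. \<phi> x \<in> W}"
    using morphism_preimage[of Y "pts Y" Y \<phi> W] \<phi> W(1) by (simp only: open_sub_pts openin_topspace)
  then show ?thesis unfolding eventually_F
    using W(2,3) y \<phi>y by (intro exI[of _ "{x \<in> pts Y. \<phi> x \<in> W}"]) auto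
qed

lemma R_\<phi>:
  assumes "f \<in> R" shows "(\<lambda>x. f (\<phi> x)) \<in> R"
proof -
  obtain U where U: "openin (top Y) U" "y \<in> U" "f \<in> reg Y U" using R_D[OF assms] by blast
  have "openin (top Y) {x \<in> pts Y. \<phi> x \<in> U}"
    using morphism_preimage[of Y "pts Y" Y \<phi> U] \<phi> U(1) by (simp only: open_sub_pts openin_topspace)
  moreover have "(\<lambda>x. f (\<phi> x)) \<in> reg Y {x \<in> pts Y. \<phi> x \<in> U}"
    using morphism_pullback[of Y "pts Y" Y \<phi> U f] \<phi> U(1,3) by (simp only: open_sub_pts openin_topspace)
  ultimately show ?thesis using R_I U(2) y \<phi>y by simp
qed

lemma M_\<phi>: "f \<in> M \<Longrightarrow> (\<lambda>x. f (\<phi> x)) \<in> M"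
  by (simp add: M_def R_\<phi> \<phi>y)

definition e :: "nat \<Rightarrow> 'p \<Rightarrow> 'k" where "e j x = \<xi> x $ j - \<xi> y $ j"

text \<open>The finitely many generators of the ideal spanned by all differences
  \<open>f x - f (\<phi> x)\<close>; see \<open>diff_J\<close>.\<close>

definition \<delta> :: "nat \<Rightarrow> 'p \<Rightarrow> 'k" where "\<delta> j x = e j x - e j (\<phi> x)"

lemma R_poly: "p \<in> poly_fun N \<Longrightarrow> (\<lambda>x. p (\<xi> x)) \<in> R"
  by (rule R_I[OF chart_openin[OF A] yA chart_reg_poly[OF A]])

lemma R_e: "j < N \<Longrightarrow> e j \<in> R"
  unfolding e_def using R_diff[OF R_poly[OF poly_fun.coord] R_const] .

lemma R_\<delta>: "j < N \<Longrightarrow> \<delta> j \<in> R"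
  unfolding \<delta>_def using R_diff[OF R_e R_\<phi>[OF R_e]] .

text \<open>With coefficients in \<open>R\<close> this is the ideal generated by the \<delta> j,
  with coefficients in \<open>M\<close> it is the product of that ideal with \<open>M\<close>. The
  parameter lets one set of closure lemmas serve both.\<close>

definition J :: "('p \<Rightarrow> 'k) set \<Rightarrow> ('p \<Rightarrow> 'k) set" where
  "J I = {f \<in> R. \<exists>a. (\<forall>j. a j \<in> I) \<and> eventually (\<lambda>x. f x = (\<Sum>j<N. a j x * \<delta> j x)) F}"

lemma J_I: "f \<in> R \<Longrightarrow> (\<And>j. a j \<in> I) \<Longrightarrow> eventually (\<lambda>x. f x = (\<Sum>j<N. a j x * \<delta> j x)) F \<Longrightarrow> f \<in> J I"
  unfolding J_def by blast

lemma J_E: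
  assumes "f \<in> J I"
  obtains a where "f \<in> R" "\<And>j. a j \<in> I" "eventually (\<lambda>x. f x = (\<Sum>j<N. a j x * \<delta> j x)) F"
  using assms unfolding J_def by blast

lemma J_cong: "f \<in> J I \<Longrightarrow> eventually (\<lambda>x. g x = f x) F \<Longrightarrow> g \<in> J I"
proof (elim J_E)
  fix a assume f: "f \<in> R" and a: "\<And>j. a j \<in> I" "eventually (\<lambda>x. f x = (\<Sum>j<N. a j x * \<delta> j x)) F"
    and g: "eventually (\<lambda>x. g x = f x) F"
  show "g \<in> J I" by (rule J_I[OF R_cong[OF f g] a(1)]) (use g a(2) in eventually_elim, simp)
qed

lemma J_add:
  assumes I: "\<And>a b. a \<in> I \<Longrightarrow> b \<in> I \<Longrightarrow> (\<lambda>x. a x + b x) \<in> I" and "f \<in> J I" "g \<in> J I"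
  shows "(\<lambda>x. f x + g x) \<in> J I"
proof -
  obtain a where a: "f \<in> R" "\<And>j. a j \<in> I" "eventually (\<lambda>x. f x = (\<Sum>j<N. a j x * \<delta> j x)) F"
    using assms(2) by (rule J_E) blast
  obtain b where b: "g \<in> R" "\<And>j. b j \<in> I" "eventually (\<lambda>x. g x = (\<Sum>j<N. b j x * \<delta> j x)) F"
    using assms(3) by (rule J_E) blast
  show ?thesis
    by (rule J_I[OF R_add[OF a(1) b(1)] I[OF a(2) b(2)]])
      (use a(3) b(3) in eventually_elim, simp add: algebra_simps sum.distrib)
qed

lemma J_mult:
  assumes "f \<in> J I" "h \<in> R" and I: "\<And>a. a \<in> I \<Longrightarrow> (\<lambda>x. h x * a x) \<in> I'"
  shows "(\<lambda>x. h x * f x) \<in> J I'"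
proof -
  obtain a where a: "f \<in> R" "\<And>j. a j \<in> I" "eventually (\<lambda>x. f x = (\<Sum>j<N. a j x * \<delta> j x)) F"
    using assms(1) by (rule J_E) blast
  show ?thesis
    by (rule J_I[OF R_mult[OF assms(2) a(1)] I[OF a(2)]])
      (use a(3) in eventually_elim, simp add: sum_distrib_left mult.assoc)
qed

lemma JR_add: "f \<in> J R \<Longrightarrow> g \<in> J R \<Longrightarrow> (\<lambda>x. f x + g x) \<in> J R" by (rule J_add[OF R_add])

lemma JM_add: "f \<in> J M \<Longrightarrow> g \<in> J M \<Longrightarrow> (\<lambda>x. f x + g x) \<in> J M" by (rule J_add[OF M_add])

lemma JR_mult: "f \<in> J R \<Longrightarrow> h \<in> R \<Longrightarrow> (\<lambda>x. h x * f x) \<in> J R" by (rule J_mult[OF _ _ R_mult])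

lemma JM_mult: "f \<in> J M \<Longrightarrow> h \<in> R \<Longrightarrow> (\<lambda>x. h x * f x) \<in> J M" by (rule J_mult[OF _ _ M_mult])

lemma M_JR_mult:
  assumes "f \<in> J R" "h \<in> M" shows "(\<lambda>x. h x * f x) \<in> J M"
  by (rule J_mult[OF assms(1) M_R[OF assms(2)]]) (use M_mult[OF assms(2)] in \<open>simp add: mult.commute\<close>)

lemma J_zero: "(\<lambda>_. 0) \<in> I \<Longrightarrow> (\<lambda>_. 0) \<in> J I"
  by (rule J_I[where a = "\<lambda>_ _. 0"]) (auto intro: R_const)

lemma J_sum:
  assumes "finite K" "\<And>k. k \<in> K \<Longrightarrow> f k \<in> J M" shows "(\<lambda>x. \<Sum>k\<in>K. f k x) \<in> J M"
  using assms by (induction K) (auto intro: J_zero[OF M_zero] JM_add)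

lemma \<delta>_J: "j < N \<Longrightarrow> \<delta> j \<in> J R"
proof (rule J_I[where a = "\<lambda>i _. if i = j then 1 else 0"])
  assume j: "j < N"
  show "\<delta> j \<in> R" by (rule R_\<delta>[OF j])
  show "(\<lambda>_. if i = j then 1 else 0) \<in> R" for i by (rule R_const)
  have "(\<Sum>i<N. (if i = j then 1 else 0) * \<delta> i x) = \<delta> j x" for x
  proof -
    have "(\<Sum>i<N. (if i = j then 1 else 0) * \<delta> i x) = (\<Sum>i<N. if i = j then \<delta> i x else 0)"
      by (rule sum.cong) auto
    then show ?thesis using j by simp
  qed
  then show "eventually (\<lambda>x. \<delta> j x = (\<Sum>i<N. (if i = j then 1 else 0) * \<delta> i x)) F" by simp
qed

text \<open>The difference operator satisfies the twisted product rule p q - (p q) o \<phi> = q (p -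
  p o \<phi>) + (p o \<phi>) (q - q o \<phi>), so coordinates suffice.\<close>

lemma poly_diff_J:
  assumes "p \<in> poly_fun N"
  shows "(\<lambda>x. p (\<xi> x) - p (\<xi> (\<phi> x))) \<in> J R"
  using assms
proof (induction rule: poly_fun.induct)
  case (const c)
  then show ?case using J_zero[of R] R_const[of 0] by simp
next
  case (coord i)
  then show ?case using \<delta>_J[of i] by (simp add: \<delta>_def[abs_def] e_def)
next
  case (add p q)
  then show ?case using JR_add[OF add(3,4)] by (simp add: algebra_simps)
next
  case (mult p q)
  have "(\<lambda>x. q (\<xi> x) * (p (\<xi> x) - p (\<xi> (\<phi> x))) + p (\<xi> (\<phi> x)) * (q (\<xi> x) - q (\<xi> (\<phi> x)))) \<in> J R"
    by (rule JR_add[OF JR_mult[OF mult(3) R_poly[OF mult(2)]] JR_mult[OF mult(4) R_\<phi>[OF R_poly[OF mult(1)]]]])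
  then show ?case by (simp add: algebra_simps)
qed

text \<open>The twisted quotient rule: near \<open>y\<close> one has f q = p, both at x and at
  \<phi> x, whence f - f o \<phi> is 1 / q times (p - p o \<phi>) - (f o \<phi>) (q - q o
  \<phi>).\<close>

lemma diff_J:
  assumes f: "f \<in> R"
  shows "(\<lambda>x. f x - f (\<phi> x)) \<in> J R"
proof -
  obtain U where U: "openin (top Y) U" "y \<in> U" "f \<in> reg Y U" using R_D[OF f] by blast
  obtain p q where pq: "p \<in> poly_fun N" "q \<in> poly_fun N" "q (\<xi> y) \<noteq> 0"
    "\<And>x. x \<in> A \<Longrightarrow> q (\<xi> x) \<noteq> 0 \<Longrightarrow> x \<in> U \<and> f x = p (\<xi> x) / q (\<xi> x)"
    using chart_local[OF A U(1,3,2) yA] by metis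
  have ev: "eventually (\<lambda>x. q (\<xi> x) \<noteq> 0 \<and> f x * q (\<xi> x) = p (\<xi> x)) F"
    unfolding eventually_F
    using chart_basic[OF A pq(2)] yA pq(3,4) by (intro exI[of _ "{x \<in> A. q (\<xi> x) \<noteq> 0}"]) auto
  have q: "(\<lambda>x. 1 / q (\<xi> x)) \<in> R" by (rule R_inverse[OF R_poly[OF pq(2)] pq(3)])
  have "(\<lambda>x. 1 / q (\<xi> x) * ((p (\<xi> x) - p (\<xi> (\<phi> x))) + (-1 * f (\<phi> x)) * (q (\<xi> x) - q (\<xi> (\<phi> x))))) \<in> J R"
    by (rule JR_mult[OF JR_add[OF poly_diff_J[OF pq(1)] JR_mult[OF poly_diff_J[OF pq(2)] R_smult[OF R_\<phi>[OF f]]]] q])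
  then show ?thesis
    by (rule J_cong) (use ev eventually_\<phi>[OF ev] in eventually_elim, simp add: field_simps)
qed

text \<open>Composition with \<phi> preserves \<open>M\<close>, and it sends \<delta> j to the
  difference of the function e j o \<phi>, which is in \<open>J R\<close> by
  \<open>diff_J\<close>.\<close>

lemma JM_\<phi>:
  assumes "f \<in> J M" shows "(\<lambda>x. f (\<phi> x)) \<in> J M"
proof -
  obtain a where a: "f \<in> R" "\<And>j. a j \<in> M" "eventually (\<lambda>x. f x = (\<Sum>j<N. a j x * \<delta> j x)) F"
    using assms by (rule J_E) blast
  have "(\<lambda>x. \<Sum>j<N. a j (\<phi> x) * \<delta> j (\<phi> x)) \<in> J M"
  proof (rule J_sum)
    fix j assume "j \<in> {..<N}"
    then have j: "j < N" by simp
    have "(\<lambda>x. \<delta> j (\<phi> x)) \<in> J R" using diff_J[OF R_\<phi>[OF R_e[OF j]]] by (simp add: \<delta>_def)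
    from M_JR_mult[OF this M_\<phi>[OF a(2)]] show "(\<lambda>x. a j (\<phi> x) * \<delta> j (\<phi> x)) \<in> J M" .
  qed simp
  then show ?thesis by (rule J_cong) (rule eventually_\<phi>[OF a(3)])
qed

text \<open>In the twisted product rule for two factors from \<open>M\<close>, each summand retains
  one of them as a coefficient.\<close>

lemma M2_diff_J: "f \<in> M2 \<Longrightarrow> (\<lambda>x. f x - f (\<phi> x)) \<in> J M"
proof (induction rule: M2.induct)
  case (prod a b f)
  have "(\<lambda>x. b x * (a x - a (\<phi> x)) + a (\<phi> x) * (b x - b (\<phi> x))) \<in> J M"
    by (rule JM_add[OF M_JR_mult[OF diff_J[OF M_R[OF prod(1)]] prod(2)]
          M_JR_mult[OF diff_J[OF M_R[OF prod(2)]] M_\<phi>[OF prod(1)]]])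
  then show ?case
    by (rule J_cong) (use prod(4) eventually_\<phi>[OF prod(4)] in eventually_elim, simp add: algebra_simps)
next
  case (add f g)
  then show ?case using JM_add[OF add(3,4)] by (simp add: algebra_simps)
qed

text \<open>Since \<open>\<phi>\<close> has order \<open>d\<close>, the element \<open>h = f - f \<circ> \<phi>\<close> has vanishing orbit sum, so that
  \<open>d h\<close> is the sum of the differences \<open>h - h \<circ> \<phi>\<^sup>i\<close>.\<close>

lemma diff_JM:
  assumes f: "f \<in> R" and h: "(\<lambda>x. f x - f (\<phi> x)) \<in> M2"
  shows "(\<lambda>x. f x - f (\<phi> x)) \<in> J M"
proof -
  define h where "h x = f x - f (\<phi> x)" for x
  have hM2: "h \<in> M2" using h by (simp add: h_def[abs_def])
  have h\<phi>: "(\<lambda>x. h ((\<phi> ^^ i) x) - h (\<phi> ((\<phi> ^^ i) x))) \<in> J M" for i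
  proof (induction i)
    case 0
    then show ?case using M2_diff_J[OF hM2] by simp
  next
    case (Suc i)
    from JM_\<phi>[OF Suc] show ?case by (simp add: funpow_swap1)
  qed
  have hi: "(\<lambda>x. h x - h ((\<phi> ^^ i) x)) \<in> J M" for i
  proof (induction i)
    case 0
    then show ?case using J_zero[OF M_zero] by simp
  next
    case (Suc i)
    from JM_add[OF Suc h\<phi>[of i]] show ?case by simp
  qed
  \<comment> \<open>The orbit sum telescopes, and for n = d it is zero; division by d uses
    characteristic zero.\<close>
  have sum: "(\<Sum>i<n. h ((\<phi> ^^ i) x)) = f x - f ((\<phi> ^^ n) x)" for n x
    by (induction n) (auto simp: h_def)
  have "(\<lambda>x. 1 / of_nat d * (\<Sum>i<d. h x - h ((\<phi> ^^ i) x))) \<in> J M"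
    by (rule JM_mult[OF J_sum[OF _ hi] R_const]) simp
  moreover have "1 / of_nat d * (\<Sum>i<d. h x - h ((\<phi> ^^ i) x)) = h x" if "x \<in> pts Y" for x
    using sum[of x d] \<phi>d[OF that] d by (simp add: sum_subtractf)
  then have "eventually (\<lambda>x. h x = 1 / of_nat d * (\<Sum>i<d. h x - h ((\<phi> ^^ i) x))) F"
    unfolding eventually_F using y by (intro exI[of _ "pts Y"]) auto
  ultimately have "h \<in> J M" by (rule J_cong)
  then show ?thesis by (simp add: h_def[abs_def])
qed

lemma R_det:
  assumes "\<And>i j. i < N \<Longrightarrow> j < N \<Longrightarrow> (\<lambda>x. B x $$ (i, j)) \<in> R" and B: "\<And>x. B x \<in> carrier_mat N N"
  shows "(\<lambda>x. det (B x)) \<in> R"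
proof -
  have "(\<lambda>x. \<Sum>p\<in>{p. p permutes {0..<N}}. signof p * (\<Prod>i = 0..<N. B x $$ (i, p i))) \<in> R"
    by (intro R_sum R_smult R_prod assms(1)) (auto dest: permutes_in_image)
  then show ?thesis by (simp add: det_def'[OF B])
qed

text \<open>Nakayama's lemma: the ideal generated by the \<open>\<delta> j\<close> equals its product with \<open>M\<close>.\<close>

lemma eventually_\<delta>_zero:
  assumes "\<And>j. j < N \<Longrightarrow> \<delta> j \<in> J M"
  shows "eventually (\<lambda>x. \<forall>j<N. \<delta> j x = 0) F"
proof -
  have "\<forall>j. \<exists>a. j < N \<longrightarrow> (\<forall>l. a l \<in> M) \<and> eventually (\<lambda>x. \<delta> j x = (\<Sum>l<N. a l x * \<delta> l x)) F"
    using assms unfolding J_def by blast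
  from choice[OF this] obtain c where cev: "\<forall>j<N. (\<forall>l. c j l \<in> M) \<and>
      eventually (\<lambda>x. \<delta> j x = (\<Sum>l<N. c j l x * \<delta> l x)) F" by blast
  then have c: "\<And>j l. j < N \<Longrightarrow> c j l \<in> M"
    and ev: "\<And>j. j < N \<Longrightarrow> eventually (\<lambda>x. \<delta> j x = (\<Sum>l<N. c j l x * \<delta> l x)) F" by simp_all
  have ev': "eventually (\<lambda>x. \<forall>j\<in>{..<N}. \<delta> j x = (\<Sum>l<N. c j l x * \<delta> l x)) F"
    by (rule eventually_ball_finite) (use ev in auto)
  \<comment> \<open>The determinant trick: \<open>B x\<close> annihilates the vector of the \<delta>
    j. Its coefficients \<open>c\<close> lie in \<open>M\<close>, so \<open>B y\<close> is the
    identity and the determinant stays nonzero near \<open>y\<close>.\<close>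
  define B where "B x = mat N N (\<lambda>(i, j). (if i = j then 1 else 0) - c i j x)" for x
  have B: "B x \<in> carrier_mat N N" for x by (simp add: B_def)
  have "(\<lambda>x. det (B x)) \<in> R"
  proof (rule R_det[OF _ B])
    show "(\<lambda>x. B x $$ (i, j)) \<in> R" if "i < N" "j < N" for i j
      using R_diff[OF R_const M_R[OF c[OF that(1)]]] that by (simp add: B_def)
  qed
  moreover have "B y = 1\<^sub>m N" by (rule eq_matI) (use c in \<open>auto simp: B_def M_def\<close>)
  then have "det (B y) \<noteq> 0" by simp
  ultimately have "eventually (\<lambda>x. det (B x) \<noteq> 0) F" by (rule eventually_neq_0)
  then show ?thesis using ev'
  proof eventually_elim
    case (elim x)
    have Bx: "(B x *\<^sub>v vec N (\<lambda>j. \<delta> j x)) $ i = 0" if i: "i < N" for i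
    proof -
      have "(B x *\<^sub>v vec N (\<lambda>j. \<delta> j x)) $ i = (\<Sum>j<N. ((if i = j then 1 else 0) - c i j x) * \<delta> j x)"
        using i by (subst mult_mat_vec_nth[OF B]) (auto simp: B_def)
      also have "\<dots> = (\<Sum>j<N. (if i = j then \<delta> j x else 0)) - (\<Sum>j<N. c i j x * \<delta> j x)"
        unfolding sum_subtractf[symmetric] by (rule sum.cong) (auto simp: algebra_simps)
      also have "\<dots> = 0" using elim(2) i by simp
      finally show ?thesis .
    qed
    have "B x *\<^sub>v vec N (\<lambda>j. \<delta> j x) = 0\<^sub>v N"
      by (rule eq_vecI) (use Bx carrier_matD[OF B[of x]] in auto)
    then have "vec N (\<lambda>j. \<delta> j x) = 0\<^sub>v N"
      using elim(1) det_0_iff_vec_prod_zero_field[OF B[of x]] vec_carrier by blast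
    then have "vec N (\<lambda>j. \<delta> j x) $ j = 0" if "j < N" for j using that by simp
    then show ?case by simp
  qed
qed

lemma eventually_fixed:
  assumes D: "\<And>D f. D \<in> tangent_space Y y \<Longrightarrow> f \<in> R \<Longrightarrow> D (\<lambda>x. f (\<phi> x)) = D f"
  shows "eventually (\<lambda>x. \<phi> x = x) F"
proof -
  have "\<delta> j \<in> J M" if j: "j < N" for j
  proof -
    have "(\<lambda>x. e j x - e j (\<phi> x)) \<in> M2"
    proof (rule in_M2_if_derivations_vanish)
      show "(\<lambda>x. e j x - e j (\<phi> x)) \<in> R" by (rule R_diff[OF R_e[OF j] R_\<phi>[OF R_e[OF j]]])
      show "E (\<lambda>x. e j x - e j (\<phi> x)) = 0" if "E \<in> tangent_space Y y" for E
        using tangent_space_diff[OF that R_e[OF j] R_\<phi>[OF R_e[OF j]]] D[OF that R_e[OF j]] by simp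
    qed (simp add: \<phi>y)
    from diff_JM[OF R_e[OF j] this] show ?thesis by (simp add: \<delta>_def[abs_def])
  qed
  then have "eventually (\<lambda>x. \<forall>j<N. \<delta> j x = 0) F" by (rule eventually_\<delta>_zero)
  \<comment> \<open>Equal coordinates give equal points only inside the chart, so both x and \<phi>
    x must be near enough to \<open>y\<close> to lie in \<open>A\<close>.\<close>
  moreover have evA: "eventually (\<lambda>x. x \<in> A) F"
    unfolding eventually_F using chart_openin[OF A] yA by blast
  ultimately show ?thesis using eventually_\<phi>[OF evA]
  proof eventually_elim
    case (elim x)
    have "\<xi> (\<phi> x) = \<xi> x"
      by (rule eq_vecI)
        (use elim(1) carrier_vecD[OF chart_carrier[OF A elim(2)]] carrier_vecD[OF chart_carrier[OF A elim(3)]]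
          in \<open>auto simp: \<delta>_def e_def\<close>)
    then show ?case using inj_onD[OF chart_inj[OF A]] elim by blast
  qed
qed

end


section \<open>The tangent representation at a fixed point\<close>

text \<open>Matrices of the operators in a basis of \<open>V\<close>. Linearity and the action law
  are assumed on \<open>V\<close> alone, since the ambient space here is that of all functionals and
  the tangent space is a subspace of it.\<close>

lemma (in vector_space) faithful_rep_of_linear_action:
  fixes G :: "('g, 'x) monoid_scheme"
  assumes G: "group G" and V: "subspace V" and dim: "dim V = n" and n: "n > 0"
    and T: "\<And>g v. g \<in> carrier G \<Longrightarrow> v \<in> V \<Longrightarrow> T g v \<in> V"
    and add: "\<And>g v w. g \<in> carrier G \<Longrightarrow> v \<in> V \<Longrightarrow> w \<in> V \<Longrightarrow> T g (v + w) = T g v + T g w"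
    and scale: "\<And>g c v. g \<in> carrier G \<Longrightarrow> v \<in> V \<Longrightarrow> T g (scale c v) = scale c (T g v)"
    and mult: "\<And>g h v. g \<in> carrier G \<Longrightarrow> h \<in> carrier G \<Longrightarrow> v \<in> V \<Longrightarrow> T (g \<otimes>\<^bsub>G\<^esub> h) v = T g (T h v)"
    and one: "\<And>v. v \<in> V \<Longrightarrow> T \<one>\<^bsub>G\<^esub> v = v"
    and faithful: "\<And>g. g \<in> carrier G \<Longrightarrow> (\<And>v. v \<in> V \<Longrightarrow> T g v = v) \<Longrightarrow> g = \<one>\<^bsub>G\<^esub>"
  shows "\<exists>r :: 'g \<Rightarrow> 'a mat. faithful_rep G n r"
proof -
  interpret group G by fact
  obtain B where B: "B \<subseteq> V" "independent B" "V \<subseteq> span B" "card B = dim V" by (rule basis_exists[of V])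
  \<comment> \<open>An infinite basis would have \<open>card\<close> equal to 0, which
    \<open>n > 0\<close> excludes.\<close>
  have finB: "finite B" using B(4) dim n by (metis card.infinite less_numeral_extra(3))
  obtain b where b: "bij_betw b {..<n} B"
    using ex_bij_betw_nat_finite[OF finB] B(4) dim by (auto simp: atLeast0LessThan)
  have bV: "b i \<in> V" "b i \<in> B" if "i < n" for i using bij_betwE[OF b] that B(1) by auto
  have b_inj: "b i = b j \<longleftrightarrow> i = j" if "i < n" "j < n" for i j
    using bij_betw_imp_inj_on[OF b] that by (auto dest: inj_onD)
  have spanV: "span B = V" using B(1,3) V span_minimal by blast
  define co where "co v i = representation B v (b i)" for v i
  have co_sum: "v = (\<Sum>i<n. scale (co v i) (b i))" if "v \<in> V" for v
  proof -
    have "v = (\<Sum>u\<in>B. scale (representation B v u) u)"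
      using sum_representation_eq[OF B(2) _ finB subset_refl, of v] that spanV by simp
    also have "\<dots> = (\<Sum>i<n. scale (co v i) (b i))"
      unfolding co_def by (rule sum.reindex_bij_betw[OF b, symmetric])
    finally show ?thesis .
  qed
  have co_b: "co (b j) i = (if i = j then 1 else 0)" if "i < n" "j < n" for i j
    unfolding co_def representation_basis[OF B(2) bV(2)[OF that(2)]] using b_inj[OF that] by simp
  have sumV: "(\<Sum>k\<in>K. scale (c k) (v k)) \<in> V" if "\<And>k. k \<in> K \<Longrightarrow> v k \<in> V" for K :: "nat set" and c v
    by (intro subspace_sum[OF V] subspace_scale[OF V] that)
  have co_comb: "co (\<Sum>k<n. scale (c k) (v k)) i = (\<Sum>k<n. c k * co (v k) i)"
    if "\<And>k. k < n \<Longrightarrow> v k \<in> V" for c v i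
  proof -
    have "scale (c k) (v k) \<in> span B" "v k \<in> span B" if "k \<in> {..<n}" for k
      using \<open>\<And>k. k < n \<Longrightarrow> v k \<in> V\<close> that spanV subspace_scale[OF V] by auto
    then show ?thesis unfolding co_def
      by (subst representation_sum[OF B(2)]) (auto simp: representation_scale[OF B(2)])
  qed
  have T_comb: "T g (\<Sum>k\<in>K. scale (c k) (v k)) = (\<Sum>k\<in>K. scale (c k) (T g (v k)))"
    if g: "g \<in> carrier G" and v: "\<And>k. k \<in> K \<Longrightarrow> v k \<in> V" and K: "finite K" for g K c v
    using K v
  proof (induction K)
    case empty
    have "T g 0 = T g (scale 0 0)" by simp
    also have "\<dots> = 0" using scale[OF g subspace_0[OF V], of 0] by simp
    finally show ?case by simp
  next
    case (insert k K)
    have "(\<Sum>k\<in>K. scale (c k) (v k)) \<in> V" by (intro subspace_sum[OF V] subspace_scale[OF V] insert.prems) auto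
    then show ?case
      using insert add[OF g subspace_scale[OF V]] scale[OF g] by simp
  qed
  define A where "A g = mat n n (\<lambda>(i, j). co (T g (b j)) i)" for g
  have "faithful_rep G n A"
  proof (rule faithful_repI[OF G])
    show "A g \<in> carrier_mat n n" for g by (simp add: A_def)
    show "A \<one>\<^bsub>G\<^esub> = 1\<^sub>m n" by (rule eq_matI) (auto simp: A_def one bV co_b)
    show "A (g \<otimes>\<^bsub>G\<^esub> h) = A g * A h" if gh: "g \<in> carrier G" "h \<in> carrier G" for g h
    proof (rule eq_matI)
      fix i j assume "i < dim_row (A g * A h)" "j < dim_col (A g * A h)"
      then have ij: "i < n" "j < n" by (simp_all add: A_def)
      have "T (g \<otimes>\<^bsub>G\<^esub> h) (b j) = T g (\<Sum>k<n. scale (co (T h (b j)) k) (b k))"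
        using mult[OF gh bV(1)[OF ij(2)]] co_sum[OF T[OF gh(2) bV(1)[OF ij(2)]]] by simp
      also have "\<dots> = (\<Sum>k<n. scale (co (T h (b j)) k) (T g (b k)))"
        by (rule T_comb[OF gh(1)]) (use bV in auto)
      finally have "co (T (g \<otimes>\<^bsub>G\<^esub> h) (b j)) i = (\<Sum>k<n. co (T h (b j)) k * co (T g (b k)) i)"
        using co_comb[of "\<lambda>k. T g (b k)"] T[OF gh(1) bV(1)] by simp
      also have "\<dots> = (A g * A h) $$ (i, j)"
        using ij by (simp add: A_def scalar_prod_def atLeast0LessThan mult.commute)
      finally show "A (g \<otimes>\<^bsub>G\<^esub> h) $$ (i, j) = (A g * A h) $$ (i, j)" using ij by (simp add: A_def)
    qed (simp_all add: A_def)
    show "g = \<one>\<^bsub>G\<^esub>" if g: "g \<in> carrier G" "A g = 1\<^sub>m n" for g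
    proof (rule faithful[OF g(1)])
      fix v assume v: "v \<in> V"
      have Tb: "T g (b j) = b j" if j: "j < n" for j
      proof -
        have co: "co (T g (b j)) i = (if i = j then 1 else 0)" if "i < n" for i
        proof -
          have "A g $$ (i, j) = (if i = j then 1 else 0)" using g(2) that j by simp
          then show ?thesis using that j by (simp add: A_def)
        qed
        have "T g (b j) = (\<Sum>i<n. scale (co (T g (b j)) i) (b i))"
          by (rule co_sum[OF T[OF g(1) bV(1)[OF j]]])
        also have "\<dots> = (\<Sum>i<n. if i = j then b i else 0)" by (rule sum.cong) (auto simp: co)
        finally show ?thesis using j by simp
      qed
      have "T g v = T g (\<Sum>k<n. scale (co v k) (b k))" using co_sum[OF v] by simp
      also have "\<dots> = (\<Sum>k<n. scale (co v k) (T g (b k)))" by (rule T_comb[OF g(1)]) (use bV in auto)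
      also have "\<dots> = (\<Sum>k<n. scale (co v k) (b k))" using Tb by (intro sum.cong) auto
      finally show "T g v = v" using co_sum[OF v] by simp
    qed
  qed
  then show ?thesis by blast
qed

text \<open>A polynomial relation between the pulled-back functions holds on the part of the image
  lying in \<open>V\<close>. Dominance makes the locus in \<open>V\<close> where it fails empty, so
  it is a relation between the original functions.\<close>

lemma alg_indep_pullback:
  fixes X :: "('p, 'k::field) fspace" and Y :: "('q, 'k) fspace"
  assumes X: "irreducible_variety X" and Y: "irreducible_variety Y" and c: "c \<in> rat_maps X Y" "dominant Y c"
    and ex: "\<exists>V f. openin (top Y) V \<and> V \<noteq> {} \<and> (\<forall>i<m. f i \<in> reg Y V) \<and> alg_indep_on V m f"
  shows "\<exists>U f. openin (top X) U \<and> U \<noteq> {} \<and> (\<forall>i<m. f i \<in> reg X U) \<and> alg_indep_on U m f"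
proof -
  note pY = irreducible_variety_prevariety[OF Y] note sY = irreducible_variety_sheaf[OF Y]
  obtain V f where V: "openin (top Y) V" "V \<noteq> {}" and f: "\<And>i. i < m \<Longrightarrow> f i \<in> reg Y V" and ind: "alg_indep_on V m f"
    using ex by blast
  obtain U \<phi> where U: "(U, \<phi>) \<in> c" using rat_maps_rep[OF X irreducible_variety_variety[OF Y] c(1)] by metis
  note mU = rat_maps_morphism[OF c(1) U]
  let ?U = "{x \<in> U. \<phi> x \<in> V}"
  have "alg_indep_on ?U m (\<lambda>i x. f i (\<phi> x))"
    unfolding alg_indep_on_def
  proof (intro ballI impI)
    fix p :: "'k vec \<Rightarrow> 'k" and v :: "'k vec" assume p: "p \<in> poly_fun m" "\<forall>x\<in>?U. p (vec m (\<lambda>i. f i (\<phi> x))) = 0" and v: "v \<in> carrier_vec m"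
    have r: "(\<lambda>z. p (vec m (\<lambda>i. f i z))) \<in> reg Y V"
      by (rule reg_poly_fun[OF sY V(1) p(1)]) (simp add: f)
    have "\<forall>z\<in>V. p (vec m (\<lambda>i. f i z)) = 0"
    proof (rule ccontr)
      assume "\<not> ?thesis"
      then have "{z \<in> V. p (vec m (\<lambda>i. f i z)) \<noteq> 0} \<noteq> {}" by blast
      from dominant_preimage[OF c(2) U openin_neq_0[OF pY V(1) r] this] p(2) show False by blast
    qed
    then show "p v = 0" using ind p(1) v unfolding alg_indep_on_def by blast
  qed
  moreover have "(\<lambda>x. f i (\<phi> x)) \<in> reg X ?U" if "i < m" for i
    by (rule morphism_pullback[OF mU(3,1) V(1) f[OF that]])
  ultimately show ?thesis
    using morphism_preimage[OF mU(3,1) V(1)] dominant_preimage[OF c(2) U V]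
    by (intro exI[of _ ?U] exI[of _ "\<lambda>i x. f i (\<phi> x)"] conjI allI impI)
qed

lemma vdim_birational:
  assumes X: "irreducible_variety X" and Y: "irreducible_variety Y" and c: "birational X Y c"
  shows "vdim X = vdim Y"
proof -
  obtain e where ce: "c \<in> rat_maps X Y" "dominant Y c" "e \<in> rat_maps Y X" "dominant X e"
    using c unfolding birational_def by blast
  have "(\<exists>U f. openin (top X) U \<and> U \<noteq> {} \<and> (\<forall>i<m. f i \<in> reg X U) \<and> alg_indep_on U m f) \<longleftrightarrow>
      (\<exists>V f. openin (top Y) V \<and> V \<noteq> {} \<and> (\<forall>i<m. f i \<in> reg Y V) \<and> alg_indep_on V m f)" for m
    using alg_indep_pullback[OF X Y ce(1,2)] alg_indep_pullback[OF Y X ce(3,4)] by (rule iffI[rotated])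
  then show ?thesis unfolding vdim_def by simp
qed

text \<open>Classes of everywhere defined morphisms determine their values at all points, so the
  homomorphism law for classes becomes an identity of maps on all of \<open>Y\<close>.\<close>

lemma fixed_point_automorphisms:
  assumes G: "group G" and act: "rational_action G Y \<sigma>" and y: "y \<in> fixed_points G Y \<sigma>"
  shows "\<exists>\<beta>. \<forall>g\<in>carrier G. morphism Y Y (\<beta> g) \<and> \<beta> g y = y \<and> (\<forall>x\<in>pts Y. \<beta> \<one>\<^bsub>G\<^esub> x = x) \<and>
     (\<forall>h\<in>carrier G. \<forall>x\<in>pts Y. \<beta> (g \<otimes>\<^bsub>G\<^esub> h) x = \<beta> g (\<beta> h x)) \<and>
     ((\<forall>x\<in>pts Y. \<beta> g x = x) \<longrightarrow> g = \<one>\<^bsub>G\<^esub>)"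
proof -
  interpret group G by fact
  note ra = rational_actionD[OF act] note Y = ra(1) note vY = irreducible_variety_variety[OF Y]
  have "\<forall>g\<in>carrier G. \<exists>\<phi>. automorphism Y \<phi> \<and> \<sigma> g = rat_of Y Y \<phi> \<and> \<phi> y = y"
    using y by (simp add: fixed_points_def)
  from bchoice[OF this] obtain \<beta> where
    \<beta>: "\<forall>g\<in>carrier G. automorphism Y (\<beta> g) \<and> \<sigma> g = rat_of Y Y (\<beta> g) \<and> \<beta> g y = y" by blast
  have m: "morphism Y Y (\<beta> g)" if "g \<in> carrier G" for g
    using \<beta> that unfolding automorphism_def iso_pair_def by blast
  have \<sigma>: "\<sigma> g = rat_of Y Y (\<beta> g)" if "g \<in> carrier G" for g using \<beta> that by blast
  have rep: "(pts Y, \<beta> g) \<in> \<sigma> g" if "g \<in> carrier G" for g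
    unfolding \<sigma>[OF that] by (rule rat_of_class(2)[OF Y vY m[OF that]])
  have mult: "\<beta> (g \<otimes>\<^bsub>G\<^esub> h) x = \<beta> g (\<beta> h x)" if gh: "g \<in> carrier G" "h \<in> carrier G" and x: "x \<in> pts Y" for g h x
    by (rule rat_comp_eqD[OF Y Y vY ra(2)[OF gh(2)] ra(3)[OF gh(2)] ra(2)[OF gh(1)] rep[OF gh(2)] rep[OF gh(1)]
          _ x _ x, symmetric])
       (use rep[of "g \<otimes>\<^bsub>G\<^esub> h"] ra(4)[OF gh] gh morphism_pts[OF m[OF gh(2)] x] in auto)
  have one: "\<beta> \<one>\<^bsub>G\<^esub> x = x" if x: "x \<in> pts Y" for x
  \<comment> \<open>Multiplicativity makes \<beta> of the unit idempotent, and as an automorphism it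
    is injective.\<close>
  proof -
    obtain \<psi> where \<psi>: "\<forall>x\<in>pts Y. \<psi> (\<beta> \<one>\<^bsub>G\<^esub> x) = x"
      using \<beta> one_closed unfolding automorphism_def iso_pair_def by blast
    have "\<beta> \<one>\<^bsub>G\<^esub> (\<beta> \<one>\<^bsub>G\<^esub> x) = \<beta> \<one>\<^bsub>G\<^esub> x" using mult[OF one_closed one_closed x] by simp
    then show ?thesis using \<psi> x morphism_pts[OF m[OF one_closed] x] by metis
  qed
  have faithful: "g = \<one>\<^bsub>G\<^esub>" if g: "g \<in> carrier G" "\<forall>x\<in>pts Y. \<beta> g x = x" for g
  proof -
    have "\<sigma> g = \<sigma> \<one>\<^bsub>G\<^esub>" unfolding \<sigma>[OF g(1)] \<sigma>[OF one_closed]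
      by (rule rat_of_cong[OF Y vY m[OF g(1)] m[OF one_closed]]) (use g(2) one in simp)
    then show ?thesis using ra(5) g(1) by (auto dest: inj_onD)
  qed
  show ?thesis using m mult one faithful \<beta> by (intro exI[of _ \<beta>]) blast
qed

lemma tangent_space_subspace:
  assumes "prevariety Y" "y \<in> pts Y"
  shows "fun_space.subspace (tangent_space Y y)"
proof -
  interpret germs Y y by unfold_locales fact+
  show ?thesis
  proof (rule fun_space.subspaceI)
    show "0 \<in> tangent_space Y y" by (rule tangent_spaceI) simp_all
    show "D + E \<in> tangent_space Y y" if D: "D \<in> tangent_space Y y" and E: "E \<in> tangent_space Y y" for D E
    proof (rule tangent_spaceI)
      show "(D + E) f = (D + E) g" if "f \<in> R" "g \<in> R" "eventually (\<lambda>x. f x = g x) F" for f g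
        using tangent_space_D(2)[OF D that] tangent_space_D(2)[OF E that] by simp
    qed (simp_all add: tangent_space_D(1,3-5)[OF D] tangent_space_D(1,3-5)[OF E] algebra_simps)
    show "fun_scale c D \<in> tangent_space Y y" if D: "D \<in> tangent_space Y y" for c D
    proof (rule tangent_spaceI)
      show "fun_scale c D f = fun_scale c D g" if "f \<in> R" "g \<in> R" "eventually (\<lambda>x. f x = g x) F" for f g
        using tangent_space_D(2)[OF D that] by (simp add: fun_scale_def)
    qed (simp_all add: fun_scale_def tangent_space_D(1,3-5)[OF D] algebra_simps)
  qed
qed

lemma faithful_tangent_rep:
  fixes Y :: "('p, 'k::field_char_0) fspace"
  assumes G: "group G" and fin: "finite (carrier G)" and act: "rational_action G Y \<sigma>"
    and fp: "y \<in> fixed_points G Y \<sigma>"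
    and dim: "fun_space.dim (tangent_space Y y) = n" and n: "n > 0"
  shows "\<exists>r :: 'g \<Rightarrow> 'k mat. faithful_rep G n r"
proof -
  interpret group G by fact
  note irr = rational_actionD(1)[OF act] note pY = irreducible_variety_prevariety[OF irr]
  note vY = irreducible_variety_variety[OF irr]
  have yY: "y \<in> pts Y" using fp by (simp add: fixed_points_def)
  interpret germs Y y by unfold_locales (fact pY, fact yY)
  obtain \<beta> where \<beta>: "\<forall>g\<in>carrier G. morphism Y Y (\<beta> g) \<and> \<beta> g y = y \<and> (\<forall>x\<in>pts Y. \<beta> \<one>\<^bsub>G\<^esub> x = x) \<and>
     (\<forall>h\<in>carrier G. \<forall>x\<in>pts Y. \<beta> (g \<otimes>\<^bsub>G\<^esub> h) x = \<beta> g (\<beta> h x)) \<and>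
     ((\<forall>x\<in>pts Y. \<beta> g x = x) \<longrightarrow> g = \<one>\<^bsub>G\<^esub>)"
    using fixed_point_automorphisms[OF G act fp] by blast
  have m: "morphism Y Y (\<beta> g)" and base: "\<beta> g y = y" if "g \<in> carrier G" for g using \<beta> that by blast+
  have mult: "\<beta> (g \<otimes>\<^bsub>G\<^esub> h) x = \<beta> g (\<beta> h x)" if "g \<in> carrier G" "h \<in> carrier G" "x \<in> pts Y" for g h x
    using \<beta> that by blast
  have one: "\<beta> \<one>\<^bsub>G\<^esub> x = x" if "x \<in> pts Y" for x using \<beta> one_closed that by blast
  have faithful: "g = \<one>\<^bsub>G\<^esub>" if "g \<in> carrier G" "\<forall>x\<in>pts Y. \<beta> g x = x" for g using \<beta> that by blast
  obtain A N \<xi> where A: "y \<in> A" "chart Y A N \<xi>" by (rule prevariety_chart[OF pY yY])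
  have pow: "(\<beta> g ^^ i) x = \<beta> (g [^]\<^bsub>G\<^esub> i) x" if g: "g \<in> carrier G" and x: "x \<in> pts Y" for g x and i :: nat
  proof (induction i)
    case (Suc i)
    have "(\<beta> g ^^ Suc i) x = \<beta> g (\<beta> (g [^]\<^bsub>G\<^esub> i) x)" using Suc by simp
    also have "\<dots> = \<beta> (g \<otimes>\<^bsub>G\<^esub> g [^]\<^bsub>G\<^esub> i) x" using mult[OF g nat_pow_closed[OF g] x] by simp
    also have "g \<otimes>\<^bsub>G\<^esub> g [^]\<^bsub>G\<^esub> i = g [^]\<^bsub>G\<^esub> Suc i" using g by (metis nat_pow_Suc2)
    finally show ?case .
  qed (simp add: one x)
  have ord: "Coset.order G > 0" using fin one_closed by (auto simp: Coset.order_def card_gt_0_iff)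
  \<comment> \<open>The group order is an exponent valid for every element.\<close>
  have gm: "germ_map Y y (\<beta> g) (Coset.order G) A N \<xi>" if g: "g \<in> carrier G" for g
    by unfold_locales (use m[OF g] base[OF g] ord A pow[OF g] pow_order_eq_1[OF g] one in auto)
  note R\<beta> = germ_map.R_\<phi>[OF gm] and ev\<beta> = germ_map.eventually_\<phi>[OF gm]
  let ?V = "tangent_space Y y"
  \<comment> \<open>The differential of \<beta> g. Composing twice gives f o \<beta> g o \<beta> h,
    so this is a left action; the value 0 off \<open>R\<close> is the convention built into
    \<open>tangent_space\<close>.\<close>
  define T where "T g D f = (if f \<in> R then D (\<lambda>x. f (\<beta> g x)) else 0)"
    for g and D :: "('p \<Rightarrow> 'k) \<Rightarrow> 'k" and f
  have TV: "T g D \<in> ?V" if g: "g \<in> carrier G" and D: "D \<in> ?V" for g D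
  proof (rule tangent_spaceI)
    note DD = tangent_space_D[OF D]
    show "T g D f = 0" if "f \<notin> R" for f using that by (simp add: T_def)
    show "T g D f = T g D h" if "f \<in> R" "h \<in> R" "eventually (\<lambda>x. f x = h x) F" for f h
      using that DD(2)[OF R\<beta>[OF g that(1)] R\<beta>[OF g that(2)] ev\<beta>[OF g that(3)]] by (simp add: T_def)
    show "T g D (\<lambda>x. f x + h x) = T g D f + T g D h" if "f \<in> R" "h \<in> R" for f h
      using that R_add[OF that] DD(3)[OF R\<beta>[OF g that(1)] R\<beta>[OF g that(2)]] by (simp add: T_def)
    show "T g D (\<lambda>x. c * f x) = c * T g D f" if "f \<in> R" for c f
      using that R_smult[OF that] DD(4)[OF R\<beta>[OF g that]] by (simp add: T_def)
    show "T g D (\<lambda>x. f x * h x) = f y * T g D h + h y * T g D f" if "f \<in> R" "h \<in> R" for f h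
      using that R_mult[OF that] DD(5)[OF R\<beta>[OF g that(1)] R\<beta>[OF g that(2)]] base[OF g] by (simp add: T_def)
  qed
  show ?thesis
  proof (rule fun_space.faithful_rep_of_linear_action[OF G tangent_space_subspace[OF pY yY] dim n, of T])
    show "T g D \<in> ?V" if "g \<in> carrier G" "D \<in> ?V" for g D by (rule TV[OF that])
    show "T g (D + E) = T g D + T g E" for g D E by (auto simp: T_def fun_eq_iff)
    show "T g (fun_scale c D) = fun_scale c (T g D)" for g c D by (auto simp: T_def fun_eq_iff fun_scale_def)
    show "T (g \<otimes>\<^bsub>G\<^esub> h) D = T g (T h D)" if g: "g \<in> carrier G" and h: "h \<in> carrier G" and D: "D \<in> ?V" for g h D
    proof
      fix f
      show "T (g \<otimes>\<^bsub>G\<^esub> h) D f = T g (T h D) f"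
      proof (cases "f \<in> R")
        case True
        have "eventually (\<lambda>x. f (\<beta> (g \<otimes>\<^bsub>G\<^esub> h) x) = f (\<beta> g (\<beta> h x))) F"
          unfolding eventually_F by (rule exI[of _ "pts Y"]) (use mult[OF g h] yY in auto)
        from tangent_space_D(2)[OF D R\<beta>[OF _ True] R\<beta>[OF h R\<beta>[OF g True]] this]
        show ?thesis using True R\<beta>[OF g True] g h by (simp add: T_def)
      qed (simp add: T_def)
    qed
    show "T \<one>\<^bsub>G\<^esub> D = D" if D: "D \<in> ?V" for D
    proof
      fix f
      show "T \<one>\<^bsub>G\<^esub> D f = D f"
      proof (cases "f \<in> R")
        case True
        have "eventually (\<lambda>x. f (\<beta> \<one>\<^bsub>G\<^esub> x) = f x) F"
          unfolding eventually_F by (rule exI[of _ "pts Y"]) (use one yY in auto)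
        from tangent_space_D(2)[OF D R\<beta>[OF one_closed True] True this]
        show ?thesis using True by (simp add: T_def)
      qed (simp add: T_def tangent_space_D(1)[OF D])
    qed
    show "g = \<one>\<^bsub>G\<^esub>" if g: "g \<in> carrier G" and triv: "\<And>D. D \<in> ?V \<Longrightarrow> T g D = D" for g
    proof (rule faithful[OF g])
      have "D (\<lambda>x. f (\<beta> g x)) = D f" if "D \<in> ?V" "f \<in> R" for D f
        using fun_cong[OF triv[OF that(1)], of f] that(2) by (simp add: T_def)
      then have "eventually (\<lambda>x. \<beta> g x = x) F" by (rule germ_map.eventually_fixed[OF gm[OF g]])
      then obtain W where W: "openin (top Y) W" "y \<in> W" "\<forall>x\<in>W. \<beta> g x = x" unfolding eventually_F by blast
      have mg: "morphism (open_sub Y (pts Y)) Y (\<beta> g)" using m[OF g] by simp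
      have mi: "morphism (open_sub Y (pts Y)) Y id" using morphism_id[OF sh] by simp
      \<comment> \<open>\<beta> g is the identity near \<open>y\<close>; irreducibility and
        separatedness of \<open>Y\<close> spread this to all points.\<close>
      show "\<forall>x\<in>pts Y. \<beta> g x = x"
      proof
        fix x assume x: "x \<in> pts Y"
        have "\<beta> g x = id x"
          by (rule morphism_eqI[OF irr vY openin_topspace mg mi W(1) _ openin_subset[OF W(1)] _ x]) (use W in auto)
        then show "\<beta> g x = x" by simp
      qed
    qed
  qed
qed

text \<open>Smoothness equates the dimension of the tangent space at the fixed point with that of
  the regularization, and birational invariance carries it back to \<open>X\<close>.\<close>

lemma fixed_point_rdim_le:
  fixes X :: "('p, 'k::field_char_0) fspace" and G :: "('g, 'b) monoid_scheme"
  assumes G: "group G" and fin: "finite (carrier G)" and act: "rational_action G X \<rho>"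
    and n: "vdim X > 0" and fp: "has_fixed_point G X \<rho>"
  shows "rdim TYPE('k) G \<le> vdim X"
proof -
  obtain Y :: "('k vec, 'k) fspace" and \<sigma> y where reg: "regularization G X \<rho> Y \<sigma>" and y: "y \<in> fixed_points G Y \<sigma>"
    using fp unfolding has_fixed_point_def by blast
  then have actY: "rational_action G Y \<sigma>" and smooth: "smooth_variety Y" and "\<exists>c. birational X Y c"
    unfolding regularization_def regular_action_def by blast+
  then have dim: "vdim X = vdim Y"
    using vdim_birational[OF rational_actionD(1)[OF act] rational_actionD(1)[OF actY]] by blast
  have "y \<in> pts Y" using y by (simp add: fixed_points_def)
  then have "fun_space.dim (tangent_space Y y) = vdim X" using smooth dim by (simp add: smooth_variety_def)
  from faithful_tangent_rep[OF G fin actY y this n] obtain r :: "'g \<Rightarrow> 'k mat" where "faithful_rep G (vdim X) r" by blast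
  then show ?thesis unfolding rdim_def using n by (intro Least_le) blast
qed

theorem theorem2p16:
  fixes G :: "('g, 'b) monoid_scheme"
    and X :: "('p, 'k :: {alg_closed_field, field_char_0}) fspace"
    and \<rho> :: "'g \<Rightarrow> ('p, 'p) rat_map"
    and n :: nat
  assumes "group G" and "finite (carrier G)"
    and "rational_action G X \<rho>"
    and "vdim X = n" and "n > 0"
  shows "(has_fixed_point G X \<rho> \<longrightarrow> n \<ge> rdim TYPE('k) G) \<and>
         (n > rdim TYPE('k) G \<longrightarrow> compressible_to_smaller_dim G X \<rho>) \<and>
         (\<forall>r :: 'g \<Rightarrow> 'k mat. faithful_rep G n r \<longrightarrow>
            compressible_to_smaller_dim G X \<rho> \<or>
            nontrivial_base_change G X \<rho> (affine_space n) (linear_action n r))"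
proof (intro conjI impI allI)
  show "n \<ge> rdim TYPE('k) G" if "has_fixed_point G X \<rho>"
    using fixed_point_rdim_le[OF assms(1-3) _ that] assms(4,5) by simp
  show "compressible_to_smaller_dim G X \<rho>" if less: "n > rdim TYPE('k) G"
  proof -
    obtain m and s :: "'g \<Rightarrow> 'k mat" where "m > 0" "faithful_rep G m s"
      by (rule faithful_rep_exists[OF assms(1,2)])
    then have "\<exists>m. m > 0 \<and> (\<exists>r :: 'g \<Rightarrow> 'k mat. faithful_rep G m r)" by blast
    from LeastI_ex[OF this] obtain r :: "'g \<Rightarrow> 'k mat" where r: "faithful_rep G (rdim TYPE('k) G) r"
      unfolding rdim_def by blast
    show ?thesis by (rule compressible_to_closure[OF assms(1-3) r]) (use less assms(4) in simp)
  qed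
  show "compressible_to_smaller_dim G X \<rho> \<or> nontrivial_base_change G X \<rho> (affine_space n) (linear_action n r)"
    if "faithful_rep G n r" for r :: "'g \<Rightarrow> 'k mat"
    by (rule compressible_or_base_change[OF assms(1-3) that assms(4,5)])
qed

end
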